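(* Let $\{g(t,s)\}$ be the smooth $2$-parameter family of Riemannian metrics on a smooth $n$-manifold $M$ described in the context (a Ricci flow $g(t)=g(t,0)$ varied in $s$ through solutions of the modified Ricci flow with DeTurck term $W$, with variation $h(t)=\frac{\partial}{\partial s}g(t,0)$), let $\tilde g(t,s)$, $\tilde\nabla(t,s)$, $\tilde R_{ij}(t,s)$, $\tilde h$ be the associated space-time metric, connection, Ricci tensor, and space-time extension of $h$, and let $\tilde W$ be the space-time $1$-form with $\tilde W_k=W_k$ for $k\ge1$ and $\tilde W_0=\sum_{p=1}^n\nabla^pW_p$. Then on $M\times[0,T)\times\{0\}$ (that is, at $s=0$), for all $0\le i,j\le n$, $$\frac{\partial}{\partial s}\left(-2\tilde R_{ij}+\tilde\nabla_i\tilde W_j+\tilde\nabla_j\tilde W_i\right)=\tilde\Delta\tilde h_{ij}+2\tilde R^q_{pij}\tilde h_{pq}-\tilde R_{iq}\tilde h_{jq}-\tilde R_{jq}\tilde h_{iq}.$$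
   Context: Setting. $g(t)$, $t\in[0,T)$, is a solution of the Ricci flow $\frac{\partial}{\partial t}g_{ij}=-2R_{ij}$ on $M$ with $g(0)=g_0$, and $h(t)$ is a symmetric $2$-tensor solving $\frac{\partial}{\partial t}h_{ij}=\Delta h_{ij}+2R_{pijq}h_{pq}-R_{iq}h_{jq}-R_{jq}h_{iq}$ with $h(0)=h_0$. The smooth $2$-parameter family of metrics $g(t,s)$, $t\in[0,T)$, $s$ near $0$, satisfies $$\frac{\partial}{\partial t}g_{ij}(t,s)=(-2R_{ij}+\nabla_iW_j+\nabla_jW_i)(t,s),\qquad W^k(t,s)=g^{ij}(t,s)\left(\Gamma_{ij}^k(t,s)-\Gamma_{ij}^k(t,0)\right),$$ with $g(0,0)=g_0$ and $\frac{\partial}{\partial s}g(0,0)=h_0$, where curvature, $\nabla$ and $\Gamma^k_{ij}(t,s)$ on the right are those of $g(t,s)$ and $W_j=g_{jk}W^k$. Moreover $g(t,0)=g(t)$ and $\frac{\partial}{\partial s}g_{ij}(t,0)=h_{ij}(t)$ for all $t\in[0,T)$. Coordinates on $\tilde M=M\times[0,T)$ are $(x^0=t,x^1,\dots,x^n)$ with $x^1,\dots,x^n$ local coordinates on $M$. For each $s$, the degenerate space-time metric on $T^*\tilde M$ is $\tilde g^{ij}=g^{ij}$ if $i,j\ge1$ and $\tilde g^{ij}=0$ if $i=0$ or $j=0$ (with $g=g(t,s)$); the space-time connection $\tilde\nabla=\tilde\nabla(t,s)$ is the symmetric connection ($\tilde\Gamma_{ij}^k=\tilde\Gamma_{ji}^k$)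 with $\tilde\Gamma^k_{ij}=\Gamma^k_{ij}$ if $i,j,k\ge1$; $\tilde\Gamma^0_{ij}=0$ if $i,j\ge0$; $\tilde\Gamma^k_{i0}=-R^k_i+\nabla_iW^k$ if $i,k\ge1$; $\tilde\Gamma^k_{00}=-\frac12\nabla^k(R+|W|^2)+g^{kp}\frac{\partial}{\partial t}W_p$ if $k\ge1$, all with respect to $g(t,s)$. Its curvatures are $\tilde R^l_{ijk}=\partial_i\tilde\Gamma^l_{jk}-\partial_j\tilde\Gamma^l_{ik}+\tilde\Gamma^p_{jk}\tilde\Gamma^l_{ip}-\tilde\Gamma^p_{ik}\tilde\Gamma^l_{jp}$ and $\tilde R_{jk}=\tilde R^p_{pjk}$ (indices from $0$ to $n$); the same conventions are used on $M$, with $R_{ijkl}=g_{lm}R^m_{ijk}$. $\tilde\Delta=\tilde g^{ij}\tilde\nabla_i\tilde\nabla_j$. The space-time extension of $h$ (formed with $g(t)=g(t,0)$) is the symmetric $2$-tensor on $\tilde M$ with $\tilde h_{ij}=h_{ij}$ if $i,j\ge1$; $\tilde h_{0j}=\tilde h_{j0}=\mathrm{div}(h)_j=g^{pq}\nabla_ph_{qj}$ if $j\ge1$; $\tilde h_{00}=\mathrm{div}(\mathrm{div}(h))+Rc\cdot h$, where $\mathrm{div}(\mathrm{div}(h))=g^{jk}\nabla_j\mathrm{div}(h)_k$ and $Rc\cdot h=g^{ip}g^{jq}R_{ij}h_{pq}$. Repeated lower indices are contracted with $g^{-1}$ (space tensors) or $\tilde g$ (space-time tensors): $\tilde R^q_{pij}\tilde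 h_{pq}=\tilde g^{pr}\tilde R^q_{pij}\tilde h_{rq}$, $\tilde R_{iq}\tilde h_{jq}=\tilde g^{qr}\tilde R_{iq}\tilde h_{jr}$. *)

theory Defs
  imports "HOL-Analysis.Analysis"
begin

section \<open>Smooth maps\<close>

primrec Ck_on :: "nat \<Rightarrow> 'a::euclidean_space set \<Rightarrow> ('a \<Rightarrow> 'b::euclidean_space) \<Rightarrow> bool" where
  "Ck_on 0 V f \<longleftrightarrow> continuous_on V f"
| "Ck_on (Suc k) V f \<longleftrightarrow>
     (\<forall>x\<in>V. f differentiable (at x)) \<and> (\<forall>v. Ck_on k V (\<lambda>x. frechet_derivative f (at x) v))"

text \<open>\<^const>\<open>Ck_on\<close> is meant for open sets. On an arbitrary set, such as a product with the half-open
  time interval \<open>[0,T)\<close>, a map is smooth if near every point it has a smooth extension.\<close>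

definition smooth_on :: "'a::euclidean_space set \<Rightarrow> ('a \<Rightarrow> 'b::euclidean_space) \<Rightarrow> bool" where
  "smooth_on S f \<longleftrightarrow>
     (\<forall>x\<in>S. \<exists>V F. open V \<and> x \<in> V \<and> (\<forall>k. Ck_on k V F) \<and> (\<forall>y\<in>S \<inter> V. F y = f y))"

definition pd :: "'n::finite \<Rightarrow> (real^'n \<Rightarrow> real) \<Rightarrow> real^'n \<Rightarrow> real" where
  "pd i f x = vector_derivative (\<lambda>r. f (x + r *\<^sub>R axis i 1)) (at 0)"


section \<open>Smooth manifolds and 2-tensors\<close>

type_synonym ('m, 'n) chart = "'m set \<times> ('m \<Rightarrow> real^'n)"

abbreviation chart_dom :: "('m, 'n) chart \<Rightarrow> 'm set" where
  "chart_dom c \<equiv> fst c"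

abbreviation chart_map :: "('m, 'n) chart \<Rightarrow> 'm \<Rightarrow> real^'n" where
  "chart_map c \<equiv> snd c"

definition chart_img :: "('m, 'n) chart \<Rightarrow> (real^'n) set" where
  "chart_img c = chart_map c ` chart_dom c"

definition is_chart :: "'m topology \<Rightarrow> ('m, 'n::finite) chart \<Rightarrow> bool" where
  "is_chart M c \<longleftrightarrow> openin M (chart_dom c) \<and> open (chart_img c) \<and>
     homeomorphic_map (subtopology M (chart_dom c)) (top_of_set (chart_img c)) (chart_map c)"

definition transition :: "('m, 'n) chart \<Rightarrow> ('m, 'n) chart \<Rightarrow> real^'n \<Rightarrow> real^'n" where
  "transition a b x = chart_map b (inv_into (chart_dom a) (chart_map a) x)"

text \<open>The atlas need not be maximal; every chart compatible with it may be a member.\<close>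

definition smooth_manifold :: "'m topology \<Rightarrow> ('m, 'n::finite) chart set \<Rightarrow> bool" where
  "smooth_manifold M A \<longleftrightarrow>
     Hausdorff_space M \<and> second_countable M \<and>
     (\<forall>c\<in>A. is_chart M c) \<and> topspace M = (\<Union>c\<in>A. chart_dom c) \<and>
     (\<forall>a\<in>A. \<forall>b\<in>A. smooth_on (chart_map a ` (chart_dom a \<inter> chart_dom b)) (transition a b))"

text \<open>A covariant 2-tensor field is the family of its component matrices in the charts of the atlas;
  \<open>h c x $ i $ j\<close> is the component \<open>h\<^sub>i\<^sub>j\<close> in the chart \<open>c\<close> at the point with coordinates \<open>x\<close>.\<close>

type_synonym ('m, 'n) tensor2 = "('m, 'n) chart \<Rightarrow> real^'n \<Rightarrow> real^'n^'n"

definition is_tensor2 :: "('m, 'n::finite) chart set \<Rightarrow> ('m, 'n) tensor2 \<Rightarrow> bool" where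
  "is_tensor2 A h \<longleftrightarrow>
     (\<forall>a\<in>A. \<forall>b\<in>A. \<forall>p \<in> chart_dom a \<inter> chart_dom b. \<forall>i j.
        h a (chart_map a p) $ i $ j =
          (\<Sum>k\<in>UNIV. \<Sum>l\<in>UNIV.
             pd i (\<lambda>x. transition a b x $ k) (chart_map a p) *
             pd j (\<lambda>x. transition a b x $ l) (chart_map a p) *
             h b (chart_map b p) $ k $ l))"

definition is_sym_tensor2 :: "('m, 'n::finite) chart set \<Rightarrow> ('m, 'n) tensor2 \<Rightarrow> bool" where
  "is_sym_tensor2 A h \<longleftrightarrow> is_tensor2 A h \<and>
     (\<forall>c\<in>A. \<forall>x\<in>chart_img c. \<forall>i j. h c x $ i $ j = h c x $ j $ i)"

definition is_metric :: "('m, 'n::finite) chart set \<Rightarrow> ('m, 'n) tensor2 \<Rightarrow> bool" where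
  "is_metric A g \<longleftrightarrow> is_sym_tensor2 A g \<and>
     (\<forall>c\<in>A. \<forall>x\<in>chart_img c. \<forall>v. v \<noteq> 0 \<longrightarrow> 0 < v \<bullet> (g c x *v v))"

definition tensor2_eq :: "('m, 'n::finite) chart set \<Rightarrow> ('m, 'n) tensor2 \<Rightarrow> ('m, 'n) tensor2 \<Rightarrow> bool"
  where "tensor2_eq A h k \<longleftrightarrow> (\<forall>c\<in>A. \<forall>x\<in>chart_img c. h c x = k c x)"

definition smooth_tensor2 :: "('m, 'n::finite) chart set \<Rightarrow> ('m, 'n) tensor2 \<Rightarrow> bool" where
  "smooth_tensor2 A h \<longleftrightarrow> (\<forall>c\<in>A. smooth_on (chart_img c) (h c))"

definition smooth_family1 ::
    "('m, 'n::finite) chart set \<Rightarrow> real set \<Rightarrow> (real \<Rightarrow> ('m, 'n) tensor2) \<Rightarrow> bool" where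
  "smooth_family1 A I h \<longleftrightarrow>
     (\<forall>c\<in>A. smooth_on (I \<times> chart_img c) (\<lambda>(t, x). h t c x))"

definition smooth_family2 ::
    "('m, 'n::finite) chart set \<Rightarrow> real set \<Rightarrow> real set \<Rightarrow> (real \<Rightarrow> real \<Rightarrow> ('m, 'n) tensor2) \<Rightarrow> bool"
  where
  "smooth_family2 A I J g \<longleftrightarrow>
     (\<forall>c\<in>A. smooth_on (I \<times> J \<times> chart_img c) (\<lambda>(t, s, x). g t s c x))"


section \<open>Connections in coordinates\<close>

text \<open>The following are used both on \<open>M\<close> (indices \<^typ>\<open>'n\<close>) and on space-time (indices
  \<^typ>\<open>'n option\<close>). \<open>D i\<close> is the \<open>i\<close>-th partial derivative, \<open>C p k i j\<close> is \<open>\<Gamma>\<^sup>k\<^sub>i\<^sub>j\<close> at \<open>p\<close>,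
  \<open>gi p a b\<close> is \<open>g\<^sup>a\<^sup>b\<close> at \<open>p\<close> (possibly degenerate), and
  \<open>curv D C p l i j k\<close> is \<open>R\<^sup>l\<^sub>i\<^sub>j\<^sub>k\<close>. In the covariant derivatives the derivative index comes first:
  \<open>cov1 D C w p i j\<close> is \<open>\<nabla>\<^sub>i w\<^sub>j\<close>, \<open>cov2 D C h p a i j\<close> is \<open>\<nabla>\<^sub>a h\<^sub>i\<^sub>j\<close>.\<close>

type_synonym ('i, 'p) pderiv = "'i \<Rightarrow> ('p \<Rightarrow> real) \<Rightarrow> 'p \<Rightarrow> real"

type_synonym ('i, 'p) conn = "'p \<Rightarrow> 'i \<Rightarrow> 'i \<Rightarrow> 'i \<Rightarrow> real"

definition curv :: "('i::finite, 'p) pderiv \<Rightarrow> ('i, 'p) conn \<Rightarrow> 'p \<Rightarrow> 'i \<Rightarrow> 'i \<Rightarrow> 'i \<Rightarrow> 'i \<Rightarrow> real" where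
  "curv D C p l i j k =
     D i (\<lambda>q. C q l j k) p - D j (\<lambda>q. C q l i k) p
     + (\<Sum>m\<in>UNIV. C p m j k * C p l i m) - (\<Sum>m\<in>UNIV. C p m i k * C p l j m)"

definition ric :: "('i::finite, 'p) pderiv \<Rightarrow> ('i, 'p) conn \<Rightarrow> 'p \<Rightarrow> 'i \<Rightarrow> 'i \<Rightarrow> real" where
  "ric D C p j k = (\<Sum>m\<in>UNIV. curv D C p m m j k)"

definition cov1 :: "('i::finite, 'p) pderiv \<Rightarrow> ('i, 'p) conn \<Rightarrow>
    ('p \<Rightarrow> 'i \<Rightarrow> real) \<Rightarrow> 'p \<Rightarrow> 'i \<Rightarrow> 'i \<Rightarrow> real" where
  "cov1 D C w p i j = D i (\<lambda>q. w q j) p - (\<Sum>m\<in>UNIV. C p m i j * w p m)"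

definition cov2 :: "('i::finite, 'p) pderiv \<Rightarrow> ('i, 'p) conn \<Rightarrow>
    ('p \<Rightarrow> 'i \<Rightarrow> 'i \<Rightarrow> real) \<Rightarrow> 'p \<Rightarrow> 'i \<Rightarrow> 'i \<Rightarrow> 'i \<Rightarrow> real" where
  "cov2 D C h p a i j =
     D a (\<lambda>q. h q i j) p
     - (\<Sum>m\<in>UNIV. C p m a i * h p m j) - (\<Sum>m\<in>UNIV. C p m a j * h p i m)"

definition cov3 :: "('i::finite, 'p) pderiv \<Rightarrow> ('i, 'p) conn \<Rightarrow>
    ('p \<Rightarrow> 'i \<Rightarrow> 'i \<Rightarrow> 'i \<Rightarrow> real) \<Rightarrow> 'p \<Rightarrow> 'i \<Rightarrow> 'i \<Rightarrow> 'i \<Rightarrow> 'i \<Rightarrow> real" where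
  "cov3 D C k p a b i j =
     D a (\<lambda>q. k q b i j) p
     - (\<Sum>m\<in>UNIV. C p m a b * k p m i j)
     - (\<Sum>m\<in>UNIV. C p m a i * k p b m j) - (\<Sum>m\<in>UNIV. C p m a j * k p b i m)"

definition laplace2 :: "('i::finite, 'p) pderiv \<Rightarrow> ('i, 'p) conn \<Rightarrow> ('p \<Rightarrow> 'i \<Rightarrow> 'i \<Rightarrow> real) \<Rightarrow>
    ('p \<Rightarrow> 'i \<Rightarrow> 'i \<Rightarrow> real) \<Rightarrow> 'p \<Rightarrow> 'i \<Rightarrow> 'i \<Rightarrow> real" where
  "laplace2 D C gi h p i j = (\<Sum>a\<in>UNIV. \<Sum>b\<in>UNIV. gi p a b * cov3 D C (cov2 D C h) p a b i j)"


section \<open>Geometry of a metric in a chart\<close>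

type_synonym 'n lmetric = "real^'n \<Rightarrow> real^'n^'n"

definition ginv :: "'n::finite lmetric \<Rightarrow> real^'n \<Rightarrow> 'n \<Rightarrow> 'n \<Rightarrow> real" where
  "ginv G x i j = matrix_inv (G x) $ i $ j"

definition christoffel :: "'n::finite lmetric \<Rightarrow> ('n, real^'n) conn" where
  "christoffel G x k i j =
     1/2 * (\<Sum>l\<in>UNIV. ginv G x k l *
       (pd i (\<lambda>y. G y $ j $ l) x + pd j (\<lambda>y. G y $ i $ l) x - pd l (\<lambda>y. G y $ i $ j) x))"

definition Rc :: "'n::finite lmetric \<Rightarrow> real^'n \<Rightarrow> 'n \<Rightarrow> 'n \<Rightarrow> real" where
  "Rc G = ric pd (christoffel G)"

definition Rm_low :: "'n::finite lmetric \<Rightarrow> real^'n \<Rightarrow> 'n \<Rightarrow> 'n \<Rightarrow> 'n \<Rightarrow> 'n \<Rightarrow> real" where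
  "Rm_low G x i j k l = (\<Sum>m\<in>UNIV. G x $ l $ m * curv pd (christoffel G) x m i j k)"

definition scal :: "'n::finite lmetric \<Rightarrow> real^'n \<Rightarrow> real" where
  "scal G x = (\<Sum>i\<in>UNIV. \<Sum>j\<in>UNIV. ginv G x i j * Rc G x i j)"

definition div2 :: "'n::finite lmetric \<Rightarrow> 'n lmetric \<Rightarrow> real^'n \<Rightarrow> 'n \<Rightarrow> real" where
  "div2 G h x j =
     (\<Sum>p\<in>UNIV. \<Sum>q\<in>UNIV. ginv G x p q * cov2 pd (christoffel G) (\<lambda>y a b. h y $ a $ b) x p q j)"

definition div1 :: "'n::finite lmetric \<Rightarrow> (real^'n \<Rightarrow> 'n \<Rightarrow> real) \<Rightarrow> real^'n \<Rightarrow> real" where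
  "div1 G w x = (\<Sum>j\<in>UNIV. \<Sum>k\<in>UNIV. ginv G x j k * cov1 pd (christoffel G) w x j k)"

definition Rc_dot :: "'n::finite lmetric \<Rightarrow> 'n lmetric \<Rightarrow> real^'n \<Rightarrow> real" where
  "Rc_dot G h x =
     (\<Sum>i\<in>UNIV. \<Sum>j\<in>UNIV. \<Sum>p\<in>UNIV. \<Sum>q\<in>UNIV.
        ginv G x i p * ginv G x j q * Rc G x i j * h x $ p $ q)"

text \<open>\<open>\<Delta>h\<^sub>i\<^sub>j + 2 R\<^sub>p\<^sub>i\<^sub>j\<^sub>q h\<^sub>p\<^sub>q - R\<^sub>i\<^sub>q h\<^sub>j\<^sub>q - R\<^sub>j\<^sub>q h\<^sub>i\<^sub>q\<close>, repeated lower indices being contracted with the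
  inverse metric.\<close>

definition linearized_rhs :: "'n::finite lmetric \<Rightarrow> 'n lmetric \<Rightarrow> real^'n \<Rightarrow> 'n \<Rightarrow> 'n \<Rightarrow> real" where
  "linearized_rhs G h x i j =
     laplace2 pd (christoffel G) (ginv G) (\<lambda>y a b. h y $ a $ b) x i j
     + 2 * (\<Sum>p\<in>UNIV. \<Sum>q\<in>UNIV. \<Sum>a\<in>UNIV. \<Sum>b\<in>UNIV.
              ginv G x p a * ginv G x q b * Rm_low G x p i j q * h x $ a $ b)
     - (\<Sum>q\<in>UNIV. \<Sum>r\<in>UNIV. ginv G x q r * Rc G x i q * h x $ j $ r)
     - (\<Sum>q\<in>UNIV. \<Sum>r\<in>UNIV. ginv G x q r * Rc G x j q * h x $ i $ r)"

text \<open>The vector field \<open>W\<close> of the metric \<open>G\<close> relative to the background metric \<open>B\<close>, and the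
  corresponding 1-form.\<close>

definition W_up :: "'n::finite lmetric \<Rightarrow> 'n lmetric \<Rightarrow> real^'n \<Rightarrow> 'n \<Rightarrow> real" where
  "W_up G B x k =
     (\<Sum>i\<in>UNIV. \<Sum>j\<in>UNIV. ginv G x i j * (christoffel G x k i j - christoffel B x k i j))"

definition W_low :: "'n::finite lmetric \<Rightarrow> 'n lmetric \<Rightarrow> real^'n \<Rightarrow> 'n \<Rightarrow> real" where
  "W_low G B x j = (\<Sum>k\<in>UNIV. G x $ j $ k * W_up G B x k)"

definition W_normsq :: "'n::finite lmetric \<Rightarrow> 'n lmetric \<Rightarrow> real^'n \<Rightarrow> real" where
  "W_normsq G B x = (\<Sum>i\<in>UNIV. \<Sum>j\<in>UNIV. G x $ i $ j * W_up G B x i * W_up G B x j)"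


section \<open>The evolution equations\<close>

text \<open>\<open>[0,T)\<close>, where \<open>T = \<infinity>\<close> is allowed. Time derivatives are taken within this interval, hence
  one-sided at \<open>0\<close>.\<close>

definition time_ivl :: "ereal \<Rightarrow> real set" where
  "time_ivl T = {t. 0 \<le> t \<and> ereal t < T}"

definition ricci_flow ::
    "('m, 'n::finite) chart set \<Rightarrow> real set \<Rightarrow> (real \<Rightarrow> ('m, 'n) tensor2) \<Rightarrow> bool" where
  "ricci_flow A I g \<longleftrightarrow>
     (\<forall>c\<in>A. \<forall>t\<in>I. \<forall>x\<in>chart_img c. \<forall>i j.
        ((\<lambda>\<tau>. g \<tau> c x $ i $ j) has_real_derivative - 2 * Rc (g t c) x i j) (at t within I))"

definition linearized_ricci_flow ::
    "('m, 'n::finite) chart set \<Rightarrow> real set \<Rightarrow>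
     (real \<Rightarrow> ('m, 'n) tensor2) \<Rightarrow> (real \<Rightarrow> ('m, 'n) tensor2) \<Rightarrow> bool" where
  "linearized_ricci_flow A I g h \<longleftrightarrow>
     (\<forall>c\<in>A. \<forall>t\<in>I. \<forall>x\<in>chart_img c. \<forall>i j.
        ((\<lambda>\<tau>. h \<tau> c x $ i $ j) has_real_derivative linearized_rhs (g t c) (h t c) x i j)
          (at t within I))"

definition modified_ricci_flow ::
    "('m, 'n::finite) chart set \<Rightarrow> real set \<Rightarrow> real set \<Rightarrow>
     (real \<Rightarrow> real \<Rightarrow> ('m, 'n) tensor2) \<Rightarrow> bool" where
  "modified_ricci_flow A I J g \<longleftrightarrow>
     (\<forall>c\<in>A. \<forall>t\<in>I. \<forall>s\<in>J. \<forall>x\<in>chart_img c. \<forall>i j.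
        ((\<lambda>\<tau>. g \<tau> s c x $ i $ j) has_real_derivative
           - 2 * Rc (g t s c) x i j
           + cov1 pd (christoffel (g t s c)) (W_low (g t s c) (g t 0 c)) x i j
           + cov1 pd (christoffel (g t s c)) (W_low (g t s c) (g t 0 c)) x j i)
          (at t within I))"

definition variation_at_0 ::
    "('m, 'n::finite) chart set \<Rightarrow> (real \<Rightarrow> ('m, 'n) tensor2) \<Rightarrow> ('m, 'n) tensor2 \<Rightarrow> bool" where
  "variation_at_0 A g h \<longleftrightarrow>
     (\<forall>c\<in>A. \<forall>x\<in>chart_img c. \<forall>i j.
        ((\<lambda>s. g s c x $ i $ j) has_real_derivative h c x $ i $ j) (at 0))"


section \<open>Space-time\<close>

text \<open>A space-time point is \<open>(t, x)\<close>; the space-time index \<^term>\<open>None\<close> is the index \<open>0\<close>, and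
  \<^term>\<open>Some i\<close> is the spatial index \<open>i\<close>. \<open>I\<close> is the time interval, and \<open>G\<close>, \<open>B\<close> are the
  time-dependent component matrices of \<open>g(t,s)\<close> (with \<open>s\<close> fixed) and \<open>g(t,0)\<close> in a chart.\<close>

type_synonym 'n stpt = "real \<times> (real^'n)"

definition st_pd :: "real set \<Rightarrow> ('n::finite option, 'n stpt) pderiv" where
  "st_pd I a f p =
     (case a of
        None \<Rightarrow> vector_derivative (\<lambda>\<tau>. f (\<tau>, snd p)) (at (fst p) within I)
      | Some i \<Rightarrow> pd i (\<lambda>y. f (fst p, y)) (snd p))"

definition st_ginv :: "(real \<Rightarrow> 'n::finite lmetric) \<Rightarrow> 'n stpt \<Rightarrow> 'n option \<Rightarrow> 'n option \<Rightarrow> real" where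
  "st_ginv G p a b =
     (case (a, b) of (Some i, Some j) \<Rightarrow> ginv (G (fst p)) (snd p) i j | _ \<Rightarrow> 0)"

text \<open>\<open>- R\<^sup>k\<^sub>i + \<nabla>\<^sub>i W\<^sup>k\<close> and \<open>- 1/2 \<nabla>\<^sup>k (R + |W|\<^sup>2) + g\<^sup>k\<^sup>p \<partial>\<^sub>t W\<^sub>p\<close>\<close>

definition st_conn_mixed :: "'n::finite lmetric \<Rightarrow> 'n lmetric \<Rightarrow> real^'n \<Rightarrow> 'n \<Rightarrow> 'n \<Rightarrow> real" where
  "st_conn_mixed G B x k i =
     - (\<Sum>l\<in>UNIV. ginv G x k l * Rc G x i l)
     + (pd i (\<lambda>y. W_up G B y k) x + (\<Sum>m\<in>UNIV. christoffel G x k i m * W_up G B x m))"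

definition st_conn_time :: "real set \<Rightarrow> (real \<Rightarrow> 'n::finite lmetric) \<Rightarrow> (real \<Rightarrow> 'n lmetric) \<Rightarrow>
    'n stpt \<Rightarrow> 'n \<Rightarrow> real" where
  "st_conn_time I G B p k =
     - 1/2 * (\<Sum>l\<in>UNIV. ginv (G (fst p)) (snd p) k l *
         pd l (\<lambda>y. scal (G (fst p)) y + W_normsq (G (fst p)) (B (fst p)) y) (snd p))
     + (\<Sum>l\<in>UNIV. ginv (G (fst p)) (snd p) k l *
         vector_derivative (\<lambda>\<tau>. W_low (G \<tau>) (B \<tau>) (snd p) l) (at (fst p) within I))"

definition st_conn :: "real set \<Rightarrow> (real \<Rightarrow> 'n::finite lmetric) \<Rightarrow> (real \<Rightarrow> 'n lmetric) \<Rightarrow>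
    ('n option, 'n stpt) conn" where
  "st_conn I G B p c a b =
     (case c of
        None \<Rightarrow> 0
      | Some k \<Rightarrow>
          (case (a, b) of
             (Some i, Some j) \<Rightarrow> christoffel (G (fst p)) (snd p) k i j
           | (Some i, None) \<Rightarrow> st_conn_mixed (G (fst p)) (B (fst p)) (snd p) k i
           | (None, Some i) \<Rightarrow> st_conn_mixed (G (fst p)) (B (fst p)) (snd p) k i
           | (None, None) \<Rightarrow> st_conn_time I G B p k))"

definition st_W :: "(real \<Rightarrow> 'n::finite lmetric) \<Rightarrow> (real \<Rightarrow> 'n lmetric) \<Rightarrow>
    'n stpt \<Rightarrow> 'n option \<Rightarrow> real" where
  "st_W G B p a =
     (case a of
        None \<Rightarrow> div1 (G (fst p)) (W_low (G (fst p)) (B (fst p))) (snd p)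
      | Some k \<Rightarrow> W_low (G (fst p)) (B (fst p)) (snd p) k)"

definition st_ext :: "(real \<Rightarrow> 'n::finite lmetric) \<Rightarrow> (real \<Rightarrow> 'n lmetric) \<Rightarrow>
    'n stpt \<Rightarrow> 'n option \<Rightarrow> 'n option \<Rightarrow> real" where
  "st_ext G h p a b =
     (let g = G (fst p); k = h (fst p); x = snd p in
      case (a, b) of
        (Some i, Some j) \<Rightarrow> k x $ i $ j
      | (None, Some j) \<Rightarrow> div2 g k x j
      | (Some j, None) \<Rightarrow> div2 g k x j
      | (None, None) \<Rightarrow> div1 g (div2 g k) x + Rc_dot g k x)"

text \<open>\<open>-2 R\<^sub>i\<^sub>j + \<nabla>\<^sub>i W\<^sub>j + \<nabla>\<^sub>j W\<^sub>i\<close> for the space-time connection\<close>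

definition st_flow_rhs :: "real set \<Rightarrow> (real \<Rightarrow> 'n::finite lmetric) \<Rightarrow> (real \<Rightarrow> 'n lmetric) \<Rightarrow>
    'n stpt \<Rightarrow> 'n option \<Rightarrow> 'n option \<Rightarrow> real" where
  "st_flow_rhs I G B p i j =
     - 2 * ric (st_pd I) (st_conn I G B) p i j
     + cov1 (st_pd I) (st_conn I G B) (st_W G B) p i j
     + cov1 (st_pd I) (st_conn I G B) (st_W G B) p j i"

text \<open>\<open>\<Delta>h\<^sub>i\<^sub>j + 2 R\<^sup>q\<^sub>p\<^sub>i\<^sub>j h\<^sub>p\<^sub>q - R\<^sub>i\<^sub>q h\<^sub>j\<^sub>q - R\<^sub>j\<^sub>q h\<^sub>i\<^sub>q\<close> for the space-time connection at \<open>s = 0\<close>, with repeated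
  lower indices contracted with the degenerate metric and \<open>h\<close> standing for its space-time extension\<close>

definition st_linearized_rhs :: "real set \<Rightarrow> (real \<Rightarrow> 'n::finite lmetric) \<Rightarrow> (real \<Rightarrow> 'n lmetric) \<Rightarrow>
    'n stpt \<Rightarrow> 'n option \<Rightarrow> 'n option \<Rightarrow> real" where
  "st_linearized_rhs I G h p i j =
     (let D = st_pd I; C = st_conn I G G; gi = st_ginv G; hh = st_ext G h in
      laplace2 D C gi hh p i j
      + 2 * (\<Sum>a\<in>UNIV. \<Sum>q\<in>UNIV. \<Sum>r\<in>UNIV. gi p a r * curv D C p q a i j * hh p r q)
      - (\<Sum>q\<in>UNIV. \<Sum>r\<in>UNIV. gi p q r * ric D C p i q * hh p j r)
      - (\<Sum>q\<in>UNIV. \<Sum>r\<in>UNIV. gi p q r * ric D C p j q * hh p i r))"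

end

(* The space-time connection at s = 0 is symmetric and preserves the degenerate metric on
   1-forms. By commuting the s- and t-derivatives in the modified Ricci flow one finds that its
   variation is 1/2 g^{kl} (nabla_i h_{jl} + nabla_j h_{il} - nabla_l h_{ij}), and that the variation
   of the space-time 1-form W is div h - 1/2 d tr h, where nabla, h, g, div and tr are all taken in
   space-time: these are the formulas for the Levi-Civita connection and for DeTurck's 1-form. The
   usual linearization of the Ricci-DeTurck operator therefore applies verbatim; it uses only the
   variation of the Ricci tensor of a symmetric connection, the commutator of second covariant
   derivatives, the first Bianchi identity and the skewness of the curvature with respect to the
   degenerate metric. In particular no evolution equation of curvature is needed. *)

theory Submission
  imports Defs
begin

section \<open>Calculus of symmetric connections\<close>

text \<open>The locale \<open>metric_variation\<close> is instantiated twice. Its spatial instance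
  supplies the variations of Ric and of nabla W, and with these the hypotheses \<open>var_C\<close>
  and \<open>var_W\<close> of the space-time instance are checked component by component. The check
  shows where the (0,0) component of \<open>hh\<close> comes from: with \<open>H\<close> the trace
  of h and w the variation of W one has w = div h - 1/2 dH, while the variation of the (0,0)
  connection coefficient contains dt w - 1/2 d(\<delta> R). Matching forces the spatial gradient of
  that component to be the gradient of dt H + \<delta> R, and this sum equals div div h + Rc.h.

  Many identities (such as W = 0) are known on the slice s = 0 only. They may be differentiated
  along the slice, so \<open>smooth_calculus\<close> keeps \<open>S0\<close> apart from
  \<open>S\<close> and has \<open>D_cong0\<close>; congruence under \<open>\<delta>\<close> is
  applied to identities on all of \<open>S\<close>.

  Since [0,T) is not open, derivatives at t = 0 are one-sided. The calculus therefore works with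
  abstract derivations, which are realised by directional derivatives of local smooth extensions;
  there second derivatives commute.\<close>

locale derivation =
  fixes S :: "'p set" and sm :: "('p \<Rightarrow> real) \<Rightarrow> bool" and d :: "('p \<Rightarrow> real) \<Rightarrow> 'p \<Rightarrow> real"
  assumes sm_d [simp]: "sm f \<Longrightarrow> sm (d f)"
    and d_const [simp]: "p \<in> S \<Longrightarrow> d (\<lambda>q. c) p = 0"
    and d_add [simp]: "sm f \<Longrightarrow> sm f' \<Longrightarrow> p \<in> S \<Longrightarrow> d (\<lambda>q. f q + f' q) p = d f p + d f' p"
    and d_mult [simp]: "sm f \<Longrightarrow> sm f' \<Longrightarrow> p \<in> S \<Longrightarrow>
      d (\<lambda>q. f q * f' q) p = d f p * f' p + f p * d f' p"
    and d_cong: "(\<And>q. q \<in> S \<Longrightarrow> f q = f' q) \<Longrightarrow> p \<in> S \<Longrightarrow> d f p = d f' p"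

locale smooth_functions =
  fixes sm :: "('p \<Rightarrow> real) \<Rightarrow> bool"
  assumes sm_const [simp]: "sm (\<lambda>q. c)"
    and sm_add [simp]: "sm f \<Longrightarrow> sm f' \<Longrightarrow> sm (\<lambda>q. f q + f' q)"
    and sm_mult [simp]: "sm f \<Longrightarrow> sm f' \<Longrightarrow> sm (\<lambda>q. f q * f' q)"
begin

lemma sm_minus [simp]: "sm f \<Longrightarrow> sm (\<lambda>q. - f q)"
  using sm_mult[of "\<lambda>q. -1" f] by simp

lemma sm_diff [simp]: "sm f \<Longrightarrow> sm f' \<Longrightarrow> sm (\<lambda>q. f q - f' q)"
  using sm_add[of f "\<lambda>q. - f' q"] by simp

lemma sm_divide [simp]: "sm f \<Longrightarrow> sm (\<lambda>q. f q / c)"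
  using sm_mult[of f "\<lambda>q. 1 / c"] by simp

lemma sm_sum [simp]: "(\<And>i. i \<in> K \<Longrightarrow> sm (f i)) \<Longrightarrow> sm (\<lambda>q. \<Sum>i\<in>K. f i q)"
  by (induction K rule: infinite_finite_induct) auto

lemma sm_prod [simp]: "(\<And>i. i \<in> K \<Longrightarrow> sm (f i)) \<Longrightarrow> sm (\<lambda>q. \<Prod>i\<in>K. f i q)"
  by (induction K rule: infinite_finite_induct) auto

end

locale smooth_derivation = smooth_functions sm + derivation S sm d
  for S :: "'p set" and sm and d :: "('p \<Rightarrow> real) \<Rightarrow> 'p \<Rightarrow> real"
begin

lemma d_minus [simp]: "sm f \<Longrightarrow> p \<in> S \<Longrightarrow> d (\<lambda>q. - f q) p = - d f p"
  using d_mult[of "\<lambda>q. -1" f] by simp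

lemma d_diff [simp]:
  "sm f \<Longrightarrow> sm f' \<Longrightarrow> p \<in> S \<Longrightarrow> d (\<lambda>q. f q - f' q) p = d f p - d f' p"
  using d_add[of f "\<lambda>q. - f' q"] by simp

lemma d_divide [simp]: "sm f \<Longrightarrow> p \<in> S \<Longrightarrow> d (\<lambda>q. f q / c) p = d f p / c"
  using d_mult[of f "\<lambda>q. 1 / c"] by simp

lemma d_sum [simp]:
  "(\<And>i. i \<in> K \<Longrightarrow> sm (f i)) \<Longrightarrow> p \<in> S \<Longrightarrow>
    d (\<lambda>q. \<Sum>i\<in>K. f i q) p = (\<Sum>i\<in>K. d (f i) p)"
  by (induction K rule: infinite_finite_induct) auto

end

text \<open>\<open>S\<close> is the domain and \<open>S0\<close> its slice \<open>s = 0\<close>; \<open>D\<close> are the coordinate derivatives (in space or in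
  space-time), which are tangential to the slice, and \<open>\<delta>\<close> is \<open>\<partial>/\<partial>s\<close>.\<close>

locale smooth_calculus = smooth_functions sm
  for sm :: "('p \<Rightarrow> real) \<Rightarrow> bool" +
  fixes S S0 :: "'p set" and D :: "('i::finite, 'p) pderiv" and \<delta> :: "('p \<Rightarrow> real) \<Rightarrow> 'p \<Rightarrow> real"
  assumes D_derivation: "derivation S sm (D a)"
    and \<delta>_derivation: "derivation S sm \<delta>"
    and D_commute: "sm f \<Longrightarrow> p \<in> S \<Longrightarrow> D a (D b f) p = D b (D a f) p"
    and \<delta>_commute: "sm f \<Longrightarrow> p \<in> S \<Longrightarrow> \<delta> (D a f) p = D a (\<delta> f) p"
    and S0_subset: "p \<in> S0 \<Longrightarrow> p \<in> S"
    and D_cong0: "(\<And>q. q \<in> S0 \<Longrightarrow> f q = f' q) \<Longrightarrow> p \<in> S0 \<Longrightarrow> D a f p = D a f' p"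
begin

sublocale D: smooth_derivation S sm "D a" for a
  by (simp add: smooth_derivation_def smooth_functions_axioms D_derivation)

sublocale \<delta>: smooth_derivation S sm \<delta>
  by (simp add: smooth_derivation_def smooth_functions_axioms \<delta>_derivation)

end

text \<open>Meant for the variation of a connection, which is a tensor with one upper index although
  the connection itself is not.\<close>

definition cov12 :: "('i::finite, 'p) pderiv \<Rightarrow> ('i, 'p) conn \<Rightarrow> ('i, 'p) conn \<Rightarrow>
    'p \<Rightarrow> 'i \<Rightarrow> 'i \<Rightarrow> 'i \<Rightarrow> 'i \<Rightarrow> real" where
  "cov12 D C K p a k i j = D a (\<lambda>q. K q k i j) p + (\<Sum>m\<in>UNIV. C p k a m * K p m i j)
     - (\<Sum>m\<in>UNIV. C p m a i * K p k m j) - (\<Sum>m\<in>UNIV. C p m a j * K p k i m)"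

locale connection = smooth_calculus sm S S0 D \<delta>
  for sm :: "('p \<Rightarrow> real) \<Rightarrow> bool" and S S0 and D :: "('i::finite, 'p) pderiv" and \<delta> +
  fixes C :: "('i, 'p) conn"
  assumes sm_C [simp]: "sm (\<lambda>q. C q k i j)"
    and C_sym: "p \<in> S \<Longrightarrow> C p k i j = C p k j i"
begin

lemma sm_cov1 [simp]: "(\<And>i. sm (\<lambda>q. w q i)) \<Longrightarrow> sm (\<lambda>q. cov1 D C w q a i)"
  unfolding cov1_def by (simp cong: sum.cong)

lemma sm_cov2 [simp]: "(\<And>i j. sm (\<lambda>q. h q i j)) \<Longrightarrow> sm (\<lambda>q. cov2 D C h q a i j)"
  unfolding cov2_def by simp

lemma sm_curv [simp]: "sm (\<lambda>q. curv D C q l i j k)"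
  unfolding curv_def by simp

lemma sm_ric [simp]: "sm (\<lambda>q. ric D C q i j)"
  unfolding ric_def by simp

text \<open>Palatini's formula. The variation of \<open>curv\<close> is the antisymmetrised
  covariant derivative of \<open>K\<close>: the terms in which \<open>C\<close> acts on the other
  differentiation index cancel because \<open>C\<close> is symmetric.\<close>

lemma variation_ric:
  assumes p: "p \<in> S"
  defines "K \<equiv> \<lambda>q k i j. \<delta> (\<lambda>r. C r k i j) q"
  shows "\<delta> (\<lambda>q. ric D C q j k) p =
    (\<Sum>m\<in>UNIV. cov12 D C K p m m j k) - (\<Sum>m\<in>UNIV. cov12 D C K p j m m k)"
proof -
  have "\<delta> (\<lambda>q. curv D C q l i j k) p = cov12 D C K p i l j k - cov12 D C K p j l i k" for l i
    using p by (simp add: curv_def cov12_def K_def \<delta>_commute sum.distrib C_sym[of _ _ j i] algebra_simps)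
  then show ?thesis
    using p by (simp add: ric_def sum_subtractf)
qed

lemma ricci_identity:
  assumes p: "p \<in> S" and h: "\<And>i j. sm (\<lambda>q. h q i j)"
  shows "cov3 D C (cov2 D C h) p a b i j - cov3 D C (cov2 D C h) p b a i j =
    - (\<Sum>m\<in>UNIV. curv D C p m a b i * h p m j) - (\<Sum>m\<in>UNIV. curv D C p m a b j * h p i m)"
proof -
  \<comment> \<open>The second derivatives, the terms with first derivatives of h, the term with
    \<open>C p m a b\<close> and the last two lines together are symmetric in a and b. What survives
    antisymmetrisation is the curvature.\<close>
  have *: "cov3 D C (cov2 D C h) p a b i j = D a (D b (\<lambda>q. h q i j)) p
      - (\<Sum>m\<in>UNIV. D a (\<lambda>q. C q m b i) p * h p m j) - (\<Sum>m\<in>UNIV. D a (\<lambda>q. C q m b j) p * h p i m)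
      - (\<Sum>m\<in>UNIV. C p m b i * D a (\<lambda>q. h q m j) p) - (\<Sum>m\<in>UNIV. C p m a i * D b (\<lambda>q. h q m j) p)
      - (\<Sum>m\<in>UNIV. C p m b j * D a (\<lambda>q. h q i m) p) - (\<Sum>m\<in>UNIV. C p m a j * D b (\<lambda>q. h q i m) p)
      - (\<Sum>m\<in>UNIV. C p m a b * cov2 D C h p m i j)
      + (\<Sum>m\<in>UNIV. (\<Sum>l\<in>UNIV. C p l a i * C p m b l) * h p m j)
      + (\<Sum>m\<in>UNIV. (\<Sum>l\<in>UNIV. C p l a j * C p m b l) * h p i m)
      + (\<Sum>m\<in>UNIV. \<Sum>l\<in>UNIV. C p m a i * C p l b j * h p m l)
      + (\<Sum>m\<in>UNIV. \<Sum>l\<in>UNIV. C p m b i * C p l a j * h p m l)" for a b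
  proof -
    have 1: "(\<Sum>m\<in>UNIV. \<Sum>l\<in>UNIV. C p m a i * (C p l b m * h p l j)) =
        (\<Sum>m\<in>UNIV. (\<Sum>l\<in>UNIV. C p l a i * C p m b l) * h p m j)"
      by (subst sum.swap) (simp add: sum_distrib_right mult.assoc)
    have 2: "(\<Sum>m\<in>UNIV. \<Sum>l\<in>UNIV. C p m a j * (C p l b m * h p i l)) =
        (\<Sum>m\<in>UNIV. (\<Sum>l\<in>UNIV. C p l a j * C p m b l) * h p i m)"
      by (subst sum.swap) (simp add: sum_distrib_right mult.assoc)
    have 3: "(\<Sum>m\<in>UNIV. \<Sum>l\<in>UNIV. C p m a j * (C p l b i * h p l m)) =
        (\<Sum>m\<in>UNIV. \<Sum>l\<in>UNIV. C p m b i * C p l a j * h p m l)"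
      by (subst sum.swap) (simp add: ac_simps)
    show ?thesis
      unfolding cov3_def using p h 1 2 3
      by (simp add: cov2_def[of _ _ _ _ b] sum.distrib sum_subtractf right_diff_distrib sum_distrib_left mult.assoc)
  qed
  have ab: "C p m a b = C p m b a" for m
    using C_sym p by blast
  show ?thesis
    unfolding * curv_def using p h
    by (simp add: ab D_commute[of _ _ a b] left_diff_distrib distrib_right sum.distrib sum_subtractf
        mult.commute[of "C p _ b _" "C p _ a _"])
qed

end

section \<open>Tensor calculus with a parallel, possibly degenerate inverse metric\<close>

lemma sum_swap13:
  "(\<Sum>a\<in>A. \<Sum>b\<in>B. \<Sum>c\<in>C. f a b c) = (\<Sum>c\<in>C. \<Sum>b\<in>B. \<Sum>a\<in>A. f a b c)"
proof -
  have "(\<Sum>a\<in>A. \<Sum>b\<in>B. \<Sum>c\<in>C. f a b c) = (\<Sum>b\<in>B. \<Sum>c\<in>C. \<Sum>a\<in>A. f a b c)"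
    by (subst sum.swap) (intro sum.cong refl sum.swap)
  then show ?thesis
    by (simp add: sum.swap[of _ C B])
qed

text \<open>\<open>\<gamma>\<close> has upper indices and need not be invertible, so indices can be
  raised but not lowered. \<open>\<gamma>_parallel\<close> says that its covariant derivative
  vanishes on the slice.\<close>

locale degenerate_metric_connection = connection sm S S0 D \<delta> C
  for sm :: "('p \<Rightarrow> real) \<Rightarrow> bool" and S S0 and D :: "('i::finite, 'p) pderiv" and \<delta> C +
  fixes \<gamma> :: "'p \<Rightarrow> 'i \<Rightarrow> 'i \<Rightarrow> real"
  assumes sm_\<gamma> [simp]: "sm (\<lambda>q. \<gamma> q a b)"
    and \<gamma>_sym: "p \<in> S0 \<Longrightarrow> \<gamma> p a b = \<gamma> p b a"
    and \<gamma>_parallel: "p \<in> S0 \<Longrightarrow> D a (\<lambda>q. \<gamma> q b c) p =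
      - (\<Sum>m\<in>UNIV. C p b a m * \<gamma> p m c) - (\<Sum>m\<in>UNIV. C p c a m * \<gamma> p b m)"
begin

text \<open>Differentiate the equation nabla \<gamma> = 0 once more and commute the two derivatives.
  Skewness is between the upper index and the last lower index, raised, since the upper one cannot
  be lowered.\<close>

lemma curv_skew:
  assumes p: "p \<in> S0"
  shows "(\<Sum>k\<in>UNIV. curv D C p b i j k * \<gamma> p k c) = - (\<Sum>k\<in>UNIV. curv D C p c i j k * \<gamma> p b k)"
proof -
  have S: "p \<in> S" by (rule S0_subset[OF p])
  have *: "D i (D j (\<lambda>q. \<gamma> q b c)) p =
      - (\<Sum>m\<in>UNIV. D i (\<lambda>q. C q b j m) p * \<gamma> p m c) - (\<Sum>m\<in>UNIV. D i (\<lambda>q. C q c j m) p * \<gamma> p b m)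
      + (\<Sum>m\<in>UNIV. (\<Sum>l\<in>UNIV. C p l i m * C p b j l) * \<gamma> p m c)
      + (\<Sum>m\<in>UNIV. (\<Sum>l\<in>UNIV. C p l i m * C p c j l) * \<gamma> p b m)
      + (\<Sum>m\<in>UNIV. \<Sum>l\<in>UNIV. C p b j m * C p c i l * \<gamma> p m l)
      + (\<Sum>m\<in>UNIV. \<Sum>l\<in>UNIV. C p b i m * C p c j l * \<gamma> p m l)" for i j
  proof -
    have 1: "(\<Sum>m\<in>UNIV. \<Sum>l\<in>UNIV. C p b j m * (C p m i l * \<gamma> p l c)) =
        (\<Sum>m\<in>UNIV. (\<Sum>l\<in>UNIV. C p l i m * C p b j l) * \<gamma> p m c)"
      by (subst sum.swap) (simp add: sum_distrib_left sum_distrib_right ac_simps)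
    have 2: "(\<Sum>m\<in>UNIV. \<Sum>l\<in>UNIV. C p c j m * (C p m i l * \<gamma> p b l)) =
        (\<Sum>m\<in>UNIV. (\<Sum>l\<in>UNIV. C p l i m * C p c j l) * \<gamma> p b m)"
      by (subst sum.swap) (simp add: sum_distrib_left sum_distrib_right ac_simps)
    have 3: "(\<Sum>m\<in>UNIV. \<Sum>l\<in>UNIV. C p c j m * (C p b i l * \<gamma> p l m)) =
        (\<Sum>m\<in>UNIV. \<Sum>l\<in>UNIV. C p b i m * C p c j l * \<gamma> p m l)"
      by (subst sum.swap) (simp add: ac_simps)
    \<comment> \<open>\<open>\<gamma>_parallel\<close> may be differentiated although it holds on
      \<open>S0\<close> only: \<open>D i\<close> is tangential to the slice.\<close>
    have "D i (D j (\<lambda>q. \<gamma> q b c)) p = D i (\<lambda>q. - (\<Sum>m\<in>UNIV. C q b j m * \<gamma> q m c)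
        - (\<Sum>m\<in>UNIV. C q c j m * \<gamma> q b m)) p"
      by (rule D_cong0[OF _ p]) (rule \<gamma>_parallel)
    then show ?thesis
      using S p by (simp add: \<gamma>_parallel 1 2 3 sum.distrib right_diff_distrib sum_subtractf
          sum_negf sum_distrib_left mult.assoc)
  qed
  have "(\<Sum>k\<in>UNIV. curv D C p b i j k * \<gamma> p k c) + (\<Sum>k\<in>UNIV. curv D C p c i j k * \<gamma> p b k) =
      D j (D i (\<lambda>q. \<gamma> q b c)) p - D i (D j (\<lambda>q. \<gamma> q b c)) p"
    unfolding * curv_def
    by (simp add: left_diff_distrib distrib_right sum.distrib sum_subtractf)
  then show ?thesis
    using S by (simp add: D_commute[of _ _ i j])
qed

text \<open>Raising an index commutes with covariant differentiation because \<open>\<gamma>\<close>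
  is parallel. Here and in the three lemmas that follow for contractions, traces and 1-forms, the
  raised object has to be known on the slice only.\<close>

lemma cov12_raise:
  assumes p: "p \<in> S0" and T: "\<And>m i j. sm (\<lambda>q. T q m i j)"
    and K: "\<And>q k i j. q \<in> S0 \<Longrightarrow> K q k i j = (\<Sum>m\<in>UNIV. \<gamma> q k m * T q m i j)"
  shows "cov12 D C K p a k i j = (\<Sum>m\<in>UNIV. \<gamma> p k m * cov3 D C T p a m i j)"
proof -
  have S: "p \<in> S" by (rule S0_subset[OF p])
  have D: "D a (\<lambda>q. K q k i j) p = D a (\<lambda>q. \<Sum>m\<in>UNIV. \<gamma> q k m * T q m i j) p"
    by (rule D_cong0[OF _ p]) (rule K)
  have 1: "(\<Sum>m\<in>UNIV. \<Sum>l\<in>UNIV. C p k a m * (\<gamma> p m l * T p l i j)) =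
      (\<Sum>m\<in>UNIV. \<Sum>l\<in>UNIV. C p k a l * (\<gamma> p l m * T p m i j))"
    by (rule sum.swap)
  have 2: "(\<Sum>m\<in>UNIV. \<Sum>l\<in>UNIV. C p m a i * (\<gamma> p k l * T p l m j)) =
      (\<Sum>m\<in>UNIV. \<Sum>l\<in>UNIV. \<gamma> p k m * (C p l a i * T p m l j))"
    by (subst sum.swap) (simp add: ac_simps)
  have 3: "(\<Sum>m\<in>UNIV. \<Sum>l\<in>UNIV. C p m a j * (\<gamma> p k l * T p l i m)) =
      (\<Sum>m\<in>UNIV. \<Sum>l\<in>UNIV. \<gamma> p k m * (C p l a j * T p m i l))"
    by (subst sum.swap) (simp add: ac_simps)
  have 4: "(\<Sum>m\<in>UNIV. \<Sum>l\<in>UNIV. C p m a l * (\<gamma> p k l * T p m i j)) =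
      (\<Sum>m\<in>UNIV. \<Sum>l\<in>UNIV. \<gamma> p k m * (C p l a m * T p l i j))"
    by (subst sum.swap) (simp add: ac_simps)
  show ?thesis
    unfolding cov12_def cov3_def D K[OF p] using S T p
    by (simp add: \<gamma>_parallel 1 2 3 4 sum.distrib right_diff_distrib left_diff_distrib sum_subtractf
        sum_negf sum_distrib_left sum_distrib_right mult.assoc)
qed

lemma cov1_contract:
  assumes p: "p \<in> S0" and T: "\<And>m i j. sm (\<lambda>q. T q m i j)"
    and w: "\<And>q k. q \<in> S0 \<Longrightarrow> w q k = (\<Sum>a\<in>UNIV. \<Sum>b\<in>UNIV. \<gamma> q a b * T q a b k)"
  shows "cov1 D C w p c k = (\<Sum>a\<in>UNIV. \<Sum>b\<in>UNIV. \<gamma> p a b * cov3 D C T p c a b k)"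
proof -
  have S: "p \<in> S" by (rule S0_subset[OF p])
  have D: "D c (\<lambda>q. w q k) p = D c (\<lambda>q. \<Sum>a\<in>UNIV. \<Sum>b\<in>UNIV. \<gamma> q a b * T q a b k) p"
    by (rule D_cong0[OF _ p]) (rule w)
  have 1: "(\<Sum>a\<in>UNIV. \<Sum>b\<in>UNIV. \<Sum>m\<in>UNIV. C p a c m * (\<gamma> p m b * T p a b k)) =
      (\<Sum>a\<in>UNIV. \<Sum>b\<in>UNIV. \<Sum>m\<in>UNIV. \<gamma> p a b * (C p m c a * T p m b k))"
    by (subst sum_swap13) (simp add: ac_simps)
  have 2: "(\<Sum>a\<in>UNIV. \<Sum>b\<in>UNIV. \<Sum>m\<in>UNIV. C p b c m * (\<gamma> p a m * T p a b k)) =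
      (\<Sum>a\<in>UNIV. \<Sum>b\<in>UNIV. \<Sum>m\<in>UNIV. \<gamma> p a b * (C p m c b * T p a m k))"
    by (subst (2) sum.swap) (simp add: ac_simps)
  have 3: "(\<Sum>m\<in>UNIV. \<Sum>a\<in>UNIV. \<Sum>b\<in>UNIV. C p m c k * (\<gamma> p a b * T p a b m)) =
      (\<Sum>a\<in>UNIV. \<Sum>b\<in>UNIV. \<Sum>m\<in>UNIV. \<gamma> p a b * (C p m c k * T p a b m))"
    by (subst sum.swap, subst (2) sum.swap) (simp add: ac_simps)
  show ?thesis
    unfolding cov1_def cov3_def D w[OF p] using S T p
    by (simp add: \<gamma>_parallel 1 2 3 sum.distrib right_diff_distrib left_diff_distrib sum_subtractf
        sum_negf sum_distrib_left sum_distrib_right mult.assoc)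
qed

lemma D_trace:
  assumes p: "p \<in> S0" and h: "\<And>i j. sm (\<lambda>q. h q i j)"
    and f: "\<And>q. q \<in> S0 \<Longrightarrow> f q = (\<Sum>a\<in>UNIV. \<Sum>b\<in>UNIV. \<gamma> q a b * h q a b)"
  shows "D c f p = (\<Sum>a\<in>UNIV. \<Sum>b\<in>UNIV. \<gamma> p a b * cov2 D C h p c a b)"
proof -
  have S: "p \<in> S" by (rule S0_subset[OF p])
  have D: "D c f p = D c (\<lambda>q. \<Sum>a\<in>UNIV. \<Sum>b\<in>UNIV. \<gamma> q a b * h q a b) p"
    by (rule D_cong0[OF _ p]) (rule f)
  have 1: "(\<Sum>a\<in>UNIV. \<Sum>b\<in>UNIV. \<Sum>m\<in>UNIV. C p a c m * (\<gamma> p m b * h p a b)) =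
      (\<Sum>a\<in>UNIV. \<Sum>b\<in>UNIV. \<Sum>m\<in>UNIV. \<gamma> p a b * (C p m c a * h p m b))"
    by (subst sum_swap13) (simp add: ac_simps)
  have 2: "(\<Sum>a\<in>UNIV. \<Sum>b\<in>UNIV. \<Sum>m\<in>UNIV. C p b c m * (\<gamma> p a m * h p a b)) =
      (\<Sum>a\<in>UNIV. \<Sum>b\<in>UNIV. \<Sum>m\<in>UNIV. \<gamma> p a b * (C p m c b * h p a m))"
    by (subst (2) sum.swap) (simp add: ac_simps)
  show ?thesis
    unfolding cov2_def D using S h p
    by (simp add: \<gamma>_parallel 1 2 sum.distrib right_diff_distrib left_diff_distrib sum_subtractf
        sum_negf sum_distrib_left sum_distrib_right mult.assoc)
qed

lemma cov1_raise:
  assumes p: "p \<in> S0" and w: "\<And>m. sm (\<lambda>q. w q m)"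
    and X: "\<And>q k. q \<in> S0 \<Longrightarrow> X q k = (\<Sum>m\<in>UNIV. \<gamma> q k m * w q m)"
  shows "D a (\<lambda>q. X q k) p + (\<Sum>m\<in>UNIV. C p k a m * X p m) =
    (\<Sum>m\<in>UNIV. \<gamma> p k m * cov1 D C w p a m)"
proof -
  have S: "p \<in> S" by (rule S0_subset[OF p])
  have D: "D a (\<lambda>q. X q k) p = D a (\<lambda>q. \<Sum>m\<in>UNIV. \<gamma> q k m * w q m) p"
    by (rule D_cong0[OF _ p]) (rule X)
  have 1: "(\<Sum>m\<in>UNIV. \<Sum>l\<in>UNIV. C p k a m * (\<gamma> p m l * w p l)) =
      (\<Sum>m\<in>UNIV. \<Sum>l\<in>UNIV. C p k a l * (\<gamma> p l m * w p m))"
    by (rule sum.swap)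
  have 2: "(\<Sum>m\<in>UNIV. \<Sum>l\<in>UNIV. C p m a l * (\<gamma> p k l * w p m)) =
      (\<Sum>m\<in>UNIV. \<Sum>l\<in>UNIV. \<gamma> p k m * (C p l a m * w p l))"
    by (subst sum.swap) (simp add: ac_simps)
  show ?thesis
    unfolding cov1_def D X[OF p] using S w p
    by (simp add: \<gamma>_parallel 1 2 sum.distrib right_diff_distrib left_diff_distrib sum_subtractf
        sum_negf sum_distrib_left sum_distrib_right mult.assoc)
qed

lemma contract_swap:
  assumes p: "p \<in> S0"
  shows "(\<Sum>a\<in>UNIV. \<Sum>b\<in>UNIV. \<gamma> p a b * f b a) = (\<Sum>a\<in>UNIV. \<Sum>b\<in>UNIV. \<gamma> p a b * f a b)"
  by (subst sum.swap) (simp add: \<gamma>_sym[OF p, of _ ])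

end

lemma curv_antisym: "curv D C p l i j k = - curv D C p l j i k"
  by (simp add: curv_def)

context connection
begin

lemma first_bianchi:
  assumes p: "p \<in> S"
  shows "curv D C p l i j k + curv D C p l j k i + curv D C p l k i j = 0"
proof -
  have "D a (\<lambda>q. C q l b c) p = D a (\<lambda>q. C q l c b) p" for a b c
    by (rule D.d_cong[OF _ p]) (rule C_sym)
  then show ?thesis
    using C_sym[OF p] by (simp add: curv_def)
qed

lemma cov3_linear:
  assumes "p \<in> S" "\<And>a i j. sm (\<lambda>q. X q a i j)" "\<And>a i j. sm (\<lambda>q. Y q a i j)"
  shows "cov3 D C (\<lambda>q a i j. X q a i j + Y q a i j) p c a i j =
      cov3 D C X p c a i j + cov3 D C Y p c a i j"
    and "cov3 D C (\<lambda>q a i j. X q a i j - Y q a i j) p c a i j =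
      cov3 D C X p c a i j - cov3 D C Y p c a i j"
  using assms by (simp_all add: cov3_def sum.distrib right_diff_distrib distrib_left sum_subtractf sum_distrib_left mult.left_commute)

lemma cov3_scale:
  assumes "p \<in> S" "\<And>a i j. sm (\<lambda>q. X q a i j)"
  shows "cov3 D C (\<lambda>q a i j. r * X q a i j) p c a i j = r * cov3 D C X p c a i j"
  using assms by (simp add: cov3_def right_diff_distrib sum_distrib_left mult.left_commute)

lemma cov3_permute:
  "cov3 D C (\<lambda>q m i j. X q i j m) p a m i j = cov3 D C X p a i j m"
  "cov3 D C (\<lambda>q m i j. X q j i m) p a m i j = cov3 D C X p a j i m"
  by (simp_all add: cov3_def)

end

context degenerate_metric_connection
begin

abbreviation tr :: "'p \<Rightarrow> ('i \<Rightarrow> 'i \<Rightarrow> real) \<Rightarrow> real" where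
  "tr p f \<equiv> \<Sum>a\<in>UNIV. \<Sum>b\<in>UNIV. \<gamma> p a b * f a b"

text \<open>With \<open>a\<close> raised, the curvature is skew in the pair contracted with the
  symmetric h.\<close>

lemma curv_contract_skew:
  assumes p: "p \<in> S0" and h: "\<And>i j. h i j = h j i"
  shows "tr p (\<lambda>a b. \<Sum>m\<in>UNIV. curv D C p m i j a * h b m) = 0"
proof -
  define X where "X b m = (\<Sum>a\<in>UNIV. curv D C p m i j a * \<gamma> p a b)" for b m
  have skew: "X b m = - X m b" for b m
    using curv_skew[OF p, of m i j b] unfolding X_def by (simp add: \<gamma>_sym[OF p])
  have "tr p (\<lambda>a b. \<Sum>m\<in>UNIV. curv D C p m i j a * h b m) = (\<Sum>b\<in>UNIV. \<Sum>m\<in>UNIV. h b m * X b m)"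
    unfolding X_def sum_distrib_left
    by (subst sum.swap, subst (2) sum.swap) (simp add: ac_simps)
  moreover have "(\<Sum>b\<in>UNIV. \<Sum>m\<in>UNIV. h b m * X b m) = - (\<Sum>b\<in>UNIV. \<Sum>m\<in>UNIV. h b m * X b m)"
  proof -
    have "(\<Sum>b\<in>UNIV. \<Sum>m\<in>UNIV. h b m * X b m) = (\<Sum>m\<in>UNIV. \<Sum>b\<in>UNIV. h b m * X b m)"
      by (rule sum.swap)
    also have "\<dots> = (\<Sum>m\<in>UNIV. \<Sum>b\<in>UNIV. - (h m b * X m b))"
      by (intro sum.cong refl) (metis h skew mult_minus_right)
    finally show ?thesis
      by (simp add: sum_negf)
  qed
  ultimately show ?thesis by simp
qed

text \<open>R^m_{ia}^a equals R^a_{ai}^m, the raised Ricci tensor: \<open>curv_skew\<close> and the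
  antisymmetry in the first two lower indices contribute one sign each.\<close>

lemma curv_contract_ric:
  assumes p: "p \<in> S0" and h: "\<And>i j. h i j = h j i"
  shows "tr p (\<lambda>a b. \<Sum>m\<in>UNIV. curv D C p m i a b * h m j) = tr p (\<lambda>q r. ric D C p i q * h j r)"
proof -
  have "tr p (\<lambda>a b. \<Sum>m\<in>UNIV. curv D C p m i a b * h m j) =
      (\<Sum>m\<in>UNIV. \<Sum>a\<in>UNIV. (\<Sum>b\<in>UNIV. curv D C p m i a b * \<gamma> p b a) * h m j)"
    unfolding sum_distrib_left sum_distrib_right
    by (subst (2) sum.swap, subst sum.swap) (simp add: ac_simps \<gamma>_sym[OF p])
  also have "\<dots> = (\<Sum>m\<in>UNIV. \<Sum>a\<in>UNIV. \<Sum>b\<in>UNIV. curv D C p a a i b * \<gamma> p m b * h m j)"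
    unfolding curv_skew[OF p]
    by (simp add: curv_antisym[of D C p _ i] sum_negf sum_distrib_right)
  also have "\<dots> = (\<Sum>m\<in>UNIV. \<Sum>b\<in>UNIV. \<Sum>a\<in>UNIV. curv D C p a a i b * \<gamma> p m b * h m j)"
    by (intro sum.cong refl sum.swap)
  also have "\<dots> = tr p (\<lambda>q r. ric D C p i q * h j r)"
    unfolding ric_def sum_distrib_left sum_distrib_right
    by (subst sum.swap) (simp add: ac_simps \<gamma>_sym[OF p] h)
  finally show ?thesis .
qed

end

text \<open>\<open>var_C\<close> and \<open>var_W\<close> are the variation formulas of the Levi-Civita connection and of DeTurck's
  1-form, but \<open>\<gamma>\<close> may be degenerate and need not come from a metric.\<close>

locale metric_variation = degenerate_metric_connection sm S S0 D \<delta> C \<gamma>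
  for sm :: "('p \<Rightarrow> real) \<Rightarrow> bool" and S S0 and D :: "('i::finite, 'p) pderiv" and \<delta> C \<gamma> +
  fixes h :: "'p \<Rightarrow> 'i \<Rightarrow> 'i \<Rightarrow> real" and W :: "'p \<Rightarrow> 'i \<Rightarrow> real"
  assumes sm_h [simp]: "sm (\<lambda>q. h q i j)"
    and h_sym: "p \<in> S0 \<Longrightarrow> h p i j = h p j i"
    and var_C: "p \<in> S0 \<Longrightarrow> \<delta> (\<lambda>q. C q k i j) p = (\<Sum>m\<in>UNIV. \<gamma> p k m *
      (1/2 * (cov2 D C h p i j m + cov2 D C h p j i m - cov2 D C h p m i j)))"
    and sm_W [simp]: "sm (\<lambda>q. W q k)"
    and W_zero: "p \<in> S0 \<Longrightarrow> W p k = 0"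
    and var_W: "p \<in> S0 \<Longrightarrow> \<delta> (\<lambda>q. W q k) p = (\<Sum>a\<in>UNIV. \<Sum>b\<in>UNIV. \<gamma> p a b *
      (cov2 D C h p a b k - 1/2 * cov2 D C h p k a b))"
begin

abbreviation hess :: "'p \<Rightarrow> 'i \<Rightarrow> 'i \<Rightarrow> 'i \<Rightarrow> 'i \<Rightarrow> real" where
  "hess \<equiv> cov3 D C (cov2 D C h)"

lemma cov2_sym:
  assumes "p \<in> S0"
  shows "cov2 D C h p a i j = cov2 D C h p a j i"
proof -
  have "D a (\<lambda>q. h q i j) p = D a (\<lambda>q. h q j i) p"
    by (rule D_cong0[OF _ assms]) (rule h_sym)
  then show ?thesis
    by (simp add: cov2_def h_sym[OF assms])
qed

lemma hess_sym:
  assumes p: "p \<in> S0"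
  shows "hess p a b i j = hess p a b j i"
proof -
  have "D a (\<lambda>q. cov2 D C h q b i j) p = D a (\<lambda>q. cov2 D C h q b j i) p"
    by (rule D_cong0[OF _ p]) (rule cov2_sym)
  then show ?thesis
    by (simp add: cov3_def cov2_sym[OF p])
qed

lemma variation_ric_hess:
  assumes p: "p \<in> S0"
  shows "2 * \<delta> (\<lambda>q. ric D C q i j) p =
      tr p (\<lambda>a b. hess p a i j b) + tr p (\<lambda>a b. hess p a j i b)
      - tr p (\<lambda>a b. hess p a b i j) - tr p (\<lambda>a b. hess p i j a b)"
proof -
  have S: "p \<in> S" by (rule S0_subset[OF p])
  \<comment> \<open>The variation of the connection with its upper index lowered. It is read off
    from \<open>var_C\<close>, since \<open>\<gamma>\<close> cannot be inverted.\<close>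
  define T where "T = (\<lambda>q m i j. 1/2 *
    (cov2 D C h q i j m + cov2 D C h q j i m - cov2 D C h q m i j))"
  have cov3_T: "cov3 D C T p a m i j = 1/2 * (hess p a i j m + hess p a j i m - hess p a m i j)" for a m i j
    unfolding T_def
    by (subst cov3_scale) (simp_all add: cov3_linear S cov3_permute[where X = "\<lambda>q. cov2 D C h q"])
  define K where "K = (\<lambda>q k i j. \<delta> (\<lambda>r. C r k i j) q)"
  have K: "cov12 D C K p a k i j = (\<Sum>m\<in>UNIV. \<gamma> p k m * cov3 D C T p a m i j)" for a k i j
    by (rule cov12_raise[OF p]) (simp_all add: T_def K_def var_C)
  have "2 * \<delta> (\<lambda>q. ric D C q i j) p =
      tr p (\<lambda>a b. hess p a i j b + hess p a j i b - hess p a b i j)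
      - tr p (\<lambda>a b. hess p i a j b + hess p i j a b - hess p i b a j)"
    using variation_ric[OF S, of i j] unfolding K_def[symmetric]
    by (simp add: K cov3_T sum_distrib_left right_diff_distrib mult.left_commute)
  also have "tr p (\<lambda>a b. hess p i a j b + hess p i j a b - hess p i b a j) =
      tr p (\<lambda>a b. hess p i a j b) + tr p (\<lambda>a b. hess p i j a b) - tr p (\<lambda>a b. hess p i b j a)"
    by (simp add: distrib_left right_diff_distrib sum.distrib sum_subtractf hess_sym[OF p, of i _ _ j])
  \<comment> \<open>Of the three terms in the trace of the varied connection, two cancel and the
    gradient of the trace of h remains.\<close>
  also have "tr p (\<lambda>a b. hess p i b j a) = tr p (\<lambda>a b. hess p i a j b)"
    by (rule contract_swap[OF p])
  finally show ?thesis
    by (simp add: distrib_left right_diff_distrib sum.distrib sum_subtractf)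
qed

text \<open>The variation of the connection is multiplied by \<open>W\<close>, which vanishes on the
  slice.\<close>

lemma variation_cov1:
  assumes p: "p \<in> S0"
  shows "\<delta> (\<lambda>q. cov1 D C W q a k) p = cov1 D C (\<lambda>q k. \<delta> (\<lambda>r. W r k) q) p a k"
  using S0_subset[OF p] by (simp add: cov1_def \<delta>_commute W_zero[OF p])

lemma cov1_variation_hess:
  assumes p: "p \<in> S0"
  shows "cov1 D C (\<lambda>q k. \<delta> (\<lambda>r. W r k) q) p a k =
    tr p (\<lambda>b c. hess p a b c k) - 1/2 * tr p (\<lambda>b c. hess p a k b c)"
proof -
  have S: "p \<in> S" by (rule S0_subset[OF p])
  define M where "M = (\<lambda>q a b k. cov2 D C h q a b k - 1/2 * cov2 D C h q k a b)"
  have cov3_M: "cov3 D C M p c a b k = hess p c a b k - 1/2 * hess p c k a b" for c a b k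
  proof -
    have "cov3 D C (\<lambda>q a b k. cov2 D C h q k a b) p c a b k = hess p c k a b"
      by (simp add: cov3_def)
    then show ?thesis
      unfolding M_def
      by (subst cov3_linear(2), simp_all add: S del: times_divide_eq_left)
         (subst cov3_scale, simp_all add: S)
  qed
  have "cov1 D C (\<lambda>q k. \<delta> (\<lambda>r. W r k) q) p a k = tr p (\<lambda>b c. cov3 D C M p a b c k)"
    by (rule cov1_contract[OF p]) (simp_all add: M_def var_W)
  then show ?thesis
    by (simp add: cov3_M right_diff_distrib sum_subtractf sum_distrib_left mult.left_commute)
qed

text \<open>DeTurck's cancellation: the Hessian of tr h in -2 Ric is cancelled by the one in nabla
  W, and the divergence terms cancel up to commutators, which produce the curvature terms.\<close>

theorem variation_flow_rhs:
  assumes p: "p \<in> S0"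
  shows "\<delta> (\<lambda>q. - 2 * ric D C q i j + cov1 D C W q i j + cov1 D C W q j i) p =
    laplace2 D C \<gamma> h p i j
    + 2 * (\<Sum>a\<in>UNIV. \<Sum>q\<in>UNIV. \<Sum>r\<in>UNIV. \<gamma> p a r * curv D C p q a i j * h p r q)
    - (\<Sum>q\<in>UNIV. \<Sum>r\<in>UNIV. \<gamma> p q r * ric D C p i q * h p j r)
    - (\<Sum>q\<in>UNIV. \<Sum>r\<in>UNIV. \<gamma> p q r * ric D C p j q * h p i r)"
proof -
  have S: "p \<in> S" by (rule S0_subset[OF p])
  have ricci: "hess p a b i j - hess p b a i j = - (\<Sum>m\<in>UNIV. curv D C p m a b i * h p m j)
      - (\<Sum>m\<in>UNIV. curv D C p m a b j * h p i m)" for a b i j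
    by (rule ricci_identity[OF S]) simp
  \<comment> \<open>As \<open>\<gamma>\<close> is parallel, both sides are the Hessian of the
    function tr h. Symmetry is obtained from the Ricci identity, whose curvature terms vanish by
    \<open>curv_contract_skew\<close>.\<close>
  have sym: "tr p (\<lambda>b c. hess p i j b c) = tr p (\<lambda>b c. hess p j i b c)"
  proof -
    have "tr p (\<lambda>b c. hess p i j b c) - tr p (\<lambda>b c. hess p j i b c) =
      - tr p (\<lambda>a b. \<Sum>m\<in>UNIV. curv D C p m i j a * h p b m)
      - tr p (\<lambda>a b. \<Sum>m\<in>UNIV. curv D C p m i j b * h p a m)"
      by (simp add: sum_subtractf[symmetric] right_diff_distrib[symmetric] ricci
          h_sym[OF p] del: sum_subtractf)
         (simp add: h_sym[OF p] right_diff_distrib sum_subtractf sum_negf)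
    also have "tr p (\<lambda>a b. \<Sum>m\<in>UNIV. curv D C p m i j b * h p a m) =
        tr p (\<lambda>a b. \<Sum>m\<in>UNIV. curv D C p m i j a * h p b m)"
      by (rule contract_swap[OF p])
    finally show ?thesis
      using curv_contract_skew[OF p, of "h p"] h_sym[OF p] by simp
  qed
  define R where "R i j = tr p (\<lambda>a b. \<Sum>m\<in>UNIV. curv D C p m a i j * h p b m)" for i j
  \<comment> \<open>Interchanges the divergence with the derivative along \<open>i\<close>. One
    curvature term contracts to Ric, the other is \<open>R i j\<close>.\<close>
  have comm: "tr p (\<lambda>a b. hess p i a b j) - tr p (\<lambda>a b. hess p a i j b) =
      R i j - tr p (\<lambda>q r. ric D C p i q * h p j r)" for i j
  proof -
    have "tr p (\<lambda>a b. hess p i a b j) - tr p (\<lambda>a b. hess p a i j b) =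
        tr p (\<lambda>a b. hess p i a b j - hess p a i b j)"
      by (simp add: hess_sym[OF p, of _ i j] right_diff_distrib sum_subtractf)
    also have "\<dots> = - tr p (\<lambda>a b. \<Sum>m\<in>UNIV. curv D C p m i a b * h p m j) + R i j"
      unfolding ricci R_def
      by (simp add: curv_antisym[of D C p _ i _ j] right_diff_distrib distrib_left sum.distrib sum_negf sum_subtractf)
    finally show ?thesis
      using curv_contract_ric[OF p, of "h p"] h_sym[OF p] by simp
  qed
  have R_sym: "R i j = R j i"
  proof -
    \<comment> \<open>The two sides of \<open>R_sym\<close> differ, by the first Bianchi identity,
      by a term that is skew where h is symmetric.\<close>
    have "curv D C p m a i j = curv D C p m a j i - curv D C p m i j a" for m a
      using first_bianchi[OF S, of m a i j] curv_antisym[of D C p m j a i] by simp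
    then have "R i j = R j i - tr p (\<lambda>a b. \<Sum>m\<in>UNIV. curv D C p m i j a * h p b m)"
      unfolding R_def by (simp add: left_diff_distrib right_diff_distrib sum_subtractf)
    then show ?thesis
      using curv_contract_skew[OF p, of "h p"] h_sym[OF p] by simp
  qed
  have "\<delta> (\<lambda>q. - 2 * ric D C q i j + cov1 D C W q i j + cov1 D C W q j i) p =
      - (2 * \<delta> (\<lambda>q. ric D C q i j) p) + \<delta> (\<lambda>q. cov1 D C W q i j) p + \<delta> (\<lambda>q. cov1 D C W q j i) p"
    using S by simp
  also have "\<dots> = tr p (\<lambda>a b. hess p a b i j) + 2 * R i j
      - tr p (\<lambda>q r. ric D C p i q * h p j r) - tr p (\<lambda>q r. ric D C p j q * h p i r)"
    using comm[of i j] comm[of j i] R_sym sym variation_ric_hess[OF p, of i j]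
    by (simp add: variation_cov1[OF p] cov1_variation_hess[OF p])
  also have "R i j = (\<Sum>a\<in>UNIV. \<Sum>q\<in>UNIV. \<Sum>r\<in>UNIV. \<gamma> p a r * curv D C p q a i j * h p r q)"
    unfolding R_def sum_distrib_left by (subst (2) sum.swap) (simp add: mult.assoc)
  finally show ?thesis
    by (simp add: laplace2_def mult.assoc)
qed

end

section \<open>Variation of the spatial geometry\<close>

text \<open>Differentiate u g = 1 and multiply by u from the right.\<close>

lemma (in smooth_derivation) d_inverse_matrix:
  fixes g u :: "'p \<Rightarrow> 'i::finite \<Rightarrow> 'i \<Rightarrow> real"
  assumes p: "p \<in> S" and [simp]: "\<And>i j. sm (\<lambda>q. g q i j)" "\<And>i j. sm (\<lambda>q. u q i j)"
    and ug: "\<And>q i j. q \<in> S \<Longrightarrow> (\<Sum>k\<in>UNIV. u q i k * g q k j) = (if i = j then 1 else 0)"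
    and gu: "\<And>q i j. q \<in> S \<Longrightarrow> (\<Sum>k\<in>UNIV. g q i k * u q k j) = (if i = j then 1 else 0)"
  shows "d (\<lambda>q. u q i j) p =
    - (\<Sum>k\<in>UNIV. \<Sum>l\<in>UNIV. u p i k * d (\<lambda>q. g q k l) p * u p l j)"
proof -
  have eq: "(\<Sum>k\<in>UNIV. d (\<lambda>q. u q i k) p * g p k l) = - (\<Sum>k\<in>UNIV. u p i k * d (\<lambda>q. g q k l) p)" for l
  proof -
    have "d (\<lambda>q. \<Sum>k\<in>UNIV. u q i k * g q k l) p = d (\<lambda>q. if i = l then 1 else 0) p"
      by (rule d_cong[OF _ p]) (rule ug)
    then show ?thesis
      using p by (simp add: sum.distrib)
  qed
  have "(\<Sum>l\<in>UNIV. (\<Sum>k\<in>UNIV. d (\<lambda>q. u q i k) p * g p k l) * u p l j) =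
      (\<Sum>k\<in>UNIV. d (\<lambda>q. u q i k) p * (\<Sum>l\<in>UNIV. g p k l * u p l j))"
    unfolding sum_distrib_left sum_distrib_right by (subst sum.swap) (simp add: mult.assoc)
  also have "\<dots> = d (\<lambda>q. u q i j) p"
    by (simp add: gu[OF p] if_distrib cong: if_cong)
  finally show ?thesis
    unfolding eq by (subst sum.swap) (simp add: sum_negf sum_distrib_right)
qed

text \<open>\<open>gl\<close>, \<open>gu\<close> are \<open>g\<^sub>i\<^sub>j\<close>, \<open>g\<^sup>i\<^sup>j\<close>, and \<open>\<Gamma>0\<close> is the connection of \<open>g(t,0)\<close>, extended constantly in \<open>s\<close>;
  \<open>Wu\<close>, \<open>Wl\<close>, \<open>Wsq\<close>, \<open>sc\<close>, \<open>hs\<close> are \<open>W\<^sup>k\<close>, \<open>W\<^sub>k\<close>, \<open>|W|\<^sup>2\<close>, \<open>R\<close>, \<open>h\<^sub>i\<^sub>j\<close>.\<close>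

locale metric_family = smooth_calculus sm S S0 D \<delta>
  for sm :: "('p \<Rightarrow> real) \<Rightarrow> bool" and S S0 and D :: "('n::finite option, 'p) pderiv" and \<delta> +
  fixes gl gu :: "'p \<Rightarrow> 'n \<Rightarrow> 'n \<Rightarrow> real" and \<Gamma>0 :: "('n, 'p) conn"
  assumes sm_gl [simp]: "sm (\<lambda>q. gl q i j)"
    and sm_gu [simp]: "sm (\<lambda>q. gu q i j)"
    and gl_sym: "p \<in> S \<Longrightarrow> gl p i j = gl p j i"
    and gu_gl: "p \<in> S \<Longrightarrow> (\<Sum>k\<in>UNIV. gu p i k * gl p k j) = (if i = j then 1 else 0)"
    and gl_gu: "p \<in> S \<Longrightarrow> (\<Sum>k\<in>UNIV. gl p i k * gu p k j) = (if i = j then 1 else 0)"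
    and gu_sym: "p \<in> S \<Longrightarrow> gu p i j = gu p j i"
    and sm_\<Gamma>0 [simp]: "sm (\<lambda>q. \<Gamma>0 q k i j)"
begin

abbreviation "dx \<equiv> (\<lambda>i. D (Some i))"
abbreviation "dt \<equiv> D None"

definition \<Gamma> :: "('n, 'p) conn" where
  "\<Gamma> p k i j = 1/2 * (\<Sum>l\<in>UNIV. gu p k l *
     (dx i (\<lambda>q. gl q j l) p + dx j (\<lambda>q. gl q i l) p - dx l (\<lambda>q. gl q i j) p))"

abbreviation "Ric \<equiv> ric dx \<Gamma>"

definition "Wu p k = (\<Sum>i\<in>UNIV. \<Sum>j\<in>UNIV. gu p i j * (\<Gamma> p k i j - \<Gamma>0 p k i j))"
definition "Wl p j = (\<Sum>k\<in>UNIV. gl p j k * Wu p k)"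
definition "Wsq p = (\<Sum>i\<in>UNIV. \<Sum>j\<in>UNIV. gl p i j * Wu p i * Wu p j)"
definition "sc p = (\<Sum>i\<in>UNIV. \<Sum>j\<in>UNIV. gu p i j * Ric p i j)"
definition "hs p i j = \<delta> (\<lambda>q. gl q i j) p"

lemma gl_dx_sym: "p \<in> S \<Longrightarrow> dx a (\<lambda>q. gl q i j) p = dx a (\<lambda>q. gl q j i) p"
  by (rule D.d_cong) (rule gl_sym)

sublocale space: smooth_calculus sm S S0 dx \<delta>
  by unfold_locales
    (rule D_commute \<delta>_commute S0_subset D.derivation_axioms \<delta>.derivation_axioms D_cong0; blast)+

lemma lower_raise: "p \<in> S \<Longrightarrow> (\<Sum>k\<in>UNIV. gl p a k * (\<Sum>l\<in>UNIV. gu p k l * f l)) = f a"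
proof -
  assume p: "p \<in> S"
  have "(\<Sum>k\<in>UNIV. gl p a k * (\<Sum>l\<in>UNIV. gu p k l * f l)) =
      (\<Sum>l\<in>UNIV. (\<Sum>k\<in>UNIV. gl p a k * gu p k l) * f l)"
    unfolding sum_distrib_left sum_distrib_right by (subst sum.swap) (simp add: mult.assoc)
  then show ?thesis
    by (simp add: gl_gu[OF p] if_distrib[of "\<lambda>x. x * _"] cong: if_cong)
qed

lemma raise_lower: "p \<in> S \<Longrightarrow> (\<Sum>k\<in>UNIV. gu p a k * (\<Sum>l\<in>UNIV. gl p k l * f l)) = f a"
proof -
  assume p: "p \<in> S"
  have "(\<Sum>k\<in>UNIV. gu p a k * (\<Sum>l\<in>UNIV. gl p k l * f l)) =
      (\<Sum>l\<in>UNIV. (\<Sum>k\<in>UNIV. gu p a k * gl p k l) * f l)"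
    unfolding sum_distrib_left sum_distrib_right by (subst sum.swap) (simp add: mult.assoc)
  then show ?thesis
    by (simp add: gu_gl[OF p] if_distrib[of "\<lambda>x. x * _"] cong: if_cong)
qed

text \<open>The Christoffel symbols of the first kind. Their right-hand side is linear in g, which
  makes this the convenient form to differentiate.\<close>

lemma \<Gamma>_lower: "p \<in> S \<Longrightarrow> (\<Sum>k\<in>UNIV. gl p l k * \<Gamma> p k i j) =
    1/2 * (dx i (\<lambda>q. gl q j l) p + dx j (\<lambda>q. gl q i l) p - dx l (\<lambda>q. gl q i j) p)"
  using lower_raise[of p l "\<lambda>l. dx i (\<lambda>q. gl q j l) p + dx j (\<lambda>q. gl q i l) p - dx l (\<lambda>q. gl q i j) p"]
  by (simp add: \<Gamma>_def sum_divide_distrib[symmetric])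

sublocale space: connection sm S S0 dx \<delta> \<Gamma>
proof
  fix p k i j assume p: "p \<in> S"
  show "\<Gamma> p k i j = \<Gamma> p k j i"
    unfolding \<Gamma>_def gl_dx_sym[OF p, of _ i j] by (simp add: add.commute)
qed (simp add: \<Gamma>_def)

lemma metric_compatible:
  "p \<in> S \<Longrightarrow> dx a (\<lambda>q. gl q k l) p = (\<Sum>m\<in>UNIV. gl p l m * \<Gamma> p m a k) + (\<Sum>m\<in>UNIV. gl p k m * \<Gamma> p m a l)"
  using gl_dx_sym[of p a l k] gl_dx_sym[of p k l a] gl_dx_sym[of p l k a] by (simp add: \<Gamma>_lower field_simps)

lemmas D_gu = D.d_inverse_matrix[OF _ sm_gl sm_gu gu_gl gl_gu]
lemmas \<delta>_gu = \<delta>.d_inverse_matrix[OF _ sm_gl sm_gu gu_gl gl_gu]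

lemma gu_parallel:
  assumes p: "p \<in> S"
  shows "dx a (\<lambda>q. gu q b c) p =
      - (\<Sum>m\<in>UNIV. \<Gamma> p b a m * gu p m c) - (\<Sum>m\<in>UNIV. \<Gamma> p c a m * gu p b m)"
proof -
  have "dx a (\<lambda>q. gu q b c) p =
      - (\<Sum>k\<in>UNIV. \<Sum>l\<in>UNIV. gu p b k * (\<Sum>m\<in>UNIV. gl p l m * \<Gamma> p m a k) * gu p l c)
      - (\<Sum>k\<in>UNIV. \<Sum>l\<in>UNIV. gu p b k * (\<Sum>m\<in>UNIV. gl p k m * \<Gamma> p m a l) * gu p l c)"
    using p by (simp add: D_gu metric_compatible distrib_left distrib_right sum.distrib)
  also have "(\<Sum>k\<in>UNIV. \<Sum>l\<in>UNIV. gu p b k * (\<Sum>m\<in>UNIV. gl p l m * \<Gamma> p m a k) * gu p l c) =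
      (\<Sum>k\<in>UNIV. gu p b k * (\<Sum>l\<in>UNIV. gu p c l * (\<Sum>m\<in>UNIV. gl p l m * \<Gamma> p m a k)))"
    by (simp add: sum_distrib_left ac_simps gu_sym[OF p])
  also have "\<dots> = (\<Sum>m\<in>UNIV. \<Gamma> p c a m * gu p b m)"
    by (simp add: raise_lower[OF p] mult.commute)
  also have "(\<Sum>k\<in>UNIV. \<Sum>l\<in>UNIV. gu p b k * (\<Sum>m\<in>UNIV. gl p k m * \<Gamma> p m a l) * gu p l c) =
      (\<Sum>l\<in>UNIV. (\<Sum>k\<in>UNIV. gu p b k * (\<Sum>m\<in>UNIV. gl p k m * \<Gamma> p m a l)) * gu p l c)"
    by (subst sum.swap) (simp add: sum_distrib_right)
  also have "\<dots> = (\<Sum>m\<in>UNIV. \<Gamma> p b a m * gu p m c)"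
    by (simp add: raise_lower[OF p])
  finally show ?thesis by simp
qed

sublocale space: degenerate_metric_connection sm S S0 dx \<delta> \<Gamma> gu
  by unfold_locales (simp_all add: gu_parallel S0_subset gu_sym)

lemma sm_Wu [simp]: "sm (\<lambda>q. Wu q k)"
  unfolding Wu_def by simp

lemma sm_Wl [simp]: "sm (\<lambda>q. Wl q k)"
  unfolding Wl_def by simp

lemma sm_Wsq [simp]: "sm Wsq"
  unfolding Wsq_def by simp

lemma sm_sc [simp]: "sm sc"
  unfolding sc_def by simp

lemma sm_hs [simp]: "sm (\<lambda>q. hs q i j)"
  unfolding hs_def by simp

lemma \<delta>_gl: "\<delta> (\<lambda>q. gl q i j) = (\<lambda>q. hs q i j)"
  by (simp add: hs_def)

lemma hs_sym: "p \<in> S \<Longrightarrow> hs p i j = hs p j i"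
  unfolding hs_def by (rule \<delta>.d_cong) (rule gl_sym)

text \<open>Varying \<open>\<Gamma>_lower\<close> avoids the variation of the inverse metric. The
  product rule leaves h times \<open>\<Gamma>\<close>, which completes the partial derivatives of h
  to covariant ones.\<close>

lemma variation_\<Gamma>:
  assumes p: "p \<in> S"
  shows "\<delta> (\<lambda>q. \<Gamma> q k i j) p = (\<Sum>m\<in>UNIV. gu p k m *
      (1/2 * (cov2 dx \<Gamma> hs p i j m + cov2 dx \<Gamma> hs p j i m - cov2 dx \<Gamma> hs p m i j)))"
proof -
  have *: "(\<Sum>k\<in>UNIV. gl p l k * \<delta> (\<lambda>q. \<Gamma> q k i j) p) =
      1/2 * (cov2 dx \<Gamma> hs p i j l + cov2 dx \<Gamma> hs p j i l - cov2 dx \<Gamma> hs p l i j)" for l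
  proof -
    have "\<delta> (\<lambda>q. \<Sum>k\<in>UNIV. gl q l k * \<Gamma> q k i j) p =
      \<delta> (\<lambda>q. 1/2 * (dx i (\<lambda>q. gl q j l) q + dx j (\<lambda>q. gl q i l) q - dx l (\<lambda>q. gl q i j) q)) p"
      by (rule \<delta>.d_cong[OF _ p]) (rule \<Gamma>_lower)
    then have "(\<Sum>k\<in>UNIV. gl p l k * \<delta> (\<lambda>q. \<Gamma> q k i j) p) =
      1/2 * (dx i (\<lambda>q. hs q j l) p + dx j (\<lambda>q. hs q i l) p - dx l (\<lambda>q. hs q i j) p)
      - (\<Sum>k\<in>UNIV. \<Gamma> p k i j * hs p k l)"
      using p by (simp add: \<delta>_commute \<delta>_gl hs_sym[OF p] sum.distrib mult.commute field_simps)
    then show ?thesis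
      by (simp add: cov2_def hs_sym[OF p] space.C_sym[OF p, of _ j i] space.C_sym[OF p, of _ l i] space.C_sym[OF p, of _ l j])
  qed
  show ?thesis
    using raise_lower[OF p, of k "\<lambda>k. \<delta> (\<lambda>q. \<Gamma> q k i j) p"] unfolding * by (rule sym)
qed

end

section \<open>Variations and time derivatives of spatial quantities along the modified flow\<close>

lemma sum_swap22:
  "(\<Sum>a\<in>A. \<Sum>b\<in>B. \<Sum>c\<in>C. \<Sum>d\<in>E. f a b c d) = (\<Sum>c\<in>C. \<Sum>d\<in>E. \<Sum>a\<in>A. \<Sum>b\<in>B. f a b c d)"
proof -
  have "(\<Sum>a\<in>A. \<Sum>b\<in>B. \<Sum>c\<in>C. \<Sum>d\<in>E. f a b c d) = (\<Sum>a\<in>A. \<Sum>c\<in>C. \<Sum>b\<in>B. \<Sum>d\<in>E. f a b c d)"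
    by (intro sum.cong refl sum.swap)
  also have "\<dots> = (\<Sum>c\<in>C. \<Sum>a\<in>A. \<Sum>b\<in>B. \<Sum>d\<in>E. f a b c d)"
    by (rule sum.swap)
  also have "\<dots> = (\<Sum>c\<in>C. \<Sum>a\<in>A. \<Sum>d\<in>E. \<Sum>b\<in>B. f a b c d)"
    by (intro sum.cong refl sum.swap)
  also have "\<dots> = (\<Sum>c\<in>C. \<Sum>d\<in>E. \<Sum>a\<in>A. \<Sum>b\<in>B. f a b c d)"
    by (intro sum.cong refl sum.swap)
  finally show ?thesis .
qed

text \<open>Restricted to s = 0, \<open>flow\<close> is the Ricci flow (\<open>dt_gl\<close>);
  differentiated in s, it is the evolution equation of h (\<open>dt_hs\<close>).
  \<open>\<delta>_\<Gamma>0\<close> expresses that the background metric does not move with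
  s.\<close>

locale ricci_deformation = metric_family sm S S0 D \<delta> gl gu \<Gamma>0
  for sm :: "('p \<Rightarrow> real) \<Rightarrow> bool" and S S0 and D :: "('n::finite option, 'p) pderiv" and \<delta> gl gu \<Gamma>0 +
  assumes \<Gamma>0_eq: "p \<in> S0 \<Longrightarrow> \<Gamma>0 p k i j = \<Gamma> p k i j"
    and \<delta>_\<Gamma>0: "p \<in> S0 \<Longrightarrow> \<delta> (\<lambda>q. \<Gamma>0 q k i j) p = 0"
    and flow: "p \<in> S \<Longrightarrow>
      dt (\<lambda>q. gl q i j) p = - 2 * Ric p i j + cov1 dx \<Gamma> Wl p i j + cov1 dx \<Gamma> Wl p j i"
begin

lemma Wu_zero: "p \<in> S0 \<Longrightarrow> Wu p k = 0"
  by (simp add: Wu_def \<Gamma>0_eq)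

lemma Wl_zero: "p \<in> S0 \<Longrightarrow> Wl p k = 0"
  by (simp add: Wl_def Wu_zero)

abbreviation "w \<equiv> \<lambda>p k. \<delta> (\<lambda>q. Wl q k) p"

lemma variation_Wu:
  assumes p: "p \<in> S0"
  shows "\<delta> (\<lambda>q. Wu q k) p = (\<Sum>i\<in>UNIV. \<Sum>j\<in>UNIV. gu p i j * \<delta> (\<lambda>q. \<Gamma> q k i j) p)"
  using S0_subset[OF p] by (simp add: Wu_def \<Gamma>0_eq[OF p] \<delta>_\<Gamma>0[OF p])

text \<open>Trace \<open>variation_\<Gamma>\<close>: its first two terms have the same trace and
  give the full divergence, the third gives half the gradient of tr h.\<close>

lemma variation_Wl:
  assumes p: "p \<in> S0"
  shows "w p k = (\<Sum>a\<in>UNIV. \<Sum>b\<in>UNIV. gu p a b *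
    (cov2 dx \<Gamma> hs p a b k - 1/2 * cov2 dx \<Gamma> hs p k a b))"
proof -
  have S: "p \<in> S" by (rule S0_subset[OF p])
  have "w p k = (\<Sum>m\<in>UNIV. \<Sum>i\<in>UNIV. \<Sum>j\<in>UNIV. gl p k m * (gu p i j * \<delta> (\<lambda>q. \<Gamma> q m i j) p))"
    using S by (simp add: Wl_def Wu_zero[OF p] variation_Wu[OF p] sum_distrib_left)
  also have "\<dots> = (\<Sum>i\<in>UNIV. \<Sum>j\<in>UNIV. gu p i j * (\<Sum>m\<in>UNIV. gl p k m * \<delta> (\<lambda>q. \<Gamma> q m i j) p))"
    by (subst sum_swap13, subst sum.swap) (simp add: sum_distrib_left ac_simps)
  also have "\<dots> = (\<Sum>i\<in>UNIV. \<Sum>j\<in>UNIV. gu p i j *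
      (1/2 * (cov2 dx \<Gamma> hs p i j k + cov2 dx \<Gamma> hs p j i k - cov2 dx \<Gamma> hs p k i j)))"
    by (simp only: variation_\<Gamma>[OF S] lower_raise[OF S])
  also have "\<dots> = (space.tr p (\<lambda>i j. cov2 dx \<Gamma> hs p i j k) + space.tr p (\<lambda>i j. cov2 dx \<Gamma> hs p j i k)
      - space.tr p (\<lambda>i j. cov2 dx \<Gamma> hs p k i j)) / 2"
    by (simp add: sum_divide_distrib[symmetric] distrib_left right_diff_distrib sum.distrib sum_subtractf
      add_divide_distrib diff_divide_distrib)
  also have "space.tr p (\<lambda>i j. cov2 dx \<Gamma> hs p j i k) = space.tr p (\<lambda>i j. cov2 dx \<Gamma> hs p i j k)"
    by (rule space.contract_swap[OF p])
  finally show ?thesis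
    by (simp add: right_diff_distrib sum_subtractf sum_divide_distrib diff_divide_distrib)
qed

sublocale space: metric_variation sm S S0 dx \<delta> \<Gamma> gu hs Wl
  by unfold_locales (simp_all add: hs_sym S0_subset variation_\<Gamma> Wl_zero variation_Wl)

text \<open>\<open>dv\<close>, \<open>dvdv\<close>, \<open>Rh\<close> are \<open>div h\<close>, \<open>div div h\<close>, \<open>Rc \<cdot> h\<close>, and \<open>H\<close> is the trace of \<open>h\<close>.\<close>

definition "dv p j = (\<Sum>a\<in>UNIV. \<Sum>b\<in>UNIV. gu p a b * cov2 dx \<Gamma> hs p a b j)"
definition "dvdv p = (\<Sum>j\<in>UNIV. \<Sum>k\<in>UNIV. gu p j k * cov1 dx \<Gamma> dv p j k)"
definition "H p = (\<Sum>a\<in>UNIV. \<Sum>b\<in>UNIV. gu p a b * hs p a b)"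
definition "lapH p = (\<Sum>j\<in>UNIV. \<Sum>k\<in>UNIV. gu p j k * cov1 dx \<Gamma> (\<lambda>q k. dx k H q) p j k)"
definition "divw p = (\<Sum>j\<in>UNIV. \<Sum>k\<in>UNIV. gu p j k * cov1 dx \<Gamma> w p j k)"
definition "Rh p = (\<Sum>i\<in>UNIV. \<Sum>j\<in>UNIV. \<Sum>a\<in>UNIV. \<Sum>b\<in>UNIV. gu p i a * gu p j b * Ric p i j * hs p a b)"

lemma sm_dv [simp]: "sm (\<lambda>q. dv q j)"
  unfolding dv_def by simp

lemma sm_dvdv [simp]: "sm dvdv"
  unfolding dvdv_def by simp

lemma sm_H [simp]: "sm H"
  unfolding H_def by simp

lemma sm_Rh [simp]: "sm Rh"
  unfolding Rh_def by simp

lemma dx_H: "p \<in> S0 \<Longrightarrow> dx k H p = space.tr p (\<lambda>a b. cov2 dx \<Gamma> hs p k a b)"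
  by (rule space.D_trace) (simp_all add: H_def)

lemma w_eq: "p \<in> S0 \<Longrightarrow> w p k = dv p k - 1/2 * dx k H p"
  by (simp add: variation_Wl dx_H dv_def right_diff_distrib sum_subtractf sum_divide_distrib)

lemma cov1_w:
  assumes p: "p \<in> S0"
  shows "cov1 dx \<Gamma> w p a k = cov1 dx \<Gamma> dv p a k - 1/2 * cov1 dx \<Gamma> (\<lambda>q k. dx k H q) p a k"
proof -
  have "dx a (\<lambda>q. w q k) p = dx a (\<lambda>q. dv q k - 1/2 * dx k H q) p"
    by (rule D_cong0[OF _ p]) (rule w_eq)
  then show ?thesis
    using S0_subset[OF p]
    by (simp add: cov1_def w_eq[OF p] right_diff_distrib sum_subtractf sum_divide_distrib diff_divide_distrib)
qed

lemma hessian_H_sym: "p \<in> S \<Longrightarrow> cov1 dx \<Gamma> (\<lambda>q k. dx k H q) p a k = cov1 dx \<Gamma> (\<lambda>q k. dx k H q) p k a"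
  by (simp add: cov1_def D_commute[of H p "Some a" "Some k"] space.C_sym[of p _ a k])

text \<open>div h and w differ by the exact form 1/2 dH, so their curls agree. This brings div h
  into the mixed components of the space-time variation.\<close>

lemma curl_dv:
  assumes p: "p \<in> S0"
  shows "cov1 dx \<Gamma> dv p a k - cov1 dx \<Gamma> dv p k a = cov1 dx \<Gamma> w p a k - cov1 dx \<Gamma> w p k a"
  using cov1_w[OF p, of a k] cov1_w[OF p, of k a] hessian_H_sym[OF S0_subset[OF p], of a k] by simp

lemma divw_eq: "p \<in> S0 \<Longrightarrow> divw p = dvdv p - 1/2 * lapH p"
  by (simp add: divw_def dvdv_def lapH_def cov1_w right_diff_distrib sum_subtractf sum_divide_distrib)

lemma cov1_dH:
  assumes p: "p \<in> S0"
  shows "cov1 dx \<Gamma> (\<lambda>q k. dx k H q) p a k = space.tr p (\<lambda>b c. space.hess p a k b c)"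
proof -
  have "cov1 dx \<Gamma> (\<lambda>q k. dx k H q) p a k =
      space.tr p (\<lambda>b c. cov3 dx \<Gamma> (\<lambda>q b c k. cov2 dx \<Gamma> hs q k b c) p a b c k)"
    by (rule space.cov1_contract[OF p]) (simp_all add: dx_H)
  moreover have "cov3 dx \<Gamma> (\<lambda>q b c k. cov2 dx \<Gamma> hs q k b c) p a b c k = space.hess p a k b c" for b c
    by (simp add: cov3_def)
  ultimately show ?thesis by simp
qed

lemma trace_variation_Ric:
  assumes p: "p \<in> S0"
  shows "space.tr p (\<lambda>j k. \<delta> (\<lambda>q. Ric q j k) p) = divw p - 1/2 * lapH p"
proof -
  define N where "N = space.hess p"
  have tr_swap: "space.tr p (\<lambda>j k. space.tr p (\<lambda>a b. F j k a b)) = space.tr p (\<lambda>a b. space.tr p (\<lambda>j k. F j k a b))" for F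
    unfolding sum_distrib_left by (subst sum_swap22) (simp add: ac_simps)
  \<comment> \<open>\<open>A\<close> is div div h and \<open>B\<close> the Laplacian of
    \<open>H\<close>, both written as double traces of the second covariant derivative of h.\<close>
  define A where "A = space.tr p (\<lambda>j k. space.tr p (\<lambda>a b. N a j k b))"
  define B where "B = space.tr p (\<lambda>j k. space.tr p (\<lambda>a b. N a b j k))"
  have ric: "space.tr p (\<lambda>j k. 2 * \<delta> (\<lambda>q. Ric q j k) p) = A + A - B - B"
  proof -
    have "space.tr p (\<lambda>j k. space.tr p (\<lambda>a b. N a k j b)) = A"
      unfolding A_def by (rule space.contract_swap[OF p])
    moreover have "space.tr p (\<lambda>j k. space.tr p (\<lambda>a b. N j k a b)) = B"
      unfolding B_def by (rule tr_swap)
    ultimately show ?thesis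
      by (simp add: space.variation_ric_hess[OF p] N_def[symmetric] distrib_left right_diff_distrib
          sum.distrib sum_subtractf A_def B_def)
  qed
  have lapH: "lapH p = B"
    unfolding lapH_def cov1_dH[OF p] B_def N_def[symmetric] by (rule tr_swap)
  have "divw p = A - 1/2 * B"
  proof -
    have "divw p = space.tr p (\<lambda>j k. space.tr p (\<lambda>a b. N j a b k)) - 1/2 * space.tr p (\<lambda>j k. space.tr p (\<lambda>a b. N j k a b))"
      by (simp only: divw_def space.cov1_variation_hess[OF p] N_def[symmetric] right_diff_distrib
          sum_subtractf mult.left_commute[of _ "1/2"] sum_distrib_left[symmetric])
    also have "space.tr p (\<lambda>j k. space.tr p (\<lambda>a b. N j k a b)) = B"
      unfolding B_def by (rule tr_swap)
    also have "space.tr p (\<lambda>j k. space.tr p (\<lambda>a b. N j a b k)) = space.tr p (\<lambda>a b. space.tr p (\<lambda>j k. N j a b k))"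
      by (rule tr_swap)
    finally show ?thesis by (simp add: A_def)
  qed
  moreover have "space.tr p (\<lambda>j k. 2 * \<delta> (\<lambda>q. Ric q j k) p) = 2 * space.tr p (\<lambda>j k. \<delta> (\<lambda>q. Ric q j k) p)"
    by (simp add: sum_distrib_left mult.left_commute)
  ultimately show ?thesis
    using ric lapH by simp
qed

lemma dt_gl: 
  assumes p: "p \<in> S0"
  shows "dt (\<lambda>q. gl q i j) p = - 2 * Ric p i j"
proof -
  have "cov1 dx \<Gamma> Wl p i j = 0" for i j
    using D_cong0[of "\<lambda>q. Wl q j" "\<lambda>q. 0" p "Some i"] p S0_subset[OF p]
    by (simp add: cov1_def Wl_zero)
  then show ?thesis
    using flow[OF S0_subset[OF p]] by simp
qed

text \<open>On the slice Ric is -1/2 dt g and inherits the symmetry of g.\<close>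

lemma Ric_sym: 
  assumes p: "p \<in> S0"
  shows "Ric p i j = Ric p j i"
proof -
  have "dt (\<lambda>q. gl q i j) p = dt (\<lambda>q. gl q j i) p"
    by (rule D.d_cong[OF _ S0_subset[OF p]]) (rule gl_sym)
  then show ?thesis
    by (simp add: dt_gl[OF p])
qed

text \<open>Apply \<open>\<delta>\<close> to \<open>flow\<close> and commute it with
  \<open>dt\<close>.\<close>

lemma dt_hs: 
  assumes p: "p \<in> S0"
  shows "dt (\<lambda>q. hs q i j) p = - 2 * \<delta> (\<lambda>q. Ric q i j) p + cov1 dx \<Gamma> w p i j + cov1 dx \<Gamma> w p j i"
proof -
  have S: "p \<in> S" by (rule S0_subset[OF p])
  have "dt (\<lambda>q. hs q i j) p = \<delta> (dt (\<lambda>q. gl q i j)) p"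
    using S by (simp add: \<delta>_commute \<delta>_gl)
  also have "\<dots> = \<delta> (\<lambda>q. - 2 * Ric q i j + cov1 dx \<Gamma> Wl q i j + cov1 dx \<Gamma> Wl q j i) p"
    by (rule \<delta>.d_cong[OF _ S]) (rule flow)
  finally show ?thesis
    using S by (simp add: space.variation_cov1[OF p])
qed

text \<open>The divergences of w coming from Ric and from nabla W cancel, so that the Laplacian of
  \<open>H\<close> is all that remains.\<close>

lemma trace_dt_hs:
  assumes p: "p \<in> S0"
  shows "space.tr p (\<lambda>i j. dt (\<lambda>q. hs q i j) p) = lapH p"
proof -
  have "space.tr p (\<lambda>i j. dt (\<lambda>q. hs q i j) p) =
      - 2 * space.tr p (\<lambda>j k. \<delta> (\<lambda>q. Ric q j k) p) + divw p + space.tr p (\<lambda>j k. cov1 dx \<Gamma> w p k j)"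
    by (simp add: dt_hs[OF p] divw_def distrib_left right_diff_distrib sum.distrib sum_subtractf
        sum_distrib_left mult.left_commute sum_negf)
  also have "space.tr p (\<lambda>j k. cov1 dx \<Gamma> w p k j) = divw p"
    unfolding divw_def by (rule space.contract_swap[OF p])
  finally show ?thesis
    by (simp add: trace_variation_Ric[OF p])
qed

lemma Rh_eq:
  assumes p: "p \<in> S"
  shows "Rh p = (\<Sum>a\<in>UNIV. \<Sum>b\<in>UNIV. (\<Sum>k\<in>UNIV. \<Sum>l\<in>UNIV. gu p a k * Ric p k l * gu p l b) * hs p a b)"
    and "Rh p = (\<Sum>a\<in>UNIV. \<Sum>b\<in>UNIV. (\<Sum>k\<in>UNIV. \<Sum>l\<in>UNIV. gu p a k * hs p k l * gu p l b) * Ric p a b)"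
proof -
  show "Rh p = (\<Sum>a\<in>UNIV. \<Sum>b\<in>UNIV. (\<Sum>k\<in>UNIV. \<Sum>l\<in>UNIV. gu p a k * Ric p k l * gu p l b) * hs p a b)"
    unfolding Rh_def sum_distrib_right
    by (subst sum_swap22) (simp add: ac_simps gu_sym[OF p])
  show "Rh p = (\<Sum>a\<in>UNIV. \<Sum>b\<in>UNIV. (\<Sum>k\<in>UNIV. \<Sum>l\<in>UNIV. gu p a k * hs p k l * gu p l b) * Ric p a b)"
    unfolding Rh_def sum_distrib_right
    by (simp add: ac_simps gu_sym[OF p])
qed

lemma dt_gu_Ric:
  assumes p: "p \<in> S0"
  shows "dt (\<lambda>q. gu q a b) p = 2 * (\<Sum>k\<in>UNIV. \<Sum>l\<in>UNIV. gu p a k * Ric p k l * gu p l b)"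
  by (simp add: D_gu[OF S0_subset[OF p]] dt_gl[OF p] sum_negf sum_distrib_left ac_simps)

lemma dt_H:
  assumes p: "p \<in> S0"
  shows "dt H p = 2 * Rh p + lapH p"
proof -
  have S: "p \<in> S" by (rule S0_subset[OF p])
  have "dt H p = (\<Sum>a\<in>UNIV. \<Sum>b\<in>UNIV. dt (\<lambda>q. gu q a b) p * hs p a b) + lapH p"
    using S unfolding H_def[abs_def] trace_dt_hs[OF p, symmetric] by (simp add: sum.distrib)
  then show ?thesis
    by (simp add: dt_gu_Ric[OF p] Rh_eq(1)[OF S] sum_distrib_left sum_distrib_right mult.assoc)
qed

lemma variation_sc:
  assumes p: "p \<in> S0"
  shows "\<delta> sc p = - Rh p + divw p - 1/2 * lapH p"
proof -
  have S: "p \<in> S" by (rule S0_subset[OF p])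
  have "\<delta> sc p = (\<Sum>a\<in>UNIV. \<Sum>b\<in>UNIV. \<delta> (\<lambda>q. gu q a b) p * Ric p a b) + (divw p - 1/2 * lapH p)"
    using S unfolding sc_def[abs_def] trace_variation_Ric[OF p, symmetric] by (simp add: sum.distrib)
  then show ?thesis
    by (simp add: \<delta>_gu[OF S] \<delta>_gl Rh_eq(2)[OF S] sum_negf)
qed

text \<open>The Laplacians of \<open>H\<close> cancel. The right-hand side is the (0,0) component of
  the space-time extension of h.\<close>

lemma dt_H_plus_variation_sc:
  "p \<in> S0 \<Longrightarrow> dt H p + \<delta> sc p = dvdv p + Rh p"
  by (simp add: dt_H variation_sc divw_eq)

end

section \<open>Variation of the space-time geometry\<close>

lemma sum_UNIV_option:
  "(\<Sum>a\<in>UNIV. f a) = f None + (\<Sum>i\<in>UNIV. f (Some (i::'a::finite)))"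
  by (simp add: UNIV_option_conv sum.reindex)

context ricci_deformation
begin

text \<open>The components \<open>\<Gamma>\<^sup>k\<^sub>i\<^sub>0\<close> and \<open>\<Gamma>\<^sup>k\<^sub>0\<^sub>0\<close> of the space-time connection \<open>stC\<close>.\<close>

definition "mixed p k i = - (\<Sum>l\<in>UNIV. gu p k l * Ric p i l)
  + (dx i (\<lambda>q. Wu q k) p + (\<Sum>m\<in>UNIV. \<Gamma> p k i m * Wu p m))"

definition "tim p k = - 1/2 * (\<Sum>l\<in>UNIV. gu p k l * dx l (\<lambda>q. sc q + Wsq q) p)
  + (\<Sum>l\<in>UNIV. gu p k l * dt (\<lambda>q. Wl q l) p)"

definition stC :: "('n option, 'p) conn" where
  "stC p c a b = (case c of
        None \<Rightarrow> 0
      | Some k \<Rightarrow>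
          (case (a, b) of
             (Some i, Some j) \<Rightarrow> \<Gamma> p k i j
           | (Some i, None) \<Rightarrow> mixed p k i
           | (None, Some i) \<Rightarrow> mixed p k i
           | (None, None) \<Rightarrow> tim p k))"

definition "stg p a b = (case (a, b) of (Some i, Some j) \<Rightarrow> gu p i j | _ \<Rightarrow> 0)"

definition "stW p a = (case a of
    None \<Rightarrow> \<Sum>j\<in>UNIV. \<Sum>k\<in>UNIV. gu p j k * cov1 dx \<Gamma> Wl p j k
  | Some k \<Rightarrow> Wl p k)"

definition "hh p a b = (case (a, b) of
    (Some i, Some j) \<Rightarrow> hs p i j
  | (None, Some j) \<Rightarrow> dv p j
  | (Some j, None) \<Rightarrow> dv p j
  | (None, None) \<Rightarrow> dvdv p + Rh p)"

lemma stC_simps [simp]: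
  "stC p None a b = 0"
  "stC p (Some k) (Some i) (Some j) = \<Gamma> p k i j"
  "stC p (Some k) (Some i) None = mixed p k i"
  "stC p (Some k) None (Some i) = mixed p k i"
  "stC p (Some k) None None = tim p k"
  by (simp_all add: stC_def)

lemma stg_simps [simp]:
  "stg p (Some i) (Some j) = gu p i j" "stg p None b = 0" "stg p a None = 0"
  by (simp_all add: stg_def split: option.split)

lemma stW_simps [simp]:
  "stW p (Some k) = Wl p k" "stW p None = (\<Sum>j\<in>UNIV. \<Sum>k\<in>UNIV. gu p j k * cov1 dx \<Gamma> Wl p j k)"
  by (simp_all add: stW_def)

lemma hh_simps [simp]:
  "hh p (Some i) (Some j) = hs p i j" "hh p None (Some j) = dv p j" "hh p (Some j) None = dv p j"
  "hh p None None = dvdv p + Rh p"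
  by (simp_all add: hh_def)

lemma sm_mixed [simp]: "sm (\<lambda>q. mixed q k i)"
  unfolding mixed_def by simp

lemma sm_tim [simp]: "sm (\<lambda>q. tim q k)"
  unfolding tim_def by simp

text \<open>W vanishes along the slice, and \<open>D a\<close>, spatial or temporal, is tangential
  to it.\<close>

lemma dx_Wu:
  assumes p: "p \<in> S0" shows "D a (\<lambda>q. Wu q k) p = 0"
  using D_cong0[of "\<lambda>q. Wu q k" "\<lambda>q. 0" p a] p S0_subset[OF p] by (simp add: Wu_zero)

lemma D_Wl:
  assumes p: "p \<in> S0" shows "D a (\<lambda>q. Wl q k) p = 0"
  using D_cong0[of "\<lambda>q. Wl q k" "\<lambda>q. 0" p a] p S0_subset[OF p] by (simp add: Wl_zero)

lemma mixed_eq: "p \<in> S0 \<Longrightarrow> mixed p k i = - (\<Sum>l\<in>UNIV. gu p k l * Ric p i l)"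
  by (simp add: mixed_def dx_Wu Wu_zero)

lemma dx_sc_Wsq:
  assumes p: "p \<in> S0" shows "dx l (\<lambda>q. sc q + Wsq q) p = dx l sc p"
  by (rule D_cong0[OF _ p]) (simp add: Wsq_def Wu_zero)

lemma tim_eq: "p \<in> S0 \<Longrightarrow> tim p k = - 1/2 * (\<Sum>l\<in>UNIV. gu p k l * dx l sc p)"
  unfolding tim_def by (simp only: dx_sc_Wsq D_Wl) simp

sublocale st: connection sm S S0 D \<delta> stC
proof
  fix k i j show "sm (\<lambda>q. stC q k i j)"
    by (cases k; cases i; cases j) simp_all
next
  fix p k i j assume "p \<in> S" then show "stC p k i j = stC p k j i"
    by (cases k; cases i; cases j) (simp_all add: space.C_sym)
qed

text \<open>The reason for the Ricci term in the mixed coefficients: dt g^{bc} is 2 R^{bc}, and by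
  symmetry of Ric each of the two sums equals -R^{bc}.\<close>

lemma dt_gu_mixed:
  assumes p: "p \<in> S0"
  shows "dt (\<lambda>q. gu q b c) p =
    - (\<Sum>m\<in>UNIV. mixed p b m * gu p m c) - (\<Sum>m\<in>UNIV. mixed p c m * gu p b m)"
proof -
  have S: "p \<in> S" by (rule S0_subset[OF p])
  have "(\<Sum>m\<in>UNIV. mixed p b m * gu p m c) = - (\<Sum>k\<in>UNIV. \<Sum>l\<in>UNIV. gu p b k * Ric p k l * gu p l c)"
    unfolding mixed_eq[OF p]
    by (simp add: sum_distrib_left sum_distrib_right sum_negf Ric_sym[OF p] mult.assoc, subst sum.swap)
       (simp add: Ric_sym[OF p])
  moreover have "(\<Sum>m\<in>UNIV. mixed p c m * gu p b m) = - (\<Sum>k\<in>UNIV. \<Sum>l\<in>UNIV. gu p b k * Ric p k l * gu p l c)"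
    unfolding mixed_eq[OF p]
    by (simp add: sum_distrib_left sum_distrib_right sum_negf ac_simps gu_sym[OF S])
  ultimately show ?thesis
    by (simp add: dt_gu_Ric[OF p])
qed

sublocale st: degenerate_metric_connection sm S S0 D \<delta> stC stg
proof
  fix a b show "sm (\<lambda>q. stg q a b)"
    by (cases a; cases b) simp_all
next
  fix p a b assume "p \<in> S0" then show "stg p a b = stg p b a"
    by (cases a; cases b) (simp_all add: gu_sym S0_subset)
next
  fix p a b c assume p: "p \<in> S0"
  show "D a (\<lambda>q. stg q b c) p =
      - (\<Sum>m\<in>UNIV. stC p b a m * stg p m c) - (\<Sum>m\<in>UNIV. stC p c a m * stg p b m)"
    \<comment> \<open>If \<open>b\<close> or \<open>c\<close> is the index 0, both sides vanish,
      because the 0 components of \<open>stg\<close> and the coefficients with upper index 0 are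
      zero.\<close>
    using p S0_subset[OF p]
    by (cases a; cases b; cases c)
       (simp_all add: sum_UNIV_option gu_parallel dt_gu_mixed)
qed

lemma sm_hh [simp]: "sm (\<lambda>q. hh q a b)"
  by (cases a; cases b) simp_all

text \<open>The indices contracted with \<open>stg\<close> are spatial; these are the components
  that the two variation formulas then involve.\<close>

lemma cov2_hh:
  "cov2 D stC hh p (Some a) (Some i) (Some j) = cov2 dx \<Gamma> hs p a i j"
  "cov2 D stC hh p (Some a) (Some i) None = cov1 dx \<Gamma> dv p a i - (\<Sum>m\<in>UNIV. mixed p m a * hs p i m)"
  "cov2 D stC hh p (Some a) None (Some i) = cov1 dx \<Gamma> dv p a i - (\<Sum>m\<in>UNIV. mixed p m a * hs p m i)"
  "cov2 D stC hh p None (Some i) (Some j) = dt (\<lambda>q. hs q i j) p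
     - (\<Sum>m\<in>UNIV. mixed p m i * hs p m j) - (\<Sum>m\<in>UNIV. mixed p m j * hs p i m)"
  "cov2 D stC hh p None None (Some k) = dt (\<lambda>q. dv q k) p
     - (\<Sum>m\<in>UNIV. tim p m * hs p m k) - (\<Sum>m\<in>UNIV. mixed p m k * dv p m)"
  "cov2 D stC hh p (Some a) None None = dx a (\<lambda>q. dvdv q + Rh q) p - 2 * (\<Sum>m\<in>UNIV. mixed p m a * dv p m)"
  by (simp_all add: cov2_def cov1_def sum_UNIV_option)

lemma variation_Wu_raise:
  assumes p: "p \<in> S0"
  shows "\<delta> (\<lambda>q. Wu q k) p = (\<Sum>m\<in>UNIV. gu p k m * w p m)"
proof -
  have "w p m = (\<Sum>k\<in>UNIV. gl p m k * \<delta> (\<lambda>q. Wu q k) p)" for m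
    using S0_subset[OF p] by (simp add: Wl_def Wu_zero[OF p])
  then show ?thesis
    by (simp add: raise_lower[OF S0_subset[OF p]])
qed

lemma \<delta>_gu_contract:
  assumes p: "p \<in> S"
  shows "(\<Sum>l\<in>UNIV. \<delta> (\<lambda>q. gu q k l) p * f l) =
    - (\<Sum>m\<in>UNIV. gu p k m * (\<Sum>l\<in>UNIV. hs p m l * (\<Sum>b\<in>UNIV. gu p l b * f b)))"
proof -
  have "(\<Sum>l\<in>UNIV. \<delta> (\<lambda>q. gu q k l) p * f l) =
      (\<Sum>l\<in>UNIV. \<Sum>m\<in>UNIV. \<Sum>b\<in>UNIV. - (gu p k m * (hs p m b * (gu p b l * f l))))"
    by (simp add: \<delta>_gu[OF p] \<delta>_gl sum_distrib_right sum_negf mult.assoc)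
  then show ?thesis
    by (subst (asm) sum_swap13, subst (asm) sum.swap) (simp add: sum_distrib_left sum_negf)
qed

text \<open>Varying the inverse metric in front of Ric gives back \<open>mixed\<close>, contracted
  with h. In nabla W only W itself is varied, since W vanishes on the slice.\<close>

lemma variation_mixed:
  assumes p: "p \<in> S0"
  shows "\<delta> (\<lambda>q. mixed q k i) p = (\<Sum>m\<in>UNIV. gu p k m *
    (cov1 dx \<Gamma> w p i m - \<delta> (\<lambda>q. Ric q i m) p - (\<Sum>l\<in>UNIV. hs p m l * mixed p l i)))"
proof -
  have S: "p \<in> S" by (rule S0_subset[OF p])
  have "\<delta> (\<lambda>q. mixed q k i) p =
      - (\<Sum>l\<in>UNIV. \<delta> (\<lambda>q. gu q k l) p * Ric p i l) - (\<Sum>l\<in>UNIV. gu p k l * \<delta> (\<lambda>q. Ric q i l) p)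
      + (dx i (\<delta> (\<lambda>q. Wu q k)) p + (\<Sum>m\<in>UNIV. \<Gamma> p k i m * \<delta> (\<lambda>q. Wu q m) p))"
    using S by (simp add: mixed_def \<delta>_commute Wu_zero[OF p] sum.distrib)
  also have "dx i (\<delta> (\<lambda>q. Wu q k)) p + (\<Sum>m\<in>UNIV. \<Gamma> p k i m * \<delta> (\<lambda>q. Wu q m) p) =
      (\<Sum>m\<in>UNIV. gu p k m * cov1 dx \<Gamma> w p i m)"
    using space.cov1_raise[OF p, of w "\<lambda>q k. \<delta> (\<lambda>q. Wu q k) q" i k] by (simp add: variation_Wu_raise)
  finally show ?thesis
    by (simp add: \<delta>_gu_contract[OF S] mixed_eq[OF p] right_diff_distrib sum_subtractf distrib_left sum.distrib sum_negf)
qed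

text \<open>|W|^2 is quadratic in a quantity that vanishes at s = 0, so to first order only R is
  varied under the gradient.\<close>

lemma variation_tim:
  assumes p: "p \<in> S0"
  shows "\<delta> (\<lambda>q. tim q k) p = (\<Sum>m\<in>UNIV. gu p k m *
    (dt (\<lambda>q. w q m) p - 1/2 * dx m (\<delta> sc) p - (\<Sum>l\<in>UNIV. hs p m l * tim p l)))"
proof -
  have S: "p \<in> S" by (rule S0_subset[OF p])
  have "\<delta> (\<lambda>q. sc q + Wsq q) q = \<delta> sc q" if "q \<in> S0" for q
    using S0_subset[OF that] by (simp add: Wsq_def Wu_zero[OF that])
  then have 1: "dx l (\<delta> (\<lambda>q. sc q + Wsq q)) p = dx l (\<delta> sc) p" for l
    by (rule D_cong0[OF _ p])
  have "\<delta> (\<lambda>q. tim q k) p =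
      - 1/2 * (\<Sum>l\<in>UNIV. \<delta> (\<lambda>q. gu q k l) p * dx l sc p) - 1/2 * (\<Sum>l\<in>UNIV. gu p k l * dx l (\<delta> sc) p)
      + (\<Sum>m\<in>UNIV. gu p k m * dt (\<lambda>q. w q m) p)"
    unfolding tim_def using S
    by (simp add: \<delta>_commute D_Wl[OF p] dx_sc_Wsq[OF p] 1 sum.distrib add_divide_distrib del: D.d_add)
  moreover have "(\<Sum>l\<in>UNIV. hs p m l * tim p l) =
      - 1/2 * (\<Sum>l\<in>UNIV. hs p m l * (\<Sum>b\<in>UNIV. gu p l b * dx b sc p))" for m
    by (simp only: tim_eq[OF p] mult.left_commute[of _ "- 1/2"] sum_distrib_left[symmetric])
  ultimately show ?thesis
    by (simp only: \<delta>_gu_contract[OF S] right_diff_distrib sum_subtractf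
        mult.left_commute[of _ "1/2"] mult.left_commute[of _ "- 1/2"] sum_distrib_left[symmetric])
qed

lemma variation_stC:
  assumes p: "p \<in> S0"
  shows "\<delta> (\<lambda>q. stC q k i j) p = (\<Sum>m\<in>UNIV. stg p k m *
      (1/2 * (cov2 D stC hh p i j m + cov2 D stC hh p j i m - cov2 D stC hh p m i j)))"
proof (cases k)
  case None
  then show ?thesis using S0_subset[OF p] by simp
next
  case k: (Some k')
  have S: "p \<in> S" by (rule S0_subset[OF p])
  have sym: "(\<Sum>m\<in>UNIV. mixed p m a * hs p b m) = (\<Sum>m\<in>UNIV. mixed p m a * hs p m b)" for a b
    by (simp add: hs_sym[OF S, of b])
  \<comment> \<open>The symmetric part of nabla w comes from the evolution of h, the antisymmetric
    part from div h through \<open>curl_dv\<close>.\<close>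
  have mixed: "1/2 * (cov2 D stC hh p (Some i) None (Some m) + cov2 D stC hh p None (Some i) (Some m)
      - cov2 D stC hh p (Some m) (Some i) None) =
    cov1 dx \<Gamma> w p i m - \<delta> (\<lambda>q. Ric q i m) p - (\<Sum>l\<in>UNIV. hs p m l * mixed p l i)" for i m
    using curl_dv[OF p, of i m] sym[of m i]
    by (simp add: cov2_hh dt_hs[OF p] sym mult.commute[of "hs p _ _"])
  \<comment> \<open>After commuting \<open>dt\<close> with \<open>dx m\<close>, the term -1/2 dH of
    w joins -1/2 d(\<delta> R) to form half the gradient of the (0,0) component of
    \<open>hh\<close>.\<close>
  have tim: "1/2 * (2 * cov2 D stC hh p None None (Some m) - cov2 D stC hh p (Some m) None None) =
    dt (\<lambda>q. w q m) p - 1/2 * dx m (\<delta> sc) p - (\<Sum>l\<in>UNIV. hs p m l * tim p l)" for m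
  proof -
    have "dt (\<lambda>q. w q m) p = dt (\<lambda>q. dv q m - 1/2 * dx m H q) p"
      by (rule D_cong0[OF _ p]) (rule w_eq)
    moreover have "dx m (\<lambda>q. dvdv q + Rh q) p = dx m (\<lambda>q. dt H q + \<delta> sc q) p"
      by (rule D_cong0[OF _ p]) (simp add: dt_H_plus_variation_sc)
    ultimately show ?thesis
      using S D_commute[of H p None "Some m"]
      by (simp add: cov2_hh hs_sym[OF S, of _ m] mult.commute[of "hs p _ _"])
  qed
  have mixed': "1/2 * (cov2 D stC hh p None (Some i) (Some m) + cov2 D stC hh p (Some i) None (Some m)
      - cov2 D stC hh p (Some m) None (Some i)) =
    cov1 dx \<Gamma> w p i m - \<delta> (\<lambda>q. Ric q i m) p - (\<Sum>l\<in>UNIV. hs p m l * mixed p l i)" for i m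
    unfolding mixed[symmetric] by (simp add: cov2_hh sym)
  show ?thesis
  proof (cases i; cases j)
    fix i' j' assume "i = Some i'" "j = Some j'"
    then show ?thesis
      using variation_\<Gamma>[OF S] by (simp add: k sum_UNIV_option cov2_hh)
  next
    fix i' assume *: "i = Some i'" "j = None"
    show ?thesis
      unfolding * k using mixed[of i'] by (simp add: sum_UNIV_option variation_mixed[OF p] del: times_divide_eq_left times_divide_eq_right)
  next
    fix j' assume *: "i = None" "j = Some j'"
    show ?thesis
      unfolding * k using mixed'[of j'] by (simp add: sum_UNIV_option variation_mixed[OF p] del: times_divide_eq_left times_divide_eq_right)
  next
    assume *: "i = None" "j = None"
    show ?thesis
      unfolding * k using tim by (simp add: sum_UNIV_option variation_tim[OF p] del: times_divide_eq_left times_divide_eq_right)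
  qed
qed

lemma variation_stW:
  assumes p: "p \<in> S0"
  shows "\<delta> (\<lambda>q. stW q k) p = (\<Sum>a\<in>UNIV. \<Sum>b\<in>UNIV. stg p a b *
      (cov2 D stC hh p a b k - 1/2 * cov2 D stC hh p k a b))"
proof (cases k)
  case (Some k')
  then show ?thesis
    by (simp add: sum_UNIV_option cov2_hh variation_Wl[OF p])
next
  case None
  have S: "p \<in> S" by (rule S0_subset[OF p])
  \<comment> \<open>Since nabla W is zero on the slice, varying the inverse metric in the divergence
    contributes nothing.\<close>
  have "cov1 dx \<Gamma> Wl p j k = 0" for j k
    by (simp add: cov1_def D_Wl[OF p] Wl_zero[OF p])
  then have "\<delta> (\<lambda>q. stW q None) p = divw p"
    using S by (simp add: divw_def space.variation_cov1[OF p])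
  \<comment> \<open>Trading the Laplacian of \<open>H\<close> for the trace of dt h produces the
    time derivative that occurs in the space-time formula; the \<open>mixed\<close> terms then
    cancel.\<close>
  also have "\<dots> = dvdv p - 1/2 * space.tr p (\<lambda>i j. dt (\<lambda>q. hs q i j) p)"
    by (simp add: divw_eq[OF p] trace_dt_hs[OF p])
  also have "\<dots> = space.tr p (\<lambda>a b. cov2 D stC hh p (Some a) (Some b) None - 1/2 * cov2 D stC hh p None (Some a) (Some b))"
  proof -
    have "space.tr p (\<lambda>a b. \<Sum>m\<in>UNIV. mixed p m b * hs p a m) = space.tr p (\<lambda>a b. \<Sum>m\<in>UNIV. mixed p m a * hs p b m)"
      by (rule space.contract_swap[OF p])
    moreover have "space.tr p (\<lambda>a b. \<Sum>m\<in>UNIV. mixed p m a * hs p m b) = space.tr p (\<lambda>a b. \<Sum>m\<in>UNIV. mixed p m a * hs p b m)"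
      by (simp add: hs_sym[OF S])
    ultimately show ?thesis
      by (simp add: cov2_hh dvdv_def right_diff_distrib sum_subtractf diff_divide_distrib sum_divide_distrib[symmetric])
  qed
  finally show ?thesis
    by (simp add: None sum_UNIV_option)
qed

sublocale st: metric_variation sm S S0 D \<delta> stC stg hh stW
proof
  show "sm (\<lambda>q. hh q i j)" for i j by simp
  show "hh p i j = hh p j i" if "p \<in> S0" for p i j
    by (cases i; cases j) (simp_all add: hs_sym S0_subset[OF that])
  show "sm (\<lambda>q. stW q k)" for k by (cases k) simp_all
  show "stW p k = 0" if "p \<in> S0" for p k
    by (cases k) (simp_all add: Wl_zero[OF that] cov1_def D_Wl[OF that])
qed (fact variation_stC variation_stW)+

end

section \<open>Smooth maps\<close>

lemma differentiable_chain_line: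
  fixes F :: "'a::real_normed_vector \<Rightarrow> real"
  assumes "F differentiable at (y + a *\<^sub>R v)"
  shows "((\<lambda>a. F (y + a *\<^sub>R v)) has_real_derivative frechet_derivative F (at (y + a *\<^sub>R v)) v) (at a)"
proof -
  have "((\<lambda>a. y + a *\<^sub>R v) has_vector_derivative v) (at a)"
    by (auto intro!: derivative_eq_intros)
  moreover have "(F has_derivative frechet_derivative F (at (y + a *\<^sub>R v))) (at (y + a *\<^sub>R v))"
    using assms frechet_derivative_works by blast
  ultimately have "((F \<circ> (\<lambda>a. y + a *\<^sub>R v)) has_vector_derivative
      frechet_derivative F (at (y + a *\<^sub>R v)) v) (at a)"
    by (intro vector_derivative_diff_chain_within) (auto intro: has_derivative_at_withinI)
  then show ?thesis
    by (simp add: has_real_derivative_iff_has_vector_derivative o_def)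
qed

text \<open>The mean value theorem twice: along v for the difference in direction w, then along w
  for the v-derivative.\<close>

lemma second_difference:
  fixes F :: "'a::real_normed_vector \<Rightarrow> real"
  assumes h: "0 < h"
    and V: "\<And>a b. \<lbrakk>0 \<le> a; a \<le> h; 0 \<le> b; b \<le> h\<rbrakk> \<Longrightarrow> x + a *\<^sub>R v + b *\<^sub>R w \<in> V"
    and F: "\<And>y. y \<in> V \<Longrightarrow> F differentiable at y"
    and F': "\<And>y. y \<in> V \<Longrightarrow> (\<lambda>y. frechet_derivative F (at y) v) differentiable at y"
  shows "\<exists>a b. 0 < a \<and> a < h \<and> 0 < b \<and> b < h \<and>
    F (x + h *\<^sub>R v + h *\<^sub>R w) - F (x + h *\<^sub>R v) - F (x + h *\<^sub>R w) + F x =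
    h * h * frechet_derivative (\<lambda>y. frechet_derivative F (at y) v) (at (x + a *\<^sub>R v + b *\<^sub>R w)) w"
proof -
  define F1 where "F1 = (\<lambda>y. frechet_derivative F (at y) v)"
  have "\<exists>a>0. a < h \<and> (F (x + h *\<^sub>R w + h *\<^sub>R v) - F (x + h *\<^sub>R v)) - (F (x + h *\<^sub>R w + 0 *\<^sub>R v) - F (x + 0 *\<^sub>R v)) =
      (h - 0) * (F1 (x + h *\<^sub>R w + a *\<^sub>R v) - F1 (x + a *\<^sub>R v))"
  proof (rule MVT2[OF h])
    fix a assume "0 \<le> a" "a \<le> h"
    then have "x + h *\<^sub>R w + a *\<^sub>R v \<in> V" "x + a *\<^sub>R v \<in> V"
      using V[of a h] V[of a 0] h by (simp_all add: ac_simps)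
    then show "((\<lambda>a. F (x + h *\<^sub>R w + a *\<^sub>R v) - F (x + a *\<^sub>R v)) has_real_derivative
        F1 (x + h *\<^sub>R w + a *\<^sub>R v) - F1 (x + a *\<^sub>R v)) (at a)"
      unfolding F1_def by (intro DERIV_diff differentiable_chain_line F)
  qed
  then obtain a where a: "0 < a" "a < h" and
    "F (x + h *\<^sub>R w + h *\<^sub>R v) - F (x + h *\<^sub>R v) - F (x + h *\<^sub>R w) + F x =
      h * (F1 (x + h *\<^sub>R w + a *\<^sub>R v) - F1 (x + a *\<^sub>R v))"
    by auto
  moreover have "x + h *\<^sub>R w + c *\<^sub>R v = x + c *\<^sub>R v + h *\<^sub>R w" for c
    by simp
  ultimately have eq1: "F (x + h *\<^sub>R v + h *\<^sub>R w) - F (x + h *\<^sub>R v) - F (x + h *\<^sub>R w) + F x =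
      h * (F1 (x + a *\<^sub>R v + h *\<^sub>R w) - F1 (x + a *\<^sub>R v))"
    by metis
  have "\<exists>b>0. b < h \<and> F1 (x + a *\<^sub>R v + h *\<^sub>R w) - F1 (x + a *\<^sub>R v + 0 *\<^sub>R w) =
      (h - 0) * frechet_derivative F1 (at (x + a *\<^sub>R v + b *\<^sub>R w)) w"
  proof (rule MVT2[OF h])
    fix b assume "0 \<le> b" "b \<le> h"
    then have "x + a *\<^sub>R v + b *\<^sub>R w \<in> V"
      using V a by simp
    then show "((\<lambda>b. F1 (x + a *\<^sub>R v + b *\<^sub>R w)) has_real_derivative
        frechet_derivative F1 (at (x + a *\<^sub>R v + b *\<^sub>R w)) w) (at b)"
      unfolding F1_def by (intro differentiable_chain_line F')
  qed
  then obtain b where "0 < b" "b < h" "F1 (x + a *\<^sub>R v + h *\<^sub>R w) - F1 (x + a *\<^sub>R v) =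
      h * frechet_derivative F1 (at (x + a *\<^sub>R v + b *\<^sub>R w)) w"
    by auto
  then show ?thesis
    using a eq1 unfolding F1_def[symmetric] by (metis mult.assoc)
qed

lemma frechet_derivative_commute:
  fixes F :: "'a::real_normed_vector \<Rightarrow> real"
  assumes V: "open V" "x \<in> V" and F: "\<And>y. y \<in> V \<Longrightarrow> F differentiable at y"
    and F': "\<And>u y. y \<in> V \<Longrightarrow> (\<lambda>y. frechet_derivative F (at y) u) differentiable at y"
    and F'': "\<And>u u'. continuous_on V (\<lambda>y. frechet_derivative (\<lambda>y. frechet_derivative F (at y) u) (at y) u')"
  shows "frechet_derivative (\<lambda>y. frechet_derivative F (at y) v) (at x) w =
    frechet_derivative (\<lambda>y. frechet_derivative F (at y) w) (at x) v"
proof -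
  define P where "P = (\<lambda>u u' y. frechet_derivative (\<lambda>y. frechet_derivative F (at y) u) (at y) u')"
  have "\<bar>P v w x - P w v x\<bar> \<le> e" if e: "0 < e" for e
  proof -
    have cont: "\<exists>d>0. \<forall>y. dist y x < d \<longrightarrow> dist (P u u' y) (P u u' x) < e / 2" for u u'
    proof -
      have "continuous (at x) (P u u')"
        using F''[of u u'] V continuous_on_eq_continuous_at unfolding P_def by blast
      then show ?thesis
        using e unfolding continuous_at_eps_delta by (meson half_gt_zero)
    qed
    obtain d1 where d1: "0 < d1" "\<And>y. dist y x < d1 \<Longrightarrow> dist (P v w y) (P v w x) < e / 2"
      using cont by blast
    obtain d2 where d2: "0 < d2" "\<And>y. dist y x < d2 \<Longrightarrow> dist (P w v y) (P w v x) < e / 2"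
      using cont by blast
    obtain d0 where d0: "0 < d0" "ball x d0 \<subseteq> V"
      using V open_contains_ball by blast
    define d where "d = min d0 (min d1 d2)"
    \<comment> \<open>Keeps the parallelogram spanned by h v and h w within distance d of x; the
      summand 1 covers the case v = w = 0.\<close>
    define h where "h = d / (2 * (norm v + norm w + 1))"
    have pos: "0 < norm v + norm w + 1"
      using norm_ge_zero[of v] norm_ge_zero[of w] by linarith
    have h: "0 < h"
      using d0 d1 d2 pos by (simp add: h_def d_def)
    have near: "dist (x + a *\<^sub>R v + b *\<^sub>R w) x < d" if "0 \<le> a" "a \<le> h" "0 \<le> b" "b \<le> h" for a b
    proof -
      have "dist (x + a *\<^sub>R v + b *\<^sub>R w) x = norm (a *\<^sub>R v + b *\<^sub>R w)"
        by (simp add: dist_norm add.assoc)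
      also have "\<dots> \<le> norm (a *\<^sub>R v) + norm (b *\<^sub>R w)"
        by (rule norm_triangle_ineq)
      also have "\<dots> \<le> h * norm v + h * norm w"
        using that by (intro add_mono) (simp_all add: mult_right_mono)
      also have "\<dots> < h * (2 * (norm v + norm w + 1))"
        using h pos by (simp add: algebra_simps add_strict_increasing)
      also have "\<dots> = d"
        using pos by (simp add: h_def)
      finally show ?thesis .
    qed
    have inV: "x + a *\<^sub>R v + b *\<^sub>R w \<in> V" if "0 \<le> a" "a \<le> h" "0 \<le> b" "b \<le> h" for a b
      using near[OF that] d0 by (auto simp: d_def dist_commute)
    obtain a b where ab: "0 < a" "a < h" "0 < b" "b < h"
      "F (x + h *\<^sub>R v + h *\<^sub>R w) - F (x + h *\<^sub>R v) - F (x + h *\<^sub>R w) + F x = h * h * P v w (x + a *\<^sub>R v + b *\<^sub>R w)"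
      using second_difference[OF h, of x v w V F, OF inV F F'] unfolding P_def by blast
    have inV': "x + a *\<^sub>R w + b *\<^sub>R v \<in> V" if "0 \<le> a" "a \<le> h" "0 \<le> b" "b \<le> h" for a b
      using inV[OF that(3,4,1,2)] by (simp add: ac_simps)
    obtain a' b' where ab': "0 < a'" "a' < h" "0 < b'" "b' < h"
      "F (x + h *\<^sub>R w + h *\<^sub>R v) - F (x + h *\<^sub>R w) - F (x + h *\<^sub>R v) + F x = h * h * P w v (x + a' *\<^sub>R w + b' *\<^sub>R v)"
      using second_difference[OF h, of x w v V F, OF inV' F F'] unfolding P_def by blast
    \<comment> \<open>Both orders of differentiation evaluate the same second difference.\<close>
    have "h * h * P v w (x + a *\<^sub>R v + b *\<^sub>R w) = h * h * P w v (x + a' *\<^sub>R w + b' *\<^sub>R v)"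
    proof -
      have "F (x + h *\<^sub>R w + h *\<^sub>R v) = F (x + h *\<^sub>R v + h *\<^sub>R w)"
        by (simp add: ac_simps)
      then show ?thesis
        using ab(5) ab'(5) by linarith
    qed
    then have eq: "P v w (x + a *\<^sub>R v + b *\<^sub>R w) = P w v (x + a' *\<^sub>R w + b' *\<^sub>R v)"
      using h by simp
    have "dist (P v w (x + a *\<^sub>R v + b *\<^sub>R w)) (P v w x) < e / 2"
      using near[of a b] ab by (intro d1) (simp add: d_def)
    moreover have "dist (P w v (x + a' *\<^sub>R w + b' *\<^sub>R v)) (P w v x) < e / 2"
      using near[of b' a'] ab' by (intro d2) (simp add: d_def ac_simps)
    ultimately show ?thesis
      unfolding eq dist_real_def by linarith
  qed
  then have "P v w x = P w v x"
    using field_le_epsilon[of "\<bar>P v w x - P w v x\<bar>" 0] by simp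
  then show ?thesis by (simp add: P_def)
qed

section \<open>Closure properties of C^k maps on open sets\<close>

lemma Ck_on_cong:
  assumes "open V" "\<And>x. x \<in> V \<Longrightarrow> f x = g x" "Ck_on k V f"
  shows "Ck_on k V g"
  using assms(2,3)
proof (induction k arbitrary: f g)
  case 0
  then show ?case by (simp cong: continuous_on_cong)
next
  case (Suc k)
  have deriv: "(g has_derivative frechet_derivative f (at x)) (at x)" if "x \<in> V" for x
    using Suc.prems that assms(1) frechet_derivative_works has_derivative_transform_within_open
    by (metis Ck_on.simps(2))
  then have "frechet_derivative f (at x) = frechet_derivative g (at x)" if "x \<in> V" for x
    using that frechet_derivative_at by blast
  then have "Ck_on k V (\<lambda>x. frechet_derivative g (at x) v)" for v
    using Suc.IH[of "\<lambda>x. frechet_derivative f (at x) v" "\<lambda>x. frechet_derivative g (at x) v"] Suc.prems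
    by simp
  moreover have "\<forall>x\<in>V. g differentiable at x"
    using deriv differentiable_def by blast
  ultimately show ?case by simp
qed

lemma Ck_on_subset: "Ck_on k V f \<Longrightarrow> W \<subseteq> V \<Longrightarrow> Ck_on k W f"
  by (induction k arbitrary: f) (auto intro: continuous_on_subset)

lemma Ck_on_SucD: "Ck_on (Suc k) V f \<Longrightarrow> Ck_on k V f"
proof (induction k arbitrary: f)
  case 0
  then show ?case
    by (auto intro!: continuous_at_imp_continuous_on differentiable_imp_continuous_within)
next
  case (Suc k)
  then show ?case by (metis Ck_on.simps(2))
qed

text \<open>Lets an explicit derivative formula stand in for \<open>frechet_derivative\<close>; this
  is the induction step of the closure proofs.\<close>

lemma Ck_on_SucI:
  assumes "open V" "\<And>x. x \<in> V \<Longrightarrow> (f has_derivative f' x) (at x)" "\<And>v. Ck_on k V (\<lambda>x. f' x v)"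
  shows "Ck_on (Suc k) V f"
proof -
  have "f' x = frechet_derivative f (at x)" if "x \<in> V" for x
    using assms(2)[OF that] frechet_derivative_at by blast
  then have "Ck_on k V (\<lambda>x. frechet_derivative f (at x) v)" for v
    using Ck_on_cong[OF assms(1) _ assms(3)[of v]] by simp
  then show ?thesis
    using assms(2) by (auto simp: differentiable_def)
qed

lemma Ck_on_has_derivative:
  "Ck_on (Suc k) V f \<Longrightarrow> x \<in> V \<Longrightarrow> (f has_derivative frechet_derivative f (at x)) (at x)"
  using frechet_derivative_works by auto

lemma Ck_on_const: "open V \<Longrightarrow> Ck_on k V (\<lambda>x. c)"
  by (induction k arbitrary: c) (auto intro!: Ck_on_SucI[where f' = "\<lambda>x v. 0"] simp del: Ck_on.simps(2))

lemma Ck_on_add: "open V \<Longrightarrow> Ck_on k V f \<Longrightarrow> Ck_on k V g \<Longrightarrow> Ck_on k V (\<lambda>x. f x + g x)"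
proof (induction k arbitrary: f g)
  case (Suc k)
  then show ?case
    by (intro Ck_on_SucI[where f' = "\<lambda>x v. frechet_derivative f (at x) v + frechet_derivative g (at x) v"])
       (auto intro!: has_derivative_add Ck_on_has_derivative simp del: Ck_on.simps(2), simp)
qed (auto intro: continuous_on_add)

lemma Ck_on_mult:
  fixes f g :: "'a::euclidean_space \<Rightarrow> real"
  shows "open V \<Longrightarrow> Ck_on k V f \<Longrightarrow> Ck_on k V g \<Longrightarrow> Ck_on k V (\<lambda>x. f x * g x)"
proof (induction k arbitrary: f g)
  case (Suc k)
  show ?case
  proof (rule Ck_on_SucI)
    show "((\<lambda>x. f x * g x) has_derivative
        (\<lambda>v. f x * frechet_derivative g (at x) v + frechet_derivative f (at x) v * g x)) (at x)" if "x \<in> V" for x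
      using Suc.prems that by (intro has_derivative_mult Ck_on_has_derivative)
    show "Ck_on k V (\<lambda>x. f x * frechet_derivative g (at x) v + frechet_derivative f (at x) v * g x)" for v
      using Suc.prems Suc.prems(2,3)[THEN Ck_on_SucD] by (intro Ck_on_add Suc.IH) auto
  qed (use Suc.prems in auto)
qed (auto intro: continuous_on_mult)

lemma Ck_on_inverse:
  fixes f :: "'a::euclidean_space \<Rightarrow> real"
  shows "open V \<Longrightarrow> (\<And>x. x \<in> V \<Longrightarrow> f x \<noteq> 0) \<Longrightarrow> Ck_on k V f \<Longrightarrow> Ck_on k V (\<lambda>x. inverse (f x))"
proof (induction k)
  case (Suc k)
  show ?case
  proof (rule Ck_on_SucI)
    show "((\<lambda>x. inverse (f x)) has_derivative
        (\<lambda>v. - (inverse (f x) * frechet_derivative f (at x) v * inverse (f x)))) (at x)" if "x \<in> V" for x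
      using Suc.prems that by (intro Deriv.has_derivative_inverse Ck_on_has_derivative)
    show "Ck_on k V (\<lambda>x. - (inverse (f x) * frechet_derivative f (at x) v * inverse (f x)))" for v
    proof -
      have "Ck_on k V (\<lambda>x. - 1 * (inverse (f x) * frechet_derivative f (at x) v * inverse (f x)))"
        using Suc.prems Suc.prems(3)[THEN Ck_on_SucD] by (intro Ck_on_mult Ck_on_const Suc.IH) auto
      then show ?thesis by simp
    qed
  qed (use Suc.prems in auto)
qed (auto intro: continuous_on_inverse)

lemma Ck_on_linear:
  assumes L: "bounded_linear L"
  shows "open V \<Longrightarrow> Ck_on k V f \<Longrightarrow> Ck_on k V (\<lambda>x. L (f x))"
proof (induction k arbitrary: f)
  case 0
  then show ?case
    using bounded_linear.continuous_on[OF L] by auto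
next
  case (Suc k)
  show ?case
  proof (rule Ck_on_SucI)
    show "((\<lambda>x. L (f x)) has_derivative (\<lambda>v. L (frechet_derivative f (at x) v))) (at x)" if "x \<in> V" for x
      using Suc.prems that bounded_linear.has_derivative[OF L] Ck_on_has_derivative by blast
    show "Ck_on k V (\<lambda>x. L (frechet_derivative f (at x) v))" for v
      using Suc by simp
  qed (use Suc.prems in auto)
qed

section \<open>Smooth functions on sets that need not be open\<close>

lemma smooth_onE:
  assumes "smooth_on S f" "x \<in> S"
  obtains V F where "open V" "x \<in> V" "\<forall>k. Ck_on k V F" "\<forall>y. y \<in> S \<longrightarrow> y \<in> V \<longrightarrow> F y = f y"
proof -
  have "\<exists>V F. open V \<and> x \<in> V \<and> (\<forall>k. Ck_on k V F) \<and> (\<forall>y\<in>S \<inter> V. F y = f y)"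
    using assms by (simp add: smooth_on_def)
  then show thesis
    using that by fast
qed

lemma smooth_onI:
  assumes "\<And>x. x \<in> S \<Longrightarrow> \<exists>V F. open V \<and> x \<in> V \<and> (\<forall>k. Ck_on k V F) \<and> (\<forall>y\<in>S \<inter> V. F y = f y)"
  shows "smooth_on S f"
  using assms by (simp add: smooth_on_def)

lemma smooth_on_const: "smooth_on S (\<lambda>x. c)"
  by (rule smooth_onI) (use Ck_on_const[OF open_UNIV] in blast)

lemma smooth_on_add:
  assumes "smooth_on S f" "smooth_on S g"
  shows "smooth_on S (\<lambda>x. f x + g x)"
proof (rule smooth_onI)
  fix x assume x: "x \<in> S"
  obtain V F where "open V" "x \<in> V" "\<forall>k. Ck_on k V F" "\<forall>y. y \<in> S \<longrightarrow> y \<in> V \<longrightarrow> F y = f y"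
    using smooth_onE[OF assms(1) x] .
  note F = this(1,2) this(3,4)[rule_format]
  obtain W G where "open W" "x \<in> W" "\<forall>k. Ck_on k W G" "\<forall>y. y \<in> S \<longrightarrow> y \<in> W \<longrightarrow> G y = g y"
    using smooth_onE[OF assms(2) x] .
  note G = this(1,2) this(3,4)[rule_format]
  have "Ck_on k (V \<inter> W) (\<lambda>x. F x + G x)" for k
    using F G by (intro Ck_on_add) (auto intro: Ck_on_subset)
  then show "\<exists>V F. open V \<and> x \<in> V \<and> (\<forall>k. Ck_on k V F) \<and> (\<forall>y\<in>S \<inter> V. F y = f y + g y)"
    using F G by (intro exI[of _ "V \<inter> W"] exI[of _ "\<lambda>x. F x + G x"]) auto
qed

lemma smooth_on_mult:
  fixes f g :: "'a::euclidean_space \<Rightarrow> real"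
  assumes "smooth_on S f" "smooth_on S g"
  shows "smooth_on S (\<lambda>x. f x * g x)"
proof (rule smooth_onI)
  fix x assume x: "x \<in> S"
  obtain V F where "open V" "x \<in> V" "\<forall>k. Ck_on k V F" "\<forall>y. y \<in> S \<longrightarrow> y \<in> V \<longrightarrow> F y = f y"
    using smooth_onE[OF assms(1) x] .
  note F = this(1,2) this(3,4)[rule_format]
  obtain W G where "open W" "x \<in> W" "\<forall>k. Ck_on k W G" "\<forall>y. y \<in> S \<longrightarrow> y \<in> W \<longrightarrow> G y = g y"
    using smooth_onE[OF assms(2) x] .
  note G = this(1,2) this(3,4)[rule_format]
  have "Ck_on k (V \<inter> W) (\<lambda>x. F x * G x)" for k
    using F G by (intro Ck_on_mult) (auto intro: Ck_on_subset)
  then show "\<exists>V F. open V \<and> x \<in> V \<and> (\<forall>k. Ck_on k V F) \<and> (\<forall>y\<in>S \<inter> V. F y = f y * g y)"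
    using F G by (intro exI[of _ "V \<inter> W"] exI[of _ "\<lambda>x. F x * G x"]) auto
qed

lemma smooth_on_inverse:
  fixes f :: "'a::euclidean_space \<Rightarrow> real"
  assumes "smooth_on S f" "\<And>x. x \<in> S \<Longrightarrow> f x \<noteq> 0"
  shows "smooth_on S (\<lambda>x. inverse (f x))"
proof (rule smooth_onI)
  fix x assume x: "x \<in> S"
  obtain V F where "open V" "x \<in> V" "\<forall>k. Ck_on k V F" "\<forall>y. y \<in> S \<longrightarrow> y \<in> V \<longrightarrow> F y = f y"
    using smooth_onE[OF assms(1) x] .
  note F = this(1,2) this(3,4)[rule_format]
  have "continuous_on V F"
    using F(3)[of 0] by simp
  \<comment> \<open>The local extension may vanish off \<open>S\<close>, so its domain is shrunk to
    the open set where it does not.\<close>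
  then have "open {y \<in> V. F y \<in> - {0}}"
    using F(1) by (intro continuous_open_preimage[unfolded Int_def vimage_def, simplified]) auto
  moreover have "Ck_on k {y \<in> V. F y \<in> - {0}} (\<lambda>x. inverse (F x))" for k
    using calculation F by (intro Ck_on_inverse) (auto intro: Ck_on_subset)
  moreover have "x \<in> {y \<in> V. F y \<in> - {0}}"
    using F x assms(2) by auto
  ultimately show "\<exists>V G. open V \<and> x \<in> V \<and> (\<forall>k. Ck_on k V G) \<and> (\<forall>y\<in>S \<inter> V. G y = inverse (f y))"
    using F by (intro exI[of _ "{y \<in> V. F y \<in> - {0}}"] exI[of _ "\<lambda>x. inverse (F x)"]) auto
qed

lemma smooth_on_linear:
  assumes "bounded_linear L" "smooth_on S f"
  shows "smooth_on S (\<lambda>x. L (f x))"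
proof (rule smooth_onI)
  fix x assume x: "x \<in> S"
  obtain V F where "open V" "x \<in> V" "\<forall>k. Ck_on k V F" "\<forall>y. y \<in> S \<longrightarrow> y \<in> V \<longrightarrow> F y = f y"
    using smooth_onE[OF assms(2) x] .
  note F = this(1,2) this(3,4)[rule_format]
  have "Ck_on k V (\<lambda>x. L (F x))" for k
    by (rule Ck_on_linear[OF assms(1) F(1,3)])
  then show "\<exists>V G. open V \<and> x \<in> V \<and> (\<forall>k. Ck_on k V G) \<and> (\<forall>y\<in>S \<inter> V. G y = L (f y))"
    using F by (intro exI[of _ V] exI[of _ "\<lambda>x. L (F x)"]) auto
qed

lemma smooth_on_cong:
  assumes "\<And>x. x \<in> S \<Longrightarrow> f x = g x"
  shows "smooth_on S f \<longleftrightarrow> smooth_on S g"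
  unfolding smooth_on_def using assms by (metis IntD1)

lemma smooth_functions_smooth_on:
  "smooth_functions (smooth_on S :: ('a::euclidean_space \<Rightarrow> real) \<Rightarrow> bool)"
  by unfold_locales (auto intro: smooth_on_const smooth_on_add smooth_on_mult)

text \<open>Every smooth local extension computes \<open>d\<close> in the fixed direction v, also at
  boundary points of \<open>S\<close>. One-sided derivatives thus become ordinary ones of an
  extension.\<close>

definition directional :: "'a::euclidean_space set \<Rightarrow> (('a \<Rightarrow> real) \<Rightarrow> 'a \<Rightarrow> real) \<Rightarrow> 'a \<Rightarrow> bool" where
  "directional S d v \<longleftrightarrow> (\<forall>f F V p. open V \<longrightarrow> p \<in> S \<longrightarrow> p \<in> V \<longrightarrow> (\<forall>k. Ck_on k V F) \<longrightarrow>
     (\<forall>y\<in>S \<inter> V. F y = f y) \<longrightarrow> d f p = frechet_derivative F (at p) v)"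

lemma directionalD:
  assumes "directional S d v" "open V" "p \<in> S" "p \<in> V" "\<And>k. Ck_on k V F" "\<And>y. y \<in> S \<Longrightarrow> y \<in> V \<Longrightarrow> F y = f y"
  shows "d f p = frechet_derivative F (at p) v"
  using assms unfolding directional_def by blast

lemma has_vector_derivative_along:
  fixes F f :: "'a::euclidean_space \<Rightarrow> real"
  assumes V: "open V" "p \<in> V" "\<And>k. Ck_on k V F" "\<And>y. y \<in> S \<Longrightarrow> y \<in> V \<Longrightarrow> F y = f y"
    and c: "c r = p" "r \<in> K" "\<And>r. r \<in> K \<Longrightarrow> c r \<in> S" "(c has_vector_derivative v) (at r within K)"
  shows "((\<lambda>r. f (c r)) has_vector_derivative frechet_derivative F (at p) v) (at r within K)"
proof -
  have "(F has_derivative frechet_derivative F (at p)) (at p)"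
    using Ck_on_has_derivative[OF V(3) V(2)] .
  then have "((F \<circ> c) has_vector_derivative frechet_derivative F (at p) v) (at r within K)"
    using c by (intro vector_derivative_diff_chain_within) (auto intro: has_derivative_at_withinI)
  moreover have "continuous (at r within K) c"
    using c(4) has_vector_derivative_continuous by blast
  then have "\<forall>\<^sub>F r in at r within K. c r \<in> V"
    using V c(1) unfolding continuous_within by (metis topological_tendstoD)
  then obtain e where e: "0 < e" "\<And>r'. r' \<in> K \<Longrightarrow> r' \<noteq> r \<Longrightarrow> dist r' r < e \<Longrightarrow> c r' \<in> V"
    unfolding eventually_at by blast
  ultimately show ?thesis
    using c V(2,4) by (elim has_vector_derivative_transform_within[OF _ e(1) c(2)]) (metis o_apply)
qed

text \<open>\<open>d\<close> differentiates along a curve that stays in \<open>S\<close> and has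
  velocity v. The nontrivial filter makes the vector derivative unique.\<close>

lemma directionalI:
  assumes "\<And>p. p \<in> S \<Longrightarrow> \<exists>c r K. (\<forall>f. d f p = vector_derivative (\<lambda>r. f (c r)) (at r within K)) \<and>
    c r = p \<and> r \<in> K \<and> c ` K \<subseteq> S \<and> (c has_vector_derivative v) (at r within K) \<and> at r within K \<noteq> bot"
  shows "directional S d v"
  unfolding directional_def
proof (intro allI impI)
  fix f F :: "'a \<Rightarrow> real" and V p assume *: "open V" "p \<in> S" "p \<in> V" "\<forall>k. Ck_on k V F" "\<forall>y\<in>S \<inter> V. F y = f y"
  obtain c r K where c: "\<And>f. d f p = vector_derivative (\<lambda>r. f (c r)) (at r within K)"
    "c r = p" "r \<in> K" "c ` K \<subseteq> S" "(c has_vector_derivative v) (at r within K)" "at r within K \<noteq> bot"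
    using assms[OF *(2)] by blast
  have "((\<lambda>r. f (c r)) has_vector_derivative frechet_derivative F (at p) v) (at r within K)"
    using * c by (intro has_vector_derivative_along[where S = S and V = V]) auto
  then show "d f p = frechet_derivative F (at p) v"
    unfolding c(1) by (rule vector_derivative_within[OF c(6)])
qed

lemma directional_smooth:
  assumes "directional S d v" "smooth_on S f"
  shows "smooth_on S (d f)"
proof (rule smooth_onI)
  fix x assume x: "x \<in> S"
  obtain V F where "open V" "x \<in> V" "\<forall>k. Ck_on k V F" "\<forall>y. y \<in> S \<longrightarrow> y \<in> V \<longrightarrow> F y = f y"
    using smooth_onE[OF assms(2) x] .
  note F = this(1,2) this(3,4)[rule_format]
  have "Ck_on k V (\<lambda>x. frechet_derivative F (at x) v)" for k
    using F(3)[of "Suc k"] by simp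
  moreover have "frechet_derivative F (at y) v = d f y" if "y \<in> S \<inter> V" for y
    using directionalD[OF assms(1) F(1) _ _ F(3,4)] that by simp
  ultimately show "\<exists>V F. open V \<and> x \<in> V \<and> (\<forall>k. Ck_on k V F) \<and> (\<forall>y\<in>S \<inter> V. F y = d f y)"
    using F by blast
qed

lemma directional_derivation:
  assumes d: "directional S d v"
    and cong: "\<And>f f' p. (\<And>q. q \<in> S \<Longrightarrow> f q = f' q) \<Longrightarrow> p \<in> S \<Longrightarrow> d f p = d f' p"
  shows "derivation S (smooth_on S) d"
proof
  show "smooth_on S (d f)" if "smooth_on S f" for f
    using d that by (rule directional_smooth)
  show "d (\<lambda>q. c) p = 0" if "p \<in> S" for c p
  proof -
    have "d (\<lambda>q. c) p = frechet_derivative (\<lambda>q. c) (at p) v"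
      by (rule directionalD[OF d open_UNIV that UNIV_I Ck_on_const[OF open_UNIV]]) simp
    then show ?thesis by simp
  qed
  show "d f p = d f' p" if "\<And>q. q \<in> S \<Longrightarrow> f q = f' q" "p \<in> S" for f f' p
    using that by (rule cong)
next
  fix f g :: "'a \<Rightarrow> real" and p assume f: "smooth_on S f" and g: "smooth_on S g" and p: "p \<in> S"
  obtain V F where "open V" "p \<in> V" "\<forall>k. Ck_on k V F" "\<forall>y. y \<in> S \<longrightarrow> y \<in> V \<longrightarrow> F y = f y"
    using smooth_onE[OF f p] .
  note F = this(1,2) this(3,4)[rule_format]
  obtain W G where "open W" "p \<in> W" "\<forall>k. Ck_on k W G" "\<forall>y. y \<in> S \<longrightarrow> y \<in> W \<longrightarrow> G y = g y"
    using smooth_onE[OF g p] .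
  note G = this(1,2) this(3,4)[rule_format]
  have F': "(F has_derivative frechet_derivative F (at p)) (at p)"
    using Ck_on_has_derivative[OF F(3,2)] .
  have G': "(G has_derivative frechet_derivative G (at p)) (at p)"
    using Ck_on_has_derivative[OF G(3,2)] .
  have V: "open (V \<inter> W)" "p \<in> V \<inter> W"
    using F G by auto
  have df: "d f p = frechet_derivative F (at p) v"
    using directionalD[OF d F(1) p F(2,3,4)] .
  have dg: "d g p = frechet_derivative G (at p) v"
    using directionalD[OF d G(1) p G(2,3,4)] .
  have FG: "Ck_on k (V \<inter> W) F" "Ck_on k (V \<inter> W) G" for k
    using F(3) G(3) by (auto intro: Ck_on_subset)
  have "d (\<lambda>q. f q + g q) p = frechet_derivative (\<lambda>q. F q + G q) (at p) v"
    using F G by (intro directionalD[OF d V(1) p V(2)] Ck_on_add V FG) auto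
  also have "\<dots> = frechet_derivative F (at p) v + frechet_derivative G (at p) v"
    using frechet_derivative_at[OF has_derivative_add[OF F' G']] by metis
  finally show "d (\<lambda>q. f q + g q) p = d f p + d g p"
    by (simp add: df dg)
  have "d (\<lambda>q. f q * g q) p = frechet_derivative (\<lambda>q. F q * G q) (at p) v"
    using F G by (intro directionalD[OF d V(1) p V(2)] Ck_on_mult V FG) auto
  also have "\<dots> = F p * frechet_derivative G (at p) v + frechet_derivative F (at p) v * G p"
    using frechet_derivative_at[OF has_derivative_mult[OF F' G']] by metis
  finally show "d (\<lambda>q. f q * g q) p = d f p * g p + f p * d g p"
    using F G p by (simp add: df dg)
qed

text \<open>One extension serves all nearby points, so both iterated derivatives are second
  derivatives of it and \<open>frechet_derivative_commute\<close> applies.\<close>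

lemma directional_commute:
  assumes d: "directional S d v" and d': "directional S d' v'" and f: "smooth_on S f" and p: "p \<in> S"
  shows "d (d' f) p = d' (d f) p"
proof -
  obtain V F where "open V" "p \<in> V" "\<forall>k. Ck_on k V F" "\<forall>y. y \<in> S \<longrightarrow> y \<in> V \<longrightarrow> F y = f y"
    using smooth_onE[OF f p] .
  note F = this(1,2) this(3,4)[rule_format]
  have Ck: "Ck_on k V (\<lambda>x. frechet_derivative F (at x) u)" for k u
    using F(3)[of "Suc k"] by simp
  have "d (d' f) p = frechet_derivative (\<lambda>x. frechet_derivative F (at x) v') (at p) v"
    by (rule directionalD[OF d F(1) p F(2) Ck]) (simp add: directionalD[OF d' F(1) _ _ F(3,4)])
  moreover have "d' (d f) p = frechet_derivative (\<lambda>x. frechet_derivative F (at x) v) (at p) v'"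
    by (rule directionalD[OF d' F(1) p F(2) Ck]) (simp add: directionalD[OF d F(1) _ _ F(3,4)])
  moreover have "frechet_derivative (\<lambda>x. frechet_derivative F (at x) v') (at p) v =
      frechet_derivative (\<lambda>x. frechet_derivative F (at x) v) (at p) v'"
  proof (rule frechet_derivative_commute[OF F(1,2)])
    show "F differentiable at y" if "y \<in> V" for y
      using F(3)[of 1] that by simp
    show "(\<lambda>y. frechet_derivative F (at y) u) differentiable at y" if "y \<in> V" for u y
      using Ck[of 1] that by simp
    show "continuous_on V (\<lambda>y. frechet_derivative (\<lambda>y. frechet_derivative F (at y) u) (at y) u')" for u u'
      using Ck[of 1] by simp
  qed
  ultimately show ?thesis by simp
qed

section \<open>The three-parameter domain\<close>

text \<open>Points \<open>(t, s, x)\<close>: time, deformation parameter, coordinates.\<close>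

type_synonym 'n dpt = "real \<times> real \<times> (real^'n)"

text \<open>Built from \<open>st_pd\<close> with s frozen, so that the operators translate to those
  on space and space-time by unfolding.\<close>

definition dpd :: "real set \<Rightarrow> ('n::finite option, 'n dpt) pderiv" where
  "dpd I a f q = st_pd I a (\<lambda>p. f (fst p, fst (snd q), snd p)) (fst q, snd (snd q))"

definition dvar :: "('n::finite dpt \<Rightarrow> real) \<Rightarrow> 'n dpt \<Rightarrow> real" where
  "dvar f q = vector_derivative (\<lambda>\<sigma>. f (fst q, \<sigma>, snd (snd q))) (at (fst (snd q)))"

lemma dpd_simps:
  "dpd I None f (t, s, x) = vector_derivative (\<lambda>\<tau>. f (\<tau>, s, x)) (at t within I)"
  "dpd I (Some i) f (t, s, x) = vector_derivative (\<lambda>r. f (t, s, x + r *\<^sub>R axis i 1)) (at 0)"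
  by (simp_all add: dpd_def st_pd_def pd_def)

lemma vector_derivative_cong_within:
  assumes "\<And>r. r \<in> K \<Longrightarrow> f r = f' r" "r \<in> K"
  shows "vector_derivative f (at r within K) = vector_derivative f' (at r within K)"
  using assms by (intro vector_derivative_cong_eq) auto

lemma at_within_line:
  fixes x :: "'a::real_normed_vector"
  assumes U: "open U" and x: "x \<in> U"
  shows "at (0::real) within {r. x + r *\<^sub>R v \<in> U} = at 0"
proof (rule at_within_open)
  show "open {r. x + r *\<^sub>R v \<in> U}"
    using open_vimage[OF U, of "\<lambda>r. x + r *\<^sub>R v"] by (simp add: vimage_def continuous_intros)
qed (simp add: x)

context
  fixes I J :: "real set" and U :: "(real^'n::finite) set"
  assumes I: "\<And>t. t \<in> I \<Longrightarrow> at t within I \<noteq> bot" and J: "open J" "0 \<in> J" and U: "open U"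
begin

text \<open>Restricting to parameters that stay in the open set \<open>U\<close> leaves the filter
  unchanged and shows that only values on \<open>U\<close> matter.\<close>

lemma dpd_Some_within: "x \<in> U \<Longrightarrow> dpd I (Some i) f (t, s, x) =
    vector_derivative (\<lambda>r. f (t, s, x + r *\<^sub>R axis i 1)) (at 0 within {r. x + r *\<^sub>R axis i 1 \<in> U})"
  using at_within_line[OF U] by (simp add: dpd_simps)

lemma dvar_within: "s \<in> J \<Longrightarrow> dvar f (t, s, x) = vector_derivative (\<lambda>\<sigma>. f (t, \<sigma>, x)) (at s within J)"
  using at_within_open[OF _ J(1)] by (simp add: dvar_def)

text \<open>\<open>dpd\<close> never moves s, hence the arbitrary \<open>K\<close>: \<open>J\<close>
  gives \<open>d_cong\<close>, the singleton of 0 gives \<open>D_cong0\<close>.\<close>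

lemma dpd_cong:
  assumes "\<And>q. q \<in> I \<times> K \<times> U \<Longrightarrow> f q = f' q" "p \<in> I \<times> K \<times> U"
  shows "dpd I a f p = dpd I a f' p"
proof -
  obtain t s x where p: "p = (t, s, x)" "t \<in> I" "s \<in> K" "x \<in> U"
    using assms(2) by auto
  show ?thesis
  proof (cases a)
    case None
    then show ?thesis
      using p assms(1) by (auto simp: dpd_simps intro!: vector_derivative_cong_within)
  next
    case (Some i)
    then show ?thesis
      using p assms(1) by (auto simp: dpd_Some_within intro!: vector_derivative_cong_within)
  qed
qed

lemma dvar_cong:
  assumes "\<And>q. q \<in> I \<times> J \<times> U \<Longrightarrow> f q = f' q" "p \<in> I \<times> J \<times> U"
  shows "dvar f p = dvar f' p"
  using assms by (auto simp: dvar_within intro!: vector_derivative_cong_within)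

lemma directional_dpd: "\<exists>v. directional (I \<times> J \<times> U) (dpd I a) v"
proof (cases a)
  case None
  have "directional (I \<times> J \<times> U) (dpd I None) (1, 0, 0)"
  proof (rule directionalI)
    fix p assume "p \<in> I \<times> J \<times> U"
    then obtain t s x where p: "p = (t, s, x)" "t \<in> I" "s \<in> J" "x \<in> U" by auto
    have "((\<lambda>\<tau>. (\<tau>, s, x)) has_vector_derivative (1, 0, 0)) (at t within I)"
      by (auto intro!: derivative_eq_intros has_vector_derivative_Pair simp: zero_prod_def)
    then show "\<exists>c r K. (\<forall>f. dpd I None f p = vector_derivative (\<lambda>r. f (c r)) (at r within K)) \<and>
      c r = p \<and> r \<in> K \<and> c ` K \<subseteq> I \<times> J \<times> U \<and> (c has_vector_derivative (1, 0, 0)) (at r within K) \<and> at r within K \<noteq> bot"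
      using p I by (intro exI[of _ "\<lambda>\<tau>. (\<tau>, s, x)"] exI[of _ t] exI[of _ I]) (auto simp: dpd_simps)
  qed
  then show ?thesis using None by blast
next
  case (Some i)
  have "directional (I \<times> J \<times> U) (dpd I (Some i)) (0, 0, axis i 1)"
  proof (rule directionalI)
    fix p assume "p \<in> I \<times> J \<times> U"
    then obtain t s x where p: "p = (t, s, x)" "t \<in> I" "s \<in> J" "x \<in> U" by auto
    have "((\<lambda>r. (t, s, x + r *\<^sub>R axis i 1)) has_vector_derivative (0, 0, axis i 1)) (at 0 within {r. x + r *\<^sub>R axis i 1 \<in> U})"
      by (auto intro!: derivative_eq_intros has_vector_derivative_Pair simp: zero_prod_def)
    then show "\<exists>c r K. (\<forall>f. dpd I (Some i) f p = vector_derivative (\<lambda>r. f (c r)) (at r within K)) \<and>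
      c r = p \<and> r \<in> K \<and> c ` K \<subseteq> I \<times> J \<times> U \<and> (c has_vector_derivative (0, 0, axis i 1)) (at r within K) \<and> at r within K \<noteq> bot"
      using p at_within_line[OF U p(4), of "axis i 1"]
      by (intro exI[of _ "\<lambda>r. (t, s, x + r *\<^sub>R axis i 1)"] exI[of _ 0] exI[of _ "{r. x + r *\<^sub>R axis i 1 \<in> U}"])
         (auto simp: dpd_simps)
  qed
  then show ?thesis using Some by blast
qed

lemma directional_dvar: "directional (I \<times> J \<times> U) dvar (0, 1, 0)"
proof (rule directionalI)
  fix p assume "p \<in> I \<times> J \<times> U"
  then obtain t s x where p: "p = (t, s, x)" "t \<in> I" "s \<in> J" "x \<in> U" by auto
  have "((\<lambda>\<sigma>. (t, \<sigma>, x)) has_vector_derivative (0, 1, 0)) (at s within J)"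
    by (auto intro!: derivative_eq_intros has_vector_derivative_Pair simp: zero_prod_def)
  then show "\<exists>c r K. (\<forall>f. dvar f p = vector_derivative (\<lambda>r. f (c r)) (at r within K)) \<and>
    c r = p \<and> r \<in> K \<and> c ` K \<subseteq> I \<times> J \<times> U \<and> (c has_vector_derivative (0, 1, 0)) (at r within K) \<and> at r within K \<noteq> bot"
    using p at_within_open[OF p(3) J(1)]
    by (intro exI[of _ "\<lambda>\<sigma>. (t, \<sigma>, x)"] exI[of _ s] exI[of _ J]) (auto simp: dvar_def)
qed

lemma smooth_calculus_dpd:
  "smooth_calculus (smooth_on (I \<times> J \<times> U)) (I \<times> J \<times> U) (I \<times> {0} \<times> U) (dpd I) dvar"
proof (intro smooth_calculus.intro smooth_calculus_axioms.intro)
  show "smooth_functions (smooth_on (I \<times> J \<times> U) :: ('n dpt \<Rightarrow> real) \<Rightarrow> bool)"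
    by (rule smooth_functions_smooth_on)
  show "derivation (I \<times> J \<times> U) (smooth_on (I \<times> J \<times> U)) (dpd I a)" for a
  proof -
    obtain v where v: "directional (I \<times> J \<times> U) (dpd I a) v"
      using directional_dpd by blast
    show ?thesis
      by (rule directional_derivation[OF v dpd_cong])
  qed
  show "derivation (I \<times> J \<times> U) (smooth_on (I \<times> J \<times> U)) dvar"
    by (rule directional_derivation[OF directional_dvar dvar_cong])
  show "dpd I a (dpd I b f) p = dpd I b (dpd I a f) p"
    if "smooth_on (I \<times> J \<times> U) f" "p \<in> I \<times> J \<times> U" for f p a b
    using directional_dpd directional_commute that by blast
  show "dvar (dpd I a f) p = dpd I a (dvar f) p"
    if "smooth_on (I \<times> J \<times> U) f" "p \<in> I \<times> J \<times> U" for f p a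
    using directional_dpd directional_dvar directional_commute that by blast
  show "p \<in> I \<times> J \<times> U" if "p \<in> I \<times> {0} \<times> U" for p
    using that J by auto
  show "dpd I a f p = dpd I a f' p" if "\<And>q. q \<in> I \<times> {0} \<times> U \<Longrightarrow> f q = f' q" "p \<in> I \<times> {0} \<times> U" for f f' p a
    using that by (rule dpd_cong)
qed

text \<open>\<open>dvar\<close> is the value of a total operator; smoothness shows that the
  derivative really exists.\<close>

lemma has_real_derivative_dvar:
  assumes f: "smooth_on (I \<times> J \<times> U) f" and p: "(t, s, x) \<in> I \<times> J \<times> U"
  shows "((\<lambda>\<sigma>. f (t, \<sigma>, x)) has_real_derivative dvar f (t, s, x)) (at s)"
proof -
  obtain V F where "open V" "(t, s, x) \<in> V" "\<forall>k. Ck_on k V F" "\<forall>y. y \<in> I \<times> J \<times> U \<longrightarrow> y \<in> V \<longrightarrow> F y = f y"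
    using smooth_onE[OF f p] .
  note F = this(1,2) this(3,4)[rule_format]
  have "((\<lambda>\<sigma>. (t, \<sigma>, x)) has_vector_derivative (0, 1, 0)) (at s within J)"
    by (auto intro!: derivative_eq_intros has_vector_derivative_Pair simp: zero_prod_def)
  then have "((\<lambda>\<sigma>. f (t, \<sigma>, x)) has_vector_derivative frechet_derivative F (at (t, s, x)) (0, 1, 0)) (at s within J)"
    using p F by (intro has_vector_derivative_along[where S = "I \<times> J \<times> U" and V = V]) auto
  moreover have "dvar f (t, s, x) = frechet_derivative F (at (t, s, x)) (0, 1, 0)"
    using directionalD[OF directional_dvar F(1) p F(2,3,4)] .
  ultimately show ?thesis
    using p at_within_open[OF _ J(1)] by (auto simp: has_real_derivative_iff_has_vector_derivative)
qed

end

section \<open>Locality\<close>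

text \<open>Serves to replace g(t,0) and its variation by the given families, with which they agree
  on the chart image and for times in the interval only.\<close>

locale local_pderiv =
  fixes S :: "'p set" and D :: "('i::finite, 'p) pderiv"
  assumes D_cong: "(\<And>q. q \<in> S \<Longrightarrow> f q = f' q) \<Longrightarrow> p \<in> S \<Longrightarrow> D a f p = D a f' p"
begin

lemma curv_cong:
  assumes "\<And>q k i j. q \<in> S \<Longrightarrow> C q k i j = C' q k i j" "p \<in> S"
  shows "curv D C p = curv D C' p"
proof -
  have "D a (\<lambda>q. C q l i j) p = D a (\<lambda>q. C' q l i j) p" for a l i j
    using assms by (intro D_cong)
  then show ?thesis
    using assms by (simp add: curv_def fun_eq_iff)
qed

lemma ric_cong:
  assumes "\<And>q k i j. q \<in> S \<Longrightarrow> C q k i j = C' q k i j" "p \<in> S"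
  shows "ric D C p = ric D C' p"
  by (simp add: ric_def fun_eq_iff curv_cong[OF assms])

lemma cov1_cong:
  assumes "\<And>q k i j. q \<in> S \<Longrightarrow> C q k i j = C' q k i j"
    and "\<And>q j. q \<in> S \<Longrightarrow> w q j = w' q j" "p \<in> S"
  shows "cov1 D C w p = cov1 D C' w' p"
proof -
  have "D a (\<lambda>q. w q j) p = D a (\<lambda>q. w' q j) p" for a j
    using assms by (intro D_cong)
  then show ?thesis
    using assms by (simp add: cov1_def fun_eq_iff)
qed

lemma cov2_cong:
  assumes "\<And>q k i j. q \<in> S \<Longrightarrow> C q k i j = C' q k i j"
    and "\<And>q i j. q \<in> S \<Longrightarrow> h q i j = h' q i j" "p \<in> S"
  shows "cov2 D C h p = cov2 D C' h' p"
proof -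
  have "D a (\<lambda>q. h q i j) p = D a (\<lambda>q. h' q i j) p" for a i j
    using assms by (intro D_cong)
  then show ?thesis
    using assms by (simp add: cov2_def fun_eq_iff)
qed

lemma cov3_cong:
  assumes "\<And>q k i j. q \<in> S \<Longrightarrow> C q k i j = C' q k i j"
    and "\<And>q a i j. q \<in> S \<Longrightarrow> h q a i j = h' q a i j" "p \<in> S"
  shows "cov3 D C h p = cov3 D C' h' p"
proof -
  have "D a (\<lambda>q. h q b i j) p = D a (\<lambda>q. h' q b i j) p" for a b i j
    using assms by (intro D_cong)
  then show ?thesis
    using assms by (simp add: cov3_def fun_eq_iff)
qed

end

context
  fixes I :: "real set" and U :: "(real^'n::finite) set"
  assumes U: "open U"
begin

lemma st_pd_cong:
  assumes "\<And>q. q \<in> I \<times> U \<Longrightarrow> f q = f' q" "p \<in> I \<times> U"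
  shows "st_pd I a f p = st_pd I a f' p"
proof -
  obtain t x where p: "p = (t, x)" "t \<in> I" "x \<in> U"
    using assms(2) by auto
  have *: "vector_derivative (\<lambda>r. f (t, x + r *\<^sub>R axis i 1)) (at 0 within {r. x + r *\<^sub>R axis i 1 \<in> U}) =
      vector_derivative (\<lambda>r. f' (t, x + r *\<^sub>R axis i 1)) (at 0 within {r. x + r *\<^sub>R axis i 1 \<in> U})" for i
    using assms(1) p by (intro vector_derivative_cong_within) auto
  have "at 0 within {r. x + r *\<^sub>R axis i 1 \<in> U} = at 0" for i
    by (rule at_within_line[OF U p(3)])
  with * show ?thesis
    using p assms(1) by (auto simp: st_pd_def pd_def intro!: vector_derivative_cong_within split: option.split)
qed

lemma pd_cong:
  assumes "\<And>y. y \<in> U \<Longrightarrow> f y = f' y" "x \<in> U"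
  shows "pd i f x = pd i f' x"
proof -
  have *: "vector_derivative (\<lambda>r. f (x + r *\<^sub>R axis i 1)) (at 0 within {r. x + r *\<^sub>R axis i 1 \<in> U}) =
      vector_derivative (\<lambda>r. f' (x + r *\<^sub>R axis i 1)) (at 0 within {r. x + r *\<^sub>R axis i 1 \<in> U})"
    using assms by (intro vector_derivative_cong_within) auto
  have "at 0 within {r. x + r *\<^sub>R axis i 1 \<in> U} = at 0"
    by (rule at_within_line[OF U assms(2)])
  with * show ?thesis
    by (simp add: pd_def)
qed

lemma local_pderiv_pd: "local_pderiv U pd"
  by unfold_locales (rule pd_cong)

lemma local_pderiv_st_pd: "local_pderiv (I \<times> U) (st_pd I)"
  by unfold_locales (rule st_pd_cong)

interpretation pd: local_pderiv U pd
  by (rule local_pderiv_pd)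

interpretation st_pd: local_pderiv "I \<times> U" "st_pd I"
  by (rule local_pderiv_st_pd)

context
  fixes G G' h h' :: "real \<Rightarrow> 'n lmetric"
  assumes G: "\<And>t x. t \<in> I \<Longrightarrow> x \<in> U \<Longrightarrow> G t x = G' t x"
    and h: "\<And>t x. t \<in> I \<Longrightarrow> x \<in> U \<Longrightarrow> h t x = h' t x"
begin

lemma ginv_cong: "t \<in> I \<Longrightarrow> x \<in> U \<Longrightarrow> ginv (G t) x = ginv (G' t) x"
  by (simp add: ginv_def G fun_eq_iff)

lemma christoffel_cong: 
  assumes "t \<in> I" "x \<in> U"
  shows "christoffel (G t) x = christoffel (G' t) x"
proof -
  have "pd a (\<lambda>y. G t y $ i $ j) x = pd a (\<lambda>y. G' t y $ i $ j) x" for a i j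
    using assms by (intro pd.D_cong) (simp_all add: G)
  then show ?thesis
    using assms by (simp add: christoffel_def fun_eq_iff ginv_cong)
qed

lemma Rc_cong: "t \<in> I \<Longrightarrow> x \<in> U \<Longrightarrow> Rc (G t) x = Rc (G' t) x"
  unfolding Rc_def by (intro pd.ric_cong) (simp_all add: christoffel_cong)

lemma scal_cong: "t \<in> I \<Longrightarrow> x \<in> U \<Longrightarrow> scal (G t) x = scal (G' t) x"
  by (simp add: scal_def Rc_cong ginv_cong)

lemma W_up_self: "W_up B B x k = 0"
  by (simp add: W_up_def)

lemma W_low_self: "W_low B B x k = 0"
  by (simp add: W_low_def W_up_self)

lemma W_normsq_self: "W_normsq B B x = 0"
  by (simp add: W_normsq_def W_up_self)

text \<open>With the metric as its own background all terms in W vanish identically, including the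
  time derivative; purely spatial quantities remain.\<close>

lemma st_conn_cong:
  assumes p: "p \<in> I \<times> U"
  shows "st_conn I G G p = st_conn I G' G' p"
proof -
  obtain t x where tx: "p = (t, x)" "t \<in> I" "x \<in> U"
    using p by auto
  have "pd l (scal (G t)) x = pd l (scal (G' t)) x" for l
    using tx by (intro pd.D_cong) (simp_all add: scal_cong)
  then show ?thesis
    using tx
    by (simp add: st_conn_def fun_eq_iff christoffel_cong st_conn_mixed_def st_conn_time_def ginv_cong
        Rc_cong W_up_self W_low_self W_normsq_self split: option.split)
qed

lemma div2_cong: 
  assumes "t \<in> I" "x \<in> U"
  shows "div2 (G t) (h t) x = div2 (G' t) (h' t) x"
proof -
  have "cov2 pd (christoffel (G t)) (\<lambda>y a b. h t y $ a $ b) x = cov2 pd (christoffel (G' t)) (\<lambda>y a b. h' t y $ a $ b) x"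
    using assms by (intro pd.cov2_cong) (simp_all add: christoffel_cong h)
  then show ?thesis
    using assms by (simp add: div2_def fun_eq_iff ginv_cong)
qed

lemma st_ext_cong:
  assumes p: "p \<in> I \<times> U"
  shows "st_ext G h p = st_ext G' h' p"
proof -
  obtain t x where tx: "p = (t, x)" "t \<in> I" "x \<in> U"
    using p by auto
  have "cov1 pd (christoffel (G t)) (div2 (G t) (h t)) x = cov1 pd (christoffel (G' t)) (div2 (G' t) (h' t)) x"
    using tx by (intro pd.cov1_cong) (simp_all add: christoffel_cong div2_cong)
  then show ?thesis
    using tx
    by (simp add: st_ext_def fun_eq_iff Let_def div2_cong div1_def Rc_dot_def ginv_cong Rc_cong h split: option.split)
qed

lemma st_linearized_rhs_cong:
  assumes p: "p \<in> I \<times> U"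
  shows "st_linearized_rhs I G h p i j = st_linearized_rhs I G' h' p i j"
proof -
  have "st_ginv G p = st_ginv G' p"
    using p by (auto simp: st_ginv_def fun_eq_iff ginv_cong split: option.split)
  moreover have "cov3 (st_pd I) (st_conn I G G) (cov2 (st_pd I) (st_conn I G G) (st_ext G h)) p =
      cov3 (st_pd I) (st_conn I G' G') (cov2 (st_pd I) (st_conn I G' G') (st_ext G' h')) p"
    using p by (intro st_pd.cov3_cong) (simp_all add: st_conn_cong st_ext_cong cong: st_pd.cov2_cong)
  moreover have "curv (st_pd I) (st_conn I G G) p = curv (st_pd I) (st_conn I G' G') p"
    using p by (intro st_pd.curv_cong) (simp_all add: st_conn_cong)
  moreover have "ric (st_pd I) (st_conn I G G) p = ric (st_pd I) (st_conn I G' G') p"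
    using p by (intro st_pd.ric_cong) (simp_all add: st_conn_cong)
  ultimately show ?thesis
    using p by (simp add: st_linearized_rhs_def laplace2_def Let_def st_ext_cong)
qed

end

end

section \<open>Positive definite matrices\<close>

lemma positive_definite_invertible:
  fixes A :: "real^'n^'n"
  assumes "\<And>v. v \<noteq> 0 \<Longrightarrow> 0 < v \<bullet> (A *v v)"
  shows "invertible A"
proof -
  have "x = 0" if "A *v x = 0" for x
    using assms[of x] that by force
  then show ?thesis
    using matrix_left_invertible_ker invertible_left_inverse by blast
qed

lemma invertible_matrix_inv:
  fixes A :: "real^'n^'n"
  assumes "invertible A"
  shows "A ** matrix_inv A = mat 1" "matrix_inv A ** A = mat 1"
proof -
  have "A ** matrix_inv A = mat 1 \<and> matrix_inv A ** A = mat 1"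
    unfolding matrix_inv_def using assms unfolding invertible_def by (rule someI_ex)
  then show "A ** matrix_inv A = mat 1" "matrix_inv A ** A = mat 1" by auto
qed

lemma symmetric_matrix_inv:
  fixes A :: "real^'n^'n"
  assumes A: "invertible A" and sym: "transpose A = A"
  shows "transpose (matrix_inv A) = matrix_inv A"
proof -
  have "transpose (matrix_inv A) ** A = mat 1"
    using invertible_matrix_inv(1)[OF A] sym by (metis matrix_transpose_mul transpose_mat)
  then show ?thesis
    using invertible_matrix_inv(1)[OF A] by (metis matrix_mul_assoc matrix_mul_lid matrix_mul_rid)
qed

text \<open>Cramer's rule exhibits the inverse as a rational function of the entries, whence its
  smoothness in \<open>smooth_gu\<close>.\<close>

lemma matrix_inv_cramer:
  fixes A :: "real^'n^'n"
  assumes A: "invertible A"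
  shows "matrix_inv A $ k $ j = det (\<chi> i l. if l = k then if i = j then 1 else 0 else A $ i $ l) * inverse (det A)"
proof -
  have *: "A *v column j (matrix_inv A) = axis j 1"
    using invertible_matrix_inv(1)[OF A] by (metis matrix_vector_mul_assoc matrix_vector_mul_lid matrix_vector_mult_basis)
  have "det A \<noteq> 0"
    using A by (simp add: invertible_det_nz)
  from iffD1[OF cramer[OF this] *] have "column j (matrix_inv A) =
      (\<chi> k. det (\<chi> i l. if l = k then axis j 1 $ i else A $ i $ l) / det A)"
    .
  then have "column j (matrix_inv A) $ k = det (\<chi> i l. if l = k then axis j 1 $ i else A $ i $ l) / det A"
    by simp
  moreover have "(axis j (1::real) :: real^'n) $ i = (if i = j then 1 else 0)" for i
    by (simp add: axis_def)
  ultimately show ?thesis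
    by (simp add: column_def divide_inverse cong: if_cong)
qed

section \<open>Metrics depending on three parameters\<close>

lemma at_within_time_ivl:
  assumes t: "t \<in> time_ivl T"
  shows "at t within time_ivl T \<noteq> bot"
proof -
  \<comment> \<open>A time u beyond t, also when T is infinite; the segment from t to u shows that t
    is not isolated.\<close>
  obtain u where u: "t < u" "ereal u < T"
    using t ereal_dense2[of "ereal t" T] by (auto simp: time_ivl_def)
  have "{t..u} \<subseteq> time_ivl T"
    using t u by (auto simp: time_ivl_def intro: le_less_trans[of _ "ereal u"])
  moreover have "at t within {t..u} \<noteq> bot"
    using u(1) by (simp add: trivial_limit_within islimpt_Icc)
  ultimately show ?thesis
    by (metis at_le bot.extremum_uniqueI)
qed

lemma Ck_on_compose_linear:
  fixes F :: "'b::euclidean_space \<Rightarrow> 'c::euclidean_space" and L :: "'a::euclidean_space \<Rightarrow> 'b"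
  assumes L: "bounded_linear L" and V: "open V" and W: "open W" "L ` W \<subseteq> V"
  shows "Ck_on k V F \<Longrightarrow> Ck_on k W (\<lambda>x. F (L x))"
proof (induction k arbitrary: F)
  case 0
  then show ?case
    using W bounded_linear.continuous_on[OF L continuous_on_id]
    by (auto intro: continuous_on_compose2)
next
  case (Suc k)
  show ?case
  proof (rule Ck_on_SucI[OF W(1)])
    show "((\<lambda>x. F (L x)) has_derivative (\<lambda>v. frechet_derivative F (at (L x)) (L v))) (at x)" if "x \<in> W" for x
      using has_derivative_compose[OF bounded_linear_imp_has_derivative[OF L] Ck_on_has_derivative[OF Suc.prems]]
        that W by auto
    show "Ck_on k W (\<lambda>x. frechet_derivative F (at (L x)) (L v))" for v
      using Suc.prems Suc.IH[of "\<lambda>y. frechet_derivative F (at y) (L v)"] by simp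
  qed
qed

text \<open>Meant for the projection of (t, s, x) to (t, 0, x), which makes the background
  connection smooth.\<close>

lemma smooth_on_compose_linear:
  assumes L: "bounded_linear L" and S: "L ` S' \<subseteq> S" and f: "smooth_on S f"
  shows "smooth_on S' (\<lambda>x. f (L x))"
proof (rule smooth_onI)
  fix x assume x: "x \<in> S'"
  then have "L x \<in> S" using S by auto
  obtain V F where "open V" "L x \<in> V" "\<forall>k. Ck_on k V F" "\<forall>y. y \<in> S \<longrightarrow> y \<in> V \<longrightarrow> F y = f y"
    using smooth_onE[OF f \<open>L x \<in> S\<close>] .
  note F = this(1,2) this(3,4)[rule_format]
  have "open (L -` V)"
    using F(1) bounded_linear.continuous_on[OF L continuous_on_id] by (rule open_vimage)
  moreover have "Ck_on k (L -` V) (\<lambda>x. F (L x))" for k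
    using calculation F by (intro Ck_on_compose_linear[OF L F(1)]) auto
  ultimately show "\<exists>V G. open V \<and> x \<in> V \<and> (\<forall>k. Ck_on k V G) \<and> (\<forall>y\<in>S' \<inter> V. G y = f (L y))"
    using F S by (intro exI[of _ "L -` V"] exI[of _ "\<lambda>x. F (L x)"]) auto
qed

section \<open>Dictionary between the three-parameter operators and those on space and
  space-time\<close>

lemma dpd_Some_pd: "dpd I (Some i) f (t, s, x) = pd i (\<lambda>y. f (t, s, y)) x"
  by (simp add: dpd_def st_pd_def)

lemma dpd_st_pd: "dpd I a f (t, s, x) = st_pd I a (\<lambda>p. f (fst p, s, snd p)) (t, x)"
  by (simp add: dpd_def)

lemma curv_dpd: "curv (dpd I) C (t, s, x) = curv (st_pd I) (\<lambda>p. C (fst p, s, snd p)) (t, x)"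
  by (simp add: curv_def dpd_st_pd fun_eq_iff)

lemma ric_dpd: "ric (dpd I) C (t, s, x) = ric (st_pd I) (\<lambda>p. C (fst p, s, snd p)) (t, x)"
  by (simp add: ric_def curv_dpd fun_eq_iff)

lemma cov1_dpd: "cov1 (dpd I) C w (t, s, x) = cov1 (st_pd I) (\<lambda>p. C (fst p, s, snd p)) (\<lambda>p. w (fst p, s, snd p)) (t, x)"
  by (simp add: cov1_def dpd_st_pd fun_eq_iff)

lemma cov2_dpd: "cov2 (dpd I) C h (t, s, x) = cov2 (st_pd I) (\<lambda>p. C (fst p, s, snd p)) (\<lambda>p. h (fst p, s, snd p)) (t, x)"
  by (simp add: cov2_def dpd_st_pd fun_eq_iff)

lemma cov3_dpd: "cov3 (dpd I) C h (t, s, x) = cov3 (st_pd I) (\<lambda>p. C (fst p, s, snd p)) (\<lambda>p. h (fst p, s, snd p)) (t, x)"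
  by (simp add: cov3_def dpd_st_pd fun_eq_iff)

lemma ric_pd: "ric (\<lambda>i. dpd I (Some i)) C (t, s, x) = ric pd (\<lambda>y. C (t, s, y)) x"
  by (simp add: ric_def curv_def dpd_Some_pd fun_eq_iff)

lemma cov1_pd: "cov1 (\<lambda>i. dpd I (Some i)) C w (t, s, x) = cov1 pd (\<lambda>y. C (t, s, y)) (\<lambda>y. w (t, s, y)) x"
  by (simp add: cov1_def dpd_Some_pd fun_eq_iff)

lemma cov2_pd: "cov2 (\<lambda>i. dpd I (Some i)) C h (t, s, x) = cov2 pd (\<lambda>y. C (t, s, y)) (\<lambda>y. h (t, s, y)) x"
  by (simp add: cov2_def dpd_Some_pd fun_eq_iff)

section \<open>A metric family in one chart as an instance of the abstract calculus\<close>

context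
  fixes I J :: "real set" and U :: "(real^'n::finite) set" and G :: "real \<Rightarrow> real \<Rightarrow> 'n lmetric"
begin

definition metric_comp :: "'n dpt \<Rightarrow> 'n \<Rightarrow> 'n \<Rightarrow> real" where
  "metric_comp q i j = G (fst q) (fst (snd q)) (snd (snd q)) $ i $ j"

definition inv_metric_comp :: "'n dpt \<Rightarrow> 'n \<Rightarrow> 'n \<Rightarrow> real" where
  "inv_metric_comp q i j = ginv (G (fst q) (fst (snd q))) (snd (snd q)) i j"

definition background_conn :: "('n, 'n dpt) conn" where
  "background_conn q k i j = christoffel (G (fst q) 0) (snd (snd q)) k i j"

definition variation_comp :: "real \<Rightarrow> 'n lmetric" where
  "variation_comp t x = (\<chi> i j. dvar (\<lambda>q. metric_comp q i j) (t, 0, x))"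

context
  assumes I: "\<And>t. t \<in> I \<Longrightarrow> at t within I \<noteq> bot" and J: "open J" "0 \<in> J" and U: "open U"
    and smooth: "smooth_on (I \<times> J \<times> U) (\<lambda>(t, s, x). G t s x)"
    and sym: "\<And>t s x i j. t \<in> I \<Longrightarrow> s \<in> J \<Longrightarrow> x \<in> U \<Longrightarrow> G t s x $ i $ j = G t s x $ j $ i"
    and pos: "\<And>t s x v. t \<in> I \<Longrightarrow> s \<in> J \<Longrightarrow> x \<in> U \<Longrightarrow> v \<noteq> 0 \<Longrightarrow> 0 < v \<bullet> (G t s x *v v)"
begin

lemma calculus:
  "smooth_calculus (smooth_on (I \<times> J \<times> U)) (I \<times> J \<times> U) (I \<times> {0} \<times> U) (dpd I) dvar"
  by (rule smooth_calculus_dpd[OF I J U])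

interpretation smooth_calculus "smooth_on (I \<times> J \<times> U)" "I \<times> J \<times> U" "I \<times> {0} \<times> U" "dpd I" dvar
  by (rule calculus)

lemma smooth_gl: "smooth_on (I \<times> J \<times> U) (\<lambda>q. metric_comp q i j)"
proof -
  have "bounded_linear (\<lambda>M :: real^'n^'n. M $ i $ j)"
    by (intro bounded_linear_compose[OF bounded_linear_vec_nth] bounded_linear_vec_nth)
  from smooth_on_linear[OF this smooth] show ?thesis
    by (simp add: metric_comp_def case_prod_unfold)
qed

lemma invertible_G: "t \<in> I \<Longrightarrow> s \<in> J \<Longrightarrow> x \<in> U \<Longrightarrow> invertible (G t s x)"
  by (intro positive_definite_invertible pos)

lemma smooth_det:
  fixes M :: "'n dpt \<Rightarrow> 'n \<Rightarrow> 'n \<Rightarrow> real"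
  assumes "\<And>i j. smooth_on (I \<times> J \<times> U) (\<lambda>q. M q i j)"
  shows "smooth_on (I \<times> J \<times> U) (\<lambda>q. det (\<chi> i j. M q i j))"
  unfolding det_def using assms by simp

lemma smooth_gu: "smooth_on (I \<times> J \<times> U) (\<lambda>q. inv_metric_comp q i j)"
proof -
  have metric_comp: "(\<chi> i j. metric_comp q i j) = G (fst q) (fst (snd q)) (snd (snd q))" for q
    by (simp add: metric_comp_def vec_eq_iff)
  have det: "smooth_on (I \<times> J \<times> U) (\<lambda>q. inverse (det (\<chi> i j. metric_comp q i j)))"
    using invertible_G by (intro smooth_on_inverse smooth_det smooth_gl) (auto simp: metric_comp invertible_det_nz)
  have "smooth_on (I \<times> J \<times> U) (\<lambda>q. if b then c else metric_comp q k l)" for b c k l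
    by (cases b) (simp_all add: smooth_gl)
  then have "smooth_on (I \<times> J \<times> U) (\<lambda>q. det (\<chi> k l. if l = i then if k = j then 1 else 0 else metric_comp q k l) *
      inverse (det (\<chi> i j. metric_comp q i j)))"
    by (intro sm_mult det smooth_det)
  moreover have "inv_metric_comp q i j = det (\<chi> k l. if l = i then if k = j then 1 else 0 else metric_comp q k l) *
      inverse (det (\<chi> i j. metric_comp q i j))" if "q \<in> I \<times> J \<times> U" for q
    using that unfolding inv_metric_comp_def ginv_def metric_comp
    by (subst matrix_inv_cramer) (auto simp: invertible_G metric_comp_def cong: if_cong)
  ultimately show ?thesis
    using smooth_on_cong[of "I \<times> J \<times> U" "\<lambda>q. inv_metric_comp q i j"] by simp
qed

lemma christoffel_eq: "christoffel (G t s) x k i j = 1/2 * (\<Sum>l\<in>UNIV. inv_metric_comp (t, s, x) k l *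
    (dpd I (Some i) (\<lambda>q. metric_comp q j l) (t, s, x) + dpd I (Some j) (\<lambda>q. metric_comp q i l) (t, s, x)
     - dpd I (Some l) (\<lambda>q. metric_comp q i j) (t, s, x)))"
  by (simp add: christoffel_def inv_metric_comp_def metric_comp_def dpd_Some_pd)

lemma smooth_\<Gamma>0: "smooth_on (I \<times> J \<times> U) (\<lambda>q. background_conn q k i j)"
proof -
  have "smooth_on (I \<times> J \<times> U) (\<lambda>q. 1/2 * (\<Sum>l\<in>UNIV. inv_metric_comp q k l *
    (dpd I (Some i) (\<lambda>q. metric_comp q j l) q + dpd I (Some j) (\<lambda>q. metric_comp q i l) q - dpd I (Some l) (\<lambda>q. metric_comp q i j) q)))"
    by (simp add: smooth_gl smooth_gu)
  moreover have "bounded_linear (\<lambda>q :: 'n dpt. (fst q, 0 :: real, snd (snd q)))"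
    by (intro bounded_linear_Pair bounded_linear_fst bounded_linear_zero bounded_linear_compose[OF bounded_linear_snd] bounded_linear_snd)
  ultimately have "smooth_on (I \<times> J \<times> U) (\<lambda>q. 1/2 * (\<Sum>l\<in>UNIV. inv_metric_comp (fst q, 0, snd (snd q)) k l *
    (dpd I (Some i) (\<lambda>q. metric_comp q j l) (fst q, 0, snd (snd q)) + dpd I (Some j) (\<lambda>q. metric_comp q i l) (fst q, 0, snd (snd q))
     - dpd I (Some l) (\<lambda>q. metric_comp q i j) (fst q, 0, snd (snd q)))))"
    using J by (elim smooth_on_compose_linear[rotated 2]) auto
  then show ?thesis
    by (simp add: background_conn_def christoffel_eq)
qed

lemma metric_family:
  "metric_family (smooth_on (I \<times> J \<times> U)) (I \<times> J \<times> U) (I \<times> {0} \<times> U) (dpd I) dvar metric_comp inv_metric_comp background_conn"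
proof (intro metric_family.intro metric_family_axioms.intro calculus smooth_gl smooth_gu smooth_\<Gamma>0)
  fix q i j assume "q \<in> I \<times> J \<times> U"
  then obtain t s x where q: "q = (t, s, x)" "t \<in> I" "s \<in> J" "x \<in> U" by auto
  note inv = invertible_matrix_inv[OF invertible_G[OF q(2-4)]]
  show "metric_comp q i j = metric_comp q j i"
    using q sym by (simp add: metric_comp_def)
  show "(\<Sum>k\<in>UNIV. inv_metric_comp q i k * metric_comp q k j) = (if i = j then 1 else 0)"
    using arg_cong[OF inv(2), of "\<lambda>M. M $ i $ j"] q
    by (simp add: inv_metric_comp_def metric_comp_def ginv_def matrix_matrix_mult_def mat_def)
  show "(\<Sum>k\<in>UNIV. metric_comp q i k * inv_metric_comp q k j) = (if i = j then 1 else 0)"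
    using arg_cong[OF inv(1), of "\<lambda>M. M $ i $ j"] q
    by (simp add: inv_metric_comp_def metric_comp_def ginv_def matrix_matrix_mult_def mat_def)
  have "transpose (G t s x) = G t s x"
    using q sym by (simp add: transpose_def vec_eq_iff)
  from symmetric_matrix_inv[OF invertible_G[OF q(2-4)] this]
  have "transpose (matrix_inv (G t s x)) $ i $ j = matrix_inv (G t s x) $ i $ j"
    by simp
  then show "inv_metric_comp q i j = inv_metric_comp q j i"
    using q by (simp add: inv_metric_comp_def ginv_def transpose_def)
qed

interpretation F: metric_family "smooth_on (I \<times> J \<times> U)" "I \<times> J \<times> U" "I \<times> {0} \<times> U" "dpd I" dvar metric_comp inv_metric_comp background_conn
  by (rule metric_family)

lemma \<Gamma>_eq: "F.\<Gamma> (t, s, x) = christoffel (G t s) x"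
  by (simp add: fun_eq_iff F.\<Gamma>_def christoffel_eq)

lemma Ric_eq: "F.Ric (t, s, x) = Rc (G t s) x"
  by (simp add: ric_pd \<Gamma>_eq Rc_def)

lemma Wu_eq: "F.Wu (t, s, x) = W_up (G t s) (G t 0) x"
  by (simp add: fun_eq_iff F.Wu_def W_up_def \<Gamma>_eq background_conn_def inv_metric_comp_def)

lemma Wl_eq: "F.Wl (t, s, x) = W_low (G t s) (G t 0) x"
  by (simp add: fun_eq_iff F.Wl_def W_low_def Wu_eq metric_comp_def)

lemma Wsq_eq: "F.Wsq (t, s, x) = W_normsq (G t s) (G t 0) x"
  by (simp add: F.Wsq_def W_normsq_def Wu_eq metric_comp_def)

lemma sc_eq: "F.sc (t, s, x) = scal (G t s) x"
  by (simp add: F.sc_def scal_def Ric_eq inv_metric_comp_def)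


context
  assumes flow: "\<And>t s x i j. t \<in> I \<Longrightarrow> s \<in> J \<Longrightarrow> x \<in> U \<Longrightarrow>
    ((\<lambda>\<tau>. G \<tau> s x $ i $ j) has_real_derivative
       - 2 * Rc (G t s) x i j
       + cov1 pd (christoffel (G t s)) (W_low (G t s) (G t 0)) x i j
       + cov1 pd (christoffel (G t s)) (W_low (G t s) (G t 0)) x j i) (at t within I)"
begin

lemma ricci_deformation:
  "ricci_deformation (smooth_on (I \<times> J \<times> U)) (I \<times> J \<times> U) (I \<times> {0} \<times> U) (dpd I) dvar metric_comp inv_metric_comp background_conn"
proof (intro ricci_deformation.intro ricci_deformation_axioms.intro metric_family)
  fix p :: "'n dpt" and k i j assume "p \<in> I \<times> {0} \<times> U"
  then obtain t x where p: "p = (t, 0, x)" by auto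
  show "background_conn p k i j = F.\<Gamma> p k i j"
    by (simp add: p \<Gamma>_eq background_conn_def)
  show "dvar (\<lambda>q. background_conn q k i j) p = 0"
    by (simp add: p dvar_def background_conn_def)
next
  fix p i j assume "p \<in> I \<times> J \<times> U"
  then obtain t s x where p: "p = (t, s, x)" "t \<in> I" "s \<in> J" "x \<in> U" by auto
  show "dpd I None (\<lambda>q. metric_comp q i j) p =
      - 2 * F.Ric p i j + cov1 F.dx F.\<Gamma> F.Wl p i j + cov1 F.dx F.\<Gamma> F.Wl p j i"
    \<comment> \<open>Since t is not isolated in \<open>I\<close>, the derivative stated by
      \<open>flow\<close> is the value of \<open>vector_derivative\<close>.\<close>
    using vector_derivative_within[OF I[OF p(2)] flow[OF p(2-4), of i j, unfolded has_real_derivative_iff_has_vector_derivative]]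
    by (simp add: p dpd_simps metric_comp_def Ric_eq cov1_pd \<Gamma>_eq Wl_eq)
qed

interpretation R: ricci_deformation "smooth_on (I \<times> J \<times> U)" "I \<times> J \<times> U" "I \<times> {0} \<times> U" "dpd I" dvar metric_comp inv_metric_comp background_conn
  by (rule ricci_deformation)

lemma mixed_eq: "R.mixed (t, s, x) k i = st_conn_mixed (G t s) (G t 0) x k i"
  by (simp add: R.mixed_def st_conn_mixed_def dpd_Some_pd inv_metric_comp_def Ric_eq Wu_eq \<Gamma>_eq)

lemma tim_eq: "R.tim (t, s, x) k = st_conn_time I (\<lambda>t. G t s) (\<lambda>t. G t 0) (t, x) k"
  by (simp add: R.tim_def st_conn_time_def dpd_Some_pd dpd_simps(1) inv_metric_comp_def sc_eq Wsq_eq Wl_eq)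

lemma stC_eq: "R.stC (t, s, x) = st_conn I (\<lambda>t. G t s) (\<lambda>t. G t 0) (t, x)"
  by (simp add: fun_eq_iff R.stC_def st_conn_def \<Gamma>_eq mixed_eq tim_eq split: option.split)

lemma stW_eq: "R.stW (t, s, x) = st_W (\<lambda>t. G t s) (\<lambda>t. G t 0) (t, x)"
  by (simp add: fun_eq_iff R.stW_def st_W_def div1_def inv_metric_comp_def cov1_pd \<Gamma>_eq Wl_eq split: option.split)

lemma stg_eq: "R.stg (t, s, x) = st_ginv (\<lambda>t. G t s) (t, x)"
  by (simp add: fun_eq_iff R.stg_def st_ginv_def inv_metric_comp_def split: option.split)

text \<open>\<open>variation_comp\<close> is the derivative at s = 0, so this and the
  identifications built on it are confined to the slice.\<close>

lemma hs_eq: "F.hs (t, 0, x) = (\<lambda>i j. variation_comp t x $ i $ j)"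
  by (simp add: fun_eq_iff F.hs_def variation_comp_def)

lemma dv_eq: "R.dv (t, 0, x) = div2 (G t 0) (variation_comp t) x"
  by (simp add: fun_eq_iff R.dv_def div2_def inv_metric_comp_def cov2_pd \<Gamma>_eq hs_eq)

lemma hh_eq: "R.hh (t, 0, x) = st_ext (\<lambda>t. G t 0) variation_comp (t, x)"
  by (simp add: fun_eq_iff R.hh_def st_ext_def Let_def hs_eq dv_eq R.dvdv_def div1_def inv_metric_comp_def cov1_pd
      \<Gamma>_eq R.Rh_def Rc_dot_def Ric_eq split: option.split)

theorem variation_st_flow_rhs:
  assumes t: "t \<in> I" and x: "x \<in> U"
  shows "((\<lambda>s. st_flow_rhs I (\<lambda>t. G t s) (\<lambda>t. G t 0) (t, x) i j) has_real_derivative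
    st_linearized_rhs I (\<lambda>t. G t 0) variation_comp (t, x) i j) (at 0)"
proof -
  define f where "f = (\<lambda>q. - 2 * ric (dpd I) R.stC q i j + cov1 (dpd I) R.stC R.stW q i j
    + cov1 (dpd I) R.stC R.stW q j i)"
  have "smooth_on (I \<times> J \<times> U) f"
    unfolding f_def by simp
  then have "((\<lambda>s. f (t, s, x)) has_real_derivative dvar f (t, 0, x)) (at 0)"
    using t x J by (intro has_real_derivative_dvar[OF I J U]) auto
  moreover have "f (t, s, x) = st_flow_rhs I (\<lambda>t. G t s) (\<lambda>t. G t 0) (t, x) i j" for s
    by (simp add: f_def st_flow_rhs_def ric_dpd cov1_dpd stC_eq stW_eq)
  moreover have "dvar f (t, 0, x) = st_linearized_rhs I (\<lambda>t. G t 0) variation_comp (t, x) i j"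
    using t x unfolding f_def
    by (subst R.st.variation_flow_rhs)
       (simp_all add: st_linearized_rhs_def Let_def laplace2_def ric_dpd curv_dpd cov3_dpd cov2_dpd stC_eq stg_eq hh_eq)
  ultimately show ?thesis by simp
qed

end

end

end

section \<open>Passage from one chart to the given families\<close>

theorem theorem5p1:
  fixes M :: "'m topology"
    and A :: "('m, 'n::finite) chart set"
    and T :: ereal
    and \<epsilon> :: real
    and g\<^sub>0 h\<^sub>0 :: "('m, 'n) tensor2"
    and gt h :: "real \<Rightarrow> ('m, 'n) tensor2"
    and g :: "real \<Rightarrow> real \<Rightarrow> ('m, 'n) tensor2"
  assumes manifold: "smooth_manifold M A"
    and T_pos: "0 < T"
    and eps_pos: "0 < \<epsilon>"
    and g0: "is_metric A g\<^sub>0" "smooth_tensor2 A g\<^sub>0"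
    and h0: "is_sym_tensor2 A h\<^sub>0" "smooth_tensor2 A h\<^sub>0"
    and gt: "\<And>t. t \<in> time_ivl T \<Longrightarrow> is_metric A (gt t)" "smooth_family1 A (time_ivl T) gt"
    and gt_flow: "ricci_flow A (time_ivl T) gt" "tensor2_eq A (gt 0) g\<^sub>0"
    and h: "\<And>t. t \<in> time_ivl T \<Longrightarrow> is_sym_tensor2 A (h t)" "smooth_family1 A (time_ivl T) h"
    and h_flow: "linearized_ricci_flow A (time_ivl T) gt h" "tensor2_eq A (h 0) h\<^sub>0"
    and g: "\<And>t s. t \<in> time_ivl T \<Longrightarrow> s \<in> {-\<epsilon><..<\<epsilon>} \<Longrightarrow> is_metric A (g t s)"
      "smooth_family2 A (time_ivl T) {-\<epsilon><..<\<epsilon>} g"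
    and g_flow: "modified_ricci_flow A (time_ivl T) {-\<epsilon><..<\<epsilon>} g"
    and g_init: "tensor2_eq A (g 0 0) g\<^sub>0" "variation_at_0 A (g 0) h\<^sub>0"
    and g_at_0: "\<And>t. t \<in> time_ivl T \<Longrightarrow> tensor2_eq A (g t 0) (gt t)"
    and g_variation: "\<And>t. t \<in> time_ivl T \<Longrightarrow> variation_at_0 A (g t) (h t)"
  shows "\<forall>c\<in>A. \<forall>t\<in>time_ivl T. \<forall>x\<in>chart_img c. \<forall>i j :: 'n option.
    ((\<lambda>s. st_flow_rhs (time_ivl T) (\<lambda>t. g t s c) (\<lambda>t. g t 0 c) (t, x) i j) has_real_derivative
       st_linearized_rhs (time_ivl T) (\<lambda>t. gt t c) (\<lambda>t. h t c) (t, x) i j) (at 0)"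
proof (intro ballI allI)
  fix c t x and i j :: "'n option"
  assume c: "c \<in> A" and t: "t \<in> time_ivl T" and x: "x \<in> chart_img c"
  define I where "I = time_ivl T"
  define J where "J = {-\<epsilon><..<\<epsilon>}"
  define U where "U = chart_img c"
  define G where "G = (\<lambda>t s. g t s c)"
  have I: "at t within I \<noteq> bot" if "t \<in> I" for t
    using at_within_time_ivl that unfolding I_def by blast
  have J: "open J" "0 \<in> J"
    using eps_pos by (simp_all add: J_def)
  have U: "open U"
    using manifold c by (simp add: smooth_manifold_def is_chart_def U_def)
  have smooth: "smooth_on (I \<times> J \<times> U) (\<lambda>(t, s, x). G t s x)"
    using g(2) c by (simp add: smooth_family2_def I_def J_def U_def G_def)
  have sym: "G t s x $ i $ j = G t s x $ j $ i" if "t \<in> I" "s \<in> J" "x \<in> U" for t s x i j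
    using g(1)[of t s] that c by (simp add: is_metric_def is_sym_tensor2_def I_def J_def U_def G_def)
  have pos: "0 < v \<bullet> (G t s x *v v)" if "t \<in> I" "s \<in> J" "x \<in> U" "v \<noteq> 0" for t s x v
    using g(1)[of t s] that c by (simp add: is_metric_def I_def J_def U_def G_def)
  have flow: "((\<lambda>\<tau>. G \<tau> s x $ i $ j) has_real_derivative
       - 2 * Rc (G t s) x i j
       + cov1 pd (christoffel (G t s)) (W_low (G t s) (G t 0)) x i j
       + cov1 pd (christoffel (G t s)) (W_low (G t s) (G t 0)) x j i) (at t within I)"
    if "t \<in> I" "s \<in> J" "x \<in> U" for t s x i j
    using g_flow that c by (simp add: modified_ricci_flow_def I_def J_def U_def G_def)
  have "((\<lambda>s. st_flow_rhs I (\<lambda>t. G t s) (\<lambda>t. G t 0) (t, x) i j) has_real_derivative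
      st_linearized_rhs I (\<lambda>t. G t 0) (variation_comp G) (t, x) i j) (at 0)"
    using t x by (intro variation_st_flow_rhs[OF I J U smooth sym pos flow]) (simp_all add: I_def U_def)
  \<comment> \<open>The right-hand side is local, so agreement on \<open>I\<close> times
    \<open>U\<close> allows the exchange.\<close>
  also have "st_linearized_rhs I (\<lambda>t. G t 0) (variation_comp G) (t, x) i j =
      st_linearized_rhs I (\<lambda>t. gt t c) (\<lambda>t. h t c) (t, x) i j"
  proof (rule st_linearized_rhs_cong[OF U])
    fix t x assume t: "t \<in> I" and x: "x \<in> U"
    show "G t 0 x = gt t c x"
      using g_at_0[of t] t x c by (simp add: tensor2_eq_def I_def U_def G_def)
    \<comment> \<open>The derivative in s at 0 is unique, which identifies \<open>dvar\<close> of
      the components with h.\<close>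
    have "((\<lambda>s. g t s c x $ i $ j) has_real_derivative h t c x $ i $ j) (at 0)" for i j
      using g_variation[of t] t x c by (simp add: variation_at_0_def I_def U_def)
    then show "variation_comp G t x = h t c x"
      by (simp add: vec_eq_iff variation_comp_def dvar_def metric_comp_def G_def vector_derivative_at
          has_real_derivative_iff_has_vector_derivative)
  qed (use t x in \<open>simp add: I_def U_def\<close>)
  finally show "((\<lambda>s. st_flow_rhs (time_ivl T) (\<lambda>t. g t s c) (\<lambda>t. g t 0 c) (t, x) i j) has_real_derivative
      st_linearized_rhs (time_ivl T) (\<lambda>t. gt t c) (\<lambda>t. h t c) (t, x) i j) (at 0)"
    by (simp add: I_def G_def)
qed

end
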